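(* Let $X$ be a compact metric space, $T\colon X\to X$ a continuous map, and suppose $(X,T)$ is uniquely ergodic with unique $T$-invariant Borel probability measure $\mu$. Then for every $\alpha\in\mathbb{R}$, every $f\in C(X)$ and every $x\in X$, $$\lim_{N\to\infty}\frac1N\sum_{n=1}^N e(n\alpha)\,f\big(T^{\Omega(n)}x\big)=\begin{cases}\int f\,d\mu,&\text{if }\alpha\in\mathbb{Z},\\ 0,&\text{if }\alpha\in\mathbb{R}\setminus\mathbb{Z}.\end{cases}$$
   Context: $e(x)=e^{2\pi ix}$. $\Omega(n)$ denotes the number of prime factors of $n$ counted with multiplicities. $C(X)$ is the space of continuous complex-valued functions on $X$. $(X,T)$ is uniquely ergodic if there is exactly one Borel probability measure $\mu$ on $X$ with $\mu(T^{-1}A)=\mu(A)$ for all Borel $A\subset X$. *)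

theory Defs
  imports "HOL-Probability.Probability" "HOL-Computational_Algebra.Computational_Algebra"
begin

definition e2pi :: "real \<Rightarrow> complex"
  where "e2pi x = exp (2 * of_real pi * \<i> * of_real x)"

definition prime_Omega :: "nat \<Rightarrow> nat"
  where "prime_Omega n = size (prime_factorization n)"

definition invariant_borel_prob :: "('a::topological_space \<Rightarrow> 'a) \<Rightarrow> 'a measure \<Rightarrow> bool"
  where "invariant_borel_prob T M \<longleftrightarrow>
    prob_space M \<and> sets M = sets borel \<and>
    (\<forall>A\<in>sets borel. emeasure M (T -` A) = emeasure M A)"

definition uniquely_ergodic :: "('a::topological_space \<Rightarrow> 'a) \<Rightarrow> bool"
  where "uniquely_ergodic T \<longleftrightarrow> (\<exists>!M. invariant_borel_prob T M)"

end

theory Submission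
  imports Defs "HOL-Complex_Analysis.Complex_Analysis" "HOL-Number_Theory.Number_Theory" "HOL-Real_Asymp.Real_Asymp"
begin

text \<open>Write \<open>\<Omega>\<close> for \<^const>\<open>prime_Omega\<close>. For a bounded sequence \<open>a\<close> and a Dirichlet character \<open>\<psi>\<close>, the
  Turan-Kubilius inequality with primes \<open>p\<close> from windows \<open>\<bar>log p - j\<bar> \<le> \<rho>\<close>, weighted by \<open>1/j\<close>,
  compares the mean of \<open>\<psi>(n) a(\<Omega>(n))\<close> up to \<open>x\<close> with the logarithmic average over \<open>j\<close> of the means of
  \<open>\<psi>(n) a(\<Omega>(n) + 1)\<close> up to \<open>x e\<^sup>-\<^sup>j\<close>, times the average of \<open>\<psi>\<close> over the primes in the windows. That
  average is 0 or 1 by a smoothed prime number theorem, which follows from the non-vanishing of the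
  L-functions on \<open>Re s = 1\<close> by a Wiener-Ikehara argument with the Fejer kernel. So the mean tends to 0
  for non-principal \<open>\<psi>\<close>. For principal \<open>\<psi>\<close> a double logarithmic average is insensitive to one more
  shift of the scale, so the means for \<open>a\<close> and its shift agree in the limit; if the block averages of \<open>a\<close>
  are uniformly small, the mean is small as well. Periodic weights are combinations of dilated
  characters, irrational \<open>\<alpha>\<close> is handled by Katai's orthogonality argument, and unique ergodicity
  makes the block averages of \<open>f(T\<^sup>k x) - \<integral>f d\<mu>\<close> uniformly small.\<close>

section \<open>L-functions on the line Re s = 1\<close>

text \<open>Restricting Turan-Kubilius to primes near e^j turns Omega(pm) = Omega(m) + 1 into a link
  between the mean of \<open>a\<close> at scale x and the mean of its shift at scale x e^-j. The
  obstacle is the change of scale, since means at different scales are not known to agree. Using the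
  link twice removes it: the mean of \<open>a\<close> is an average over j of means of the first
  shift, hence a double average over j and r of means of the second shift at x e^-(j+r). The weights
  1/j do not notice a bounded displacement r, so what remains is the single average that represents
  the mean of the first shift. For this the ranges of j and r must be fixed before the sequence is.
  The same weights have unbounded total mass, which makes the variance relatively small. Windows of
  fixed logarithmic width suffice, so the prime number theorem is only needed in smoothed form. The
  Fourier transform of the Fejer kernel has compact support, so only a bounded piece of the line Re
  s = 1 enters and no growth bounds for L-functions are required.\<close>

lemma powr_diff_bound:
  fixes s :: complex and x :: real
  assumes "Re s > -1" "0 < y" "y \<le> x"
  shows "norm (of_real y powr (-s) - of_real x powr (-s)) \<le> norm s * y powr (- Re s - 1) * (x - y)"
proof -
  let ?S = "closed_segment (complex_of_real y) (of_real x)"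
  have S: "\<exists>t. z = of_real t \<and> y \<le> t \<and> t \<le> x" if "z \<in> ?S" for z
    using that assms by (auto simp: closed_segment_of_real closed_segment_eq_real_ivl)
  have "norm ((of_real y) powr (-s) - (of_real x) powr (-s)) \<le> norm s * y powr (- Re s - 1) * norm (complex_of_real y - of_real x)"
  proof (rule field_differentiable_bound[where S = ?S and f' = "\<lambda>z. -s * z powr (-s-1)"])
    fix z assume "z \<in> ?S"
    then obtain t where t: "z = of_real t" "y \<le> t" "t \<le> x" using S by blast
    have "z \<notin> \<real>\<^sub>\<le>\<^sub>0" using t assms by (auto simp: complex_nonpos_Reals_iff)
    then show "((\<lambda>z. z powr (-s)) has_field_derivative -s * z powr (-s-1)) (at z within ?S)"
      by (auto intro!: derivative_eq_intros simp: complex_nonpos_Reals_iff)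
    have "norm (z powr (-s-1)) = t powr (- Re s - 1)"
      using t assms by (subst norm_powr_real_powr) auto
    also have "\<dots> \<le> y powr (- Re s - 1)"
      using t assms by (intro powr_mono2') auto
    finally show "norm (-s * z powr (-s-1)) \<le> norm s * y powr (- Re s - 1)"
      by (simp add: norm_mult mult_left_mono)
  qed auto
  also have "norm (complex_of_real y - of_real x) = x - y"
    using assms by (simp flip: of_real_diff)
  finally show ?thesis .
qed

text \<open>With m = n + 1 this is s - 1 times the difference of m^-s and the integral of t^-s over
  [m, m+1]. The factor s - 1 removes the pole, and for Re s > 1 the sum over n is (s - 1) zeta(s) -
  1.\<close>

definition zterm :: "nat \<Rightarrow> complex \<Rightarrow> complex" where
  "zterm n s = (s - 1) * of_nat (Suc n) powr (-s) + of_nat (Suc (Suc n)) powr (1-s) - of_nat (Suc n) powr (1-s)"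

lemma norm_zterm_le:
  assumes "Re s > -1"
  shows "norm (zterm n s) \<le> norm (s-1) * norm s * real (Suc n) powr (- Re s - 1)"
proof -
  define y where "y = real (Suc n)"
  have y: "y \<ge> 1" by (simp add: y_def)
  let ?S = "closed_segment (complex_of_real y) (of_real (y+1))"
  have S: "\<exists>t. z = of_real t \<and> y \<le> t \<and> t \<le> y+1" if "z \<in> ?S" for z
    using that y unfolding closed_segment_of_real closed_segment_eq_real_ivl by auto
  \<comment> \<open>The increment of \<open>?f\<close> over [y, y+1] is exactly
    \<open>zterm n s\<close>, while its derivative is a difference of two nearly equal powers. This
    gains the extra power of y.\<close>
  let ?f = "\<lambda>z. (s-1) * of_real y powr (-s) * z + z powr (1-s)"
  have "norm (?f (of_real (y+1)) - ?f (of_real y)) \<le> norm (s-1) * norm s * y powr (- Re s - 1) * norm (complex_of_real (y+1) - of_real y)"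
  proof (rule field_differentiable_bound[where S = ?S and f' = "\<lambda>z. (s-1) * (of_real y powr (-s) - z powr (-s))"])
    fix z assume "z \<in> ?S"
    then obtain t where t: "z = of_real t" "y \<le> t" "t \<le> y+1" using S by blast
    have nz: "z \<notin> \<real>\<^sub>\<le>\<^sub>0" using t y by (auto simp: complex_nonpos_Reals_iff)
    show "(?f has_field_derivative (s-1) * (of_real y powr (-s) - z powr (-s))) (at z within ?S)"
      using nz by (auto intro!: derivative_eq_intros simp: complex_nonpos_Reals_iff algebra_simps)
    have "norm (of_real y powr (-s) - z powr (-s)) \<le> norm s * y powr (- Re s - 1) * (t - y)"
      unfolding t(1) using t y assms by (intro powr_diff_bound) auto
    also have "\<dots> \<le> norm s * y powr (- Re s - 1) * 1"
      using t by (intro mult_left_mono) auto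
    finally have *: "norm (of_real y powr (-s) - z powr (-s)) \<le> norm s * y powr (- Re s - 1)" by simp
    show "norm ((s-1) * (of_real y powr (-s) - z powr (-s))) \<le> norm (s-1) * norm s * y powr (- Re s - 1)"
      unfolding norm_mult mult.assoc[of "norm (s-1)"] by (intro mult_left_mono *) auto
  qed (use y in auto)
  moreover have "?f (of_real (y+1)) - ?f (of_real y) = zterm n s"
    by (simp add: zterm_def y_def algebra_simps)
  ultimately show ?thesis by (simp add: y_def)
qed

lemma summable_powr_shift: "\<sigma> > 1 \<Longrightarrow> summable (\<lambda>n. real (Suc n) powr (-\<sigma>))"
  using summable_real_powr_iff[of "-\<sigma>"] summable_Suc_iff[of "\<lambda>n. real n powr (-\<sigma>)"] by simp

text \<open>Weierstrass M-test on small discs: a disc of radius Re x / 2 stays in Re s \<ge> Re x /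
  2, where the exponent is uniformly below -1, and the continuous factor \<open>B\<close> is bounded
  there by compactness.\<close>

lemma series_holomorphic_half_plane:
  fixes f :: "nat \<Rightarrow> complex \<Rightarrow> complex"
  assumes hol: "\<And>n. f n holomorphic_on {s. Re s > 0}"
      and B: "continuous_on {s. Re s > 0} B"
      and bd: "\<And>n s. Re s > 0 \<Longrightarrow> norm (f n s) \<le> B s * real (Suc n) powr (- Re s - 1)"
  shows "\<exists>g. g holomorphic_on {s. Re s > 0} \<and> (\<forall>s. Re s > 0 \<longrightarrow> (\<lambda>n. f n s) sums g s)"
proof -
  let ?S = "{s. Re s > 0}"
  have op: "open ?S" by (rule open_halfspace_Re_gt)
  have "\<exists>g. \<forall>x\<in>?S. ((\<lambda>n. f n x) sums g x) \<and> g field_differentiable (at x)"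
  proof (rule series_differentiable_comparison_complex[OF op, of f])
    show "f n field_differentiable at x" if "x \<in> ?S" for n x
      using hol[of n] op that by (rule holomorphic_on_imp_differentiable_at)
  next
    fix x assume x: "x \<in> ?S"
    define d where "d = Re x / 2"
    have d: "d > 0" using x by (simp add: d_def)
    have sub: "cball x d \<subseteq> {s. Re s \<ge> d}"
    proof
      fix y assume "y \<in> cball x d"
      then have "Re x - Re y \<le> d" using complex_Re_le_cmod[of "x-y"] by (simp add: dist_norm)
      then show "y \<in> {s. Re s \<ge> d}" by (simp add: d_def)
    qed
    have "compact (B ` cball x d)"
      by (rule compact_continuous_image[OF continuous_on_subset[OF B]]) (use sub d in force, simp)
    then obtain M where M: "\<And>y. y \<in> cball x d \<Longrightarrow> B y \<le> M"
      using compact_imp_bounded bounded_imp_bdd_above unfolding bdd_above_def by (metis imageI)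
    have M0: "M \<ge> 0"
    proof -
      have "0 \<le> norm (f 0 x)" by simp
      also have "\<dots> \<le> B x" using bd[of x 0] x by simp
      also have "\<dots> \<le> M" using M d by simp
      finally show ?thesis .
    qed
    show "\<exists>e h. 0 < e \<and> summable h \<and> range h \<subseteq> \<real>\<^sub>\<ge>\<^sub>0 \<and> (\<forall>\<^sub>F n in sequentially. \<forall>y\<in>ball x e \<inter> ?S. cmod (f n y) \<le> cmod (h n))"
    proof (intro exI[of _ d] exI[of _ "\<lambda>n. complex_of_real (M * real (Suc n) powr (-1-d))"] conjI always_eventually allI ballI)
      show "summable (\<lambda>n. complex_of_real (M * real (Suc n) powr (-1-d)))"
        using summable_powr_shift[of "1+d"] d by (intro summable_of_real summable_mult) simp
      show "range (\<lambda>n. complex_of_real (M * real (Suc n) powr (- 1 - d))) \<subseteq> \<real>\<^sub>\<ge>\<^sub>0"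
        using M0 by (auto simp: complex_nonneg_Reals_iff)
      fix n y assume y: "y \<in> ball x d \<inter> ?S"
      then have "y \<in> cball x d" by simp
      then have yd: "Re y \<ge> d" "B y \<le> M" using sub M by blast+
      have "norm (f n y) \<le> B y * real (Suc n) powr (- Re y - 1)" using bd y by auto
      also have "\<dots> \<le> M * real (Suc n) powr (- Re y - 1)" using yd by (intro mult_right_mono) auto
      also have "\<dots> \<le> M * real (Suc n) powr (-1-d)" using yd M0 by (intro mult_left_mono powr_mono) auto
      finally show "norm (f n y) \<le> cmod (complex_of_real (M * real (Suc n) powr (-1-d)))"
        using M0 by (simp add: norm_mult)
    qed (use d in auto)
  qed blast
  then obtain g where "\<forall>x\<in>?S. ((\<lambda>n. f n x) sums g x) \<and> g field_differentiable (at x)" by blast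
  then show ?thesis
    by (intro exI[of _ g]) (auto simp: holomorphic_on_def field_differentiable_at_within)
qed

lemma zterm_holomorphic: "zterm n holomorphic_on A"
  unfolding zterm_def by (intro holomorphic_intros)

text \<open>\<open>Z\<close> is (s - 1) zeta(s), namely 1 plus the sum of the \<open>zterm\<close>;
  the telescoping differences contribute the 1. The value at 1 is the residue of zeta.\<close>

lemma zeta_series:
  "\<exists>Z. Z holomorphic_on {s. Re s > 0} \<and> Z 1 = 1 \<and>
    (\<forall>s. Re s > 1 \<longrightarrow> (\<lambda>n. of_nat (Suc n) powr (-s)) sums (Z s / (s - 1)))"
proof -
  obtain g where g: "g holomorphic_on {s. Re s > 0}" "\<And>s. Re s > 0 \<Longrightarrow> (\<lambda>n. zterm n s) sums g s"
  proof -
    have "\<exists>g. g holomorphic_on {s. Re s > 0} \<and> (\<forall>s. Re s > 0 \<longrightarrow> (\<lambda>n. zterm n s) sums g s)"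
      by (rule series_holomorphic_half_plane[of zterm "\<lambda>s. norm (s-1) * norm s"])
         (use norm_zterm_le in \<open>auto intro!: zterm_holomorphic continuous_intros simp del: of_nat_Suc\<close>)
    then show ?thesis using that by blast
  qed
  show ?thesis
  proof (intro exI[of _ "\<lambda>s. 1 + g s"] conjI allI impI)
    show "(\<lambda>s. 1 + g s) holomorphic_on {s. Re s > 0}" using g by (intro holomorphic_intros)
    have "(\<lambda>n. zterm n 1) sums 0" by (simp add: zterm_def del: of_nat_Suc)
    moreover have "(\<lambda>n. zterm n 1) sums g 1" using g by simp
    ultimately have "g 1 = 0" by (metis sums_unique2)
    then show "1 + g 1 = 1" by simp
    fix s :: complex assume s: "Re s > 1"
    have lim: "(\<lambda>n. of_nat (Suc n) powr (1-s)) \<longlonglongrightarrow> 0"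
    proof (rule tendsto_norm_zero_cancel)
      have "(\<lambda>n. real (Suc n) powr (1 - Re s)) \<longlonglongrightarrow> 0"
        using s by (intro tendsto_neg_powr filterlim_compose[OF filterlim_real_sequentially filterlim_Suc]) auto
      moreover have "norm (complex_of_nat (Suc n) powr (1-s)) = real (Suc n) powr (1 - Re s)" for n
        using norm_powr_real_powr[of "of_nat (Suc n)" "1-s"] by simp
      ultimately show "(\<lambda>n. norm (complex_of_nat (Suc n) powr (1-s))) \<longlonglongrightarrow> 0" by simp
    qed
    have "(\<lambda>n. of_nat (Suc n) powr (1-s) - of_nat (Suc (Suc n)) powr (1-s)) sums (of_nat (Suc 0) powr (1-s) - 0)"
      by (rule telescope_sums') (rule lim)
    then have "(\<lambda>n. zterm n s + (of_nat (Suc n) powr (1-s) - of_nat (Suc (Suc n)) powr (1-s))) sums (g s + 1)"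
      using s by (intro sums_add g) auto
    then have "(\<lambda>n. (s-1) * of_nat (Suc n) powr (-s)) sums (g s + 1)"
      by (simp add: zterm_def)
    then have "(\<lambda>n. (s-1) * of_nat (Suc n) powr (-s) / (s-1)) sums ((g s + 1) / (s-1))"
      by (rule sums_divide)
    then show "(\<lambda>n. of_nat (Suc n) powr (-s)) sums ((1 + g s) / (s - 1))"
      using s by (cases "s = 1") (simp_all add: add.commute del: of_nat_Suc)
  qed
qed

lemma sum_lessThan_add: "sum f {..<m + n} = sum f {..<m} + (\<Sum>k<n. f (k + m))"
  for f :: "nat \<Rightarrow> 'a :: comm_monoid_add"
  by (induction n) (simp_all add: algebra_simps)

text \<open>Absolute convergence allows regrouping the double sum by the product n = d e. The index
  0 stays out of the regrouping, as every number divides it; its terms vanish because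
  \<open>0 powr z = 0\<close>.\<close>

lemma dirichlet_product_sums:
  fixes a b :: "nat \<Rightarrow> complex"
  assumes sa: "summable (\<lambda>n. norm (a n * of_nat n powr (-s)))" and A: "(\<lambda>n. a n * of_nat n powr (-s)) sums A"
      and sb: "summable (\<lambda>n. norm (b n * of_nat n powr (-s)))" and B: "(\<lambda>n. b n * of_nat n powr (-s)) sums B"
  shows "(\<lambda>n. (\<Sum>d | d dvd n. a d * b (n div d)) * of_nat n powr (-s)) sums (A * B)"
proof -
  define f where "f n = a n * of_nat n powr (-s)" for n
  define h where "h n = b n * of_nat n powr (-s)" for n
  let ?P = "{0<..} :: nat set"
  have f: "(f has_sum A) ?P"
    using norm_summable_imp_has_sum[OF sa A] unfolding f_def
    by (subst has_sum_cong_neutral[where T = UNIV and g = "\<lambda>n. a n * of_nat n powr (-s)"]) auto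
  have h: "(h has_sum B) ?P"
    using norm_summable_imp_has_sum[OF sb B] unfolding h_def
    by (subst has_sum_cong_neutral[where T = UNIV and g = "\<lambda>n. b n * of_nat n powr (-s)"]) auto
  have fa: "(\<lambda>n. norm (f n)) summable_on ?P"
    using norm_summable_imp_summable_on[of "\<lambda>n. norm (f n)"] sa unfolding f_def
    by (auto intro: summable_on_subset_banach)
  have ha: "(\<lambda>n. norm (h n)) summable_on ?P"
    using norm_summable_imp_summable_on[of "\<lambda>n. norm (h n)"] sb unfolding h_def
    by (auto intro: summable_on_subset_banach)
  have "(\<lambda>x. norm (case x of (d, e) \<Rightarrow> f d * h e)) summable_on ?P \<times> ?P"
  proof (rule summable_on_SigmaI)
    show "((\<lambda>e. norm (case (d, e) of (d, e) \<Rightarrow> f d * h e)) has_sum norm (f d) * infsum (\<lambda>e. norm (h e)) ?P) ?P" for d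
      unfolding prod.case norm_mult by (intro has_sum_cmult_right has_sum_infsum ha)
    show "(\<lambda>d. norm (f d) * infsum (\<lambda>e. norm (h e)) ?P) summable_on ?P"
      by (intro summable_on_cmult_left fa)
  qed auto
  then have "(\<lambda>(d, e). f d * h e) summable_on ?P \<times> ?P"
    by (rule abs_summable_summable)
  then obtain S where S: "((\<lambda>(d, e). f d * h e) has_sum S) (?P \<times> ?P)"
    by (auto simp: summable_on_def)
  have "((\<lambda>d. f d * B) has_sum S) ?P"
    by (rule has_sum_SigmaD[OF S]) (auto intro!: has_sum_cmult_right h)
  moreover have "((\<lambda>d. f d * B) has_sum A * B) ?P"
    by (intro has_sum_cmult_left f)
  ultimately have "S = A * B" by (metis has_sum_unique)
  have "((\<lambda>(n, d). a d * b (n div d) * of_nat n powr (-s)) has_sum S) (SIGMA n:?P. {d. d dvd n})"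
  proof (rule iffD1[OF has_sum_reindex_bij_witness S])
    show "(case (\<lambda>(d, e). (d * e, d)) a' of (n, d) \<Rightarrow> a d * b (n div d) * complex_of_nat n powr - s)
       = (case a' of (d, e) \<Rightarrow> f d * h e)" if "a' \<in> ?P \<times> ?P" for a'
      using that by (auto simp: f_def h_def powr_times_real)
  next
    show "(\<lambda>(n, d). (d, n div d)) ((\<lambda>(d, e). (d * e, d)) a) = a" if "a \<in> ?P \<times> ?P" for a
      using that by auto
  qed (auto simp: dvd_div_eq_0_iff elim!: dvdE)
  then have "((\<lambda>n. (\<Sum>d | d dvd n. a d * b (n div d)) * of_nat n powr (-s)) has_sum S) ?P"
    by (rule has_sum_SigmaD) (auto simp: sum_distrib_right intro!: has_sum_finite finite_divisors_nat)
  then have "((\<lambda>n. (\<Sum>d | d dvd n. a d * b (n div d)) * of_nat n powr (-s)) has_sum S) UNIV"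
    by (subst has_sum_cong_neutral[where T = ?P and g = "\<lambda>n. (\<Sum>d | d dvd n. a d * b (n div d)) * of_nat n powr (-s)"]) auto
  then show ?thesis using \<open>S = A * B\<close> has_sum_imp_sums by blast
qed

section \<open>Dirichlet characters and the continuation of their L-series to Re s > 0\<close>

locale dchar =
  fixes \<psi> :: "nat \<Rightarrow> complex" and q :: nat
  assumes q_pos: "q > 0"
    and mult: "\<psi> (m * n) = \<psi> m * \<psi> n"
    and one: "\<psi> 1 = 1"
    and periodic: "\<psi> (n + q) = \<psi> n"
    and zero: "\<not> coprime n q \<Longrightarrow> \<psi> n = 0"
begin

lemma periodic_mult: "\<psi> (n + k * q) = \<psi> n"
proof (induction k)
  case (Suc k)
  then show ?case using periodic[of "n + k * q"] by (simp add: algebra_simps)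
qed simp

lemma psi_mod: "\<psi> (n mod q) = \<psi> n"
  by (metis periodic_mult mod_div_mult_eq)

lemma psi_power: "\<psi> (n ^ k) = \<psi> n ^ k"
  by (induction k) (use mult one in auto)

lemma norm_coprime: assumes "coprime n q" shows "norm (\<psi> n) = 1"
proof -
  have "[n ^ totient q = 1] (mod q)" by (rule euler_theorem) fact
  then have "\<psi> (n ^ totient q) = \<psi> 1" by (metis psi_mod cong_def)
  then have "\<psi> n ^ totient q = 1" by (simp add: psi_power one del: One_nat_def)
  then have "norm (\<psi> n) ^ totient q = 1" by (metis norm_power norm_one)
  then show ?thesis using q_pos power_eq_imp_eq_base[of "norm (\<psi> n)" "totient q" 1] by simp
qed

lemma norm_le1: "norm (\<psi> n) \<le> 1"
  using norm_coprime[of n] zero[of n] by (cases "coprime n q") auto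

text \<open>The residue of the L-series at 1; it is nonzero exactly for the principal
  character.\<close>

definition mean :: complex where "mean = (\<Sum>k<q. \<psi> k) / of_nat q"

lemma sum_period: "(\<Sum>k<q. \<psi> (k + j)) = (\<Sum>k<q. \<psi> k)"
proof (induction j)
  case (Suc j)
  have "(\<Sum>k<q. \<psi> (k + Suc j)) = (\<Sum>k<q. \<psi> (k + j)) + (\<psi> (q + j) - \<psi> j)"
    using sum.lessThan_Suc_shift[of "\<lambda>k. \<psi> (k + j)" q] sum.lessThan_Suc[of "\<lambda>k. \<psi> (k + j)" q]
    by (simp add: algebra_simps)
  then show ?case using Suc periodic[of j] by (simp add: add.commute)
qed simp

lemma norm_mean: "norm mean \<le> 1"
proof -
  have "norm (\<Sum>k<q. \<psi> k) \<le> (\<Sum>k<q. 1)" by (rule sum_norm_le) (rule norm_le1)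
  then show ?thesis using q_pos by (simp add: mean_def norm_divide)
qed

text \<open>Full periods cancel once the mean is subtracted, so only an incomplete period of fewer
  than q terms, each of size at most 2, survives.\<close>

lemma bounded_partial_sums: "norm (\<Sum>k<n. \<psi> (Suc k) - mean) \<le> 2 * real q"
proof -
  define b where "b k = \<psi> (Suc k) - mean" for k
  have per: "(\<Sum>k<q. b (k + j)) = 0" for j
    using sum_period[of "Suc j"] q_pos by (simp add: b_def sum_subtractf mean_def)
  have block: "(\<Sum>k<m*q. b k) = 0" for m
  proof (induction m)
    case (Suc m)
    have "(\<Sum>k<Suc m*q. b k) = (\<Sum>k<m*q. b k) + (\<Sum>k<q. b (k + m * q))"
      by (simp add: add.commute[of q] sum_lessThan_add)
    then show ?case using Suc per by simp
  qed simp
  have "(\<Sum>k<n. b k) = (\<Sum>k<(n div q)*q. b k) + (\<Sum>k<n mod q. b (k + (n div q)*q))"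
    by (metis div_mult_mod_eq sum_lessThan_add)
  then have "norm (\<Sum>k<n. b k) = norm (\<Sum>k<n mod q. b (k + (n div q)*q))"
    by (simp add: block)
  also have "\<dots> \<le> (\<Sum>k<n mod q. 2)"
  proof (rule sum_norm_le)
    fix k
    have "norm (b m) \<le> 2" for m unfolding b_def
      using norm_triangle_ineq4[of "\<psi> (Suc m)" mean] norm_le1[of "Suc m"] norm_mean by linarith
    then show "norm (b (k + (n div q)*q)) \<le> 2" by simp
  qed
  also have "\<dots> \<le> 2 * real q" using q_pos by (simp add: less_imp_le)
  finally show ?thesis by (simp add: b_def)
qed

text \<open>Summation by parts: bounded partial sums against u(n) - u(n+1), which decays like n^(-Re
  s - 1), converge on the whole half-plane.\<close>

lemma L_minus_mean_series:
  "\<exists>h. h holomorphic_on {s. Re s > 0} \<and>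
     (\<forall>s. Re s > 0 \<longrightarrow> (\<lambda>n. (\<psi> (Suc n) - mean) * of_nat (Suc n) powr (-s)) sums h s)"
proof -
  define b where "b k = \<psi> (Suc k) - mean" for k
  define B where "B n = (\<Sum>k<n. b k)" for n
  define u where "u s n = complex_of_nat (Suc n) powr (-s)" for s n
  have B: "norm (B n) \<le> 2 * real q" for n using bounded_partial_sums by (simp add: B_def b_def)
  have "\<exists>g. g holomorphic_on {s. Re s > 0} \<and> (\<forall>s. Re s > 0 \<longrightarrow> (\<lambda>n. B (Suc n) * (u s n - u s (Suc n))) sums g s)"
  proof (rule series_holomorphic_half_plane[where B = "\<lambda>s. 2 * real q * norm s"])
    show "(\<lambda>s. B (Suc n) * (u s n - u s (Suc n))) holomorphic_on {s. 0 < Re s}" for n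
      unfolding u_def by (intro holomorphic_intros)
    show "continuous_on {s. 0 < Re s} (\<lambda>s. 2 * real q * norm s)" by (intro continuous_intros)
    fix n s assume s: "0 < Re s"
    have "norm (u s n - u s (Suc n)) \<le> norm s * real (Suc n) powr (- Re s - 1)"
      using powr_diff_bound[of s "real (Suc n)" "real (Suc (Suc n))"] s by (simp add: u_def)
    then show "norm (B (Suc n) * (u s n - u s (Suc n))) \<le> 2 * real q * norm s * real (Suc n) powr (- Re s - 1)"
      unfolding norm_mult mult.assoc[of _ "norm s"] by (intro mult_mono B) auto
  qed
  then obtain g where g: "g holomorphic_on {s. Re s > 0}"
    "\<And>s. Re s > 0 \<Longrightarrow> (\<lambda>n. B (Suc n) * (u s n - u s (Suc n))) sums g s" by blast
  have parts: "(\<Sum>n<N. b n * u s n) = (\<Sum>n<N. B (Suc n) * (u s n - u s (Suc n))) + B N * u s N" for N s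
    by (induction N) (simp_all add: B_def algebra_simps)
  show ?thesis
  proof (intro exI[of _ g] conjI g allI impI)
    fix s :: complex assume s: "Re s > 0"
    have "(\<lambda>N. B N * u s N) \<longlonglongrightarrow> 0"
    proof (rule Lim_null_comparison)
      show "\<forall>\<^sub>F N in sequentially. norm (B N * u s N) \<le> 2 * real q * real (Suc N) powr (- Re s)"
      proof (intro always_eventually allI)
        fix N
        have "norm (u s N) = real (Suc N) powr (- Re s)"
          using norm_powr_real_powr[of "of_nat (Suc N)" "-s"] by (simp add: u_def)
        then show "norm (B N * u s N) \<le> 2 * real q * real (Suc N) powr (- Re s)"
          unfolding norm_mult by (intro mult_mono B) auto
      qed
      have "(\<lambda>n. real (Suc n) powr (- Re s)) \<longlonglongrightarrow> 0"
        using s by (intro tendsto_neg_powr filterlim_compose[OF filterlim_real_sequentially filterlim_Suc]) auto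
      then show "(\<lambda>N. 2 * real q * real (Suc N) powr (- Re s)) \<longlonglongrightarrow> 0"
        using tendsto_mult_right_zero by blast
    qed
    then have "(\<lambda>N. \<Sum>n<N. b n * u s n) \<longlonglongrightarrow> g s + 0"
      unfolding parts using g(2)[OF s] by (intro tendsto_add) (auto simp: sums_def)
    then show "(\<lambda>n. (\<psi> (Suc n) - mean) * of_nat (Suc n) powr (-s)) sums g s"
      by (simp add: sums_def b_def u_def)
  qed
qed

text \<open>Splitting L into \<open>mean\<close> times zeta plus the series with the mean removed
  leaves at most a simple pole at 1; \<open>Z\<close> is (s - 1) L(s).\<close>

lemma L_series:
  "\<exists>Z. Z holomorphic_on {s. Re s > 0} \<and> Z 1 = mean \<and>
    (\<forall>s. Re s > 1 \<longrightarrow> (\<lambda>n. \<psi> (Suc n) * of_nat (Suc n) powr (-s)) sums (Z s / (s - 1)))"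
proof -
  obtain h where h: "h holomorphic_on {s. Re s > 0}"
     "\<And>s. Re s > 0 \<Longrightarrow> (\<lambda>n. (\<psi> (Suc n) - mean) * of_nat (Suc n) powr (-s)) sums h s"
    using L_minus_mean_series by blast
  obtain Z where Z: "Z holomorphic_on {s. Re s > 0}" "Z 1 = 1"
    "\<And>s. Re s > 1 \<Longrightarrow> (\<lambda>n. of_nat (Suc n) powr (-s)) sums (Z s / (s - 1))" using zeta_series by blast
  show ?thesis
  proof (intro exI[of _ "\<lambda>s. mean * Z s + (s - 1) * h s"] conjI allI impI)
    fix s :: complex assume s: "Re s > 1"
    then have "(\<lambda>n. (\<psi> (Suc n) - mean) * of_nat (Suc n) powr (-s) + mean * of_nat (Suc n) powr (-s))
        sums (h s + mean * (Z s / (s - 1)))"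
      by (intro sums_add sums_mult h Z) auto
    moreover have "h s + mean * (Z s / (s - 1)) = (mean * Z s + (s - 1) * h s) / (s - 1)"
      using s by (cases "s = 1") (auto simp: field_simps)
    ultimately show "(\<lambda>n. \<psi> (Suc n) * of_nat (Suc n) powr (-s)) sums ((mean * Z s + (s - 1) * h s) / (s - 1))"
      by (simp add: left_diff_distrib del: of_nat_Suc)
  qed (use Z h in \<open>auto intro!: holomorphic_intros\<close>)
qed

end

section \<open>The logarithmic derivative as a Dirichlet series\<close>

lemma norm_nat_powr: "norm (complex_of_nat n powr (-s)) = real n powr (- Re s)"
  by (cases "n = 0") (use norm_powr_real_powr[of "of_nat n" "-s"] in auto)

lemma summable_powr: "\<sigma> > 1 \<Longrightarrow> summable (\<lambda>n. real n powr (-\<sigma>))"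
  using summable_real_powr_iff[of "-\<sigma>"] by simp

lemma ln_le_powr: "\<delta> > 0 \<Longrightarrow> ln (real n) \<le> real n powr \<delta> / \<delta>"
  by (cases "n = 0") (use ln_powr_bound[of "real n" \<delta>] in auto)

lemma summable_ln_powr:
  assumes "\<sigma> > 1" shows "summable (\<lambda>n. ln (real n) * real n powr (-\<sigma>))"
proof (rule summable_comparison_test)
  define \<delta> where "\<delta> = (\<sigma> - 1) / 2"
  have d: "\<delta> > 0" "\<sigma> - \<delta> > 1" using assms by (auto simp: \<delta>_def field_simps)
  show "summable (\<lambda>n. 1/\<delta> * real n powr (-(\<sigma> - \<delta>)))" by (intro summable_mult summable_powr d)
  show "\<exists>N. \<forall>n\<ge>N. norm (ln (real n) * real n powr (-\<sigma>)) \<le> 1/\<delta> * real n powr (-(\<sigma> - \<delta>))"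
  proof (intro exI allI impI)
    fix n :: nat assume n: "n \<ge> 1"
    have "norm (ln (real n) * real n powr (-\<sigma>)) = ln (real n) * real n powr (-\<sigma>)" using n by simp
    also have "\<dots> \<le> (real n powr \<delta> / \<delta>) * real n powr (-\<sigma>)" by (intro mult_right_mono ln_le_powr d) auto
    also have "\<dots> = 1/\<delta> * real n powr (-(\<sigma> - \<delta>))" by (simp add: powr_add[symmetric] algebra_simps)
    finally show "norm (ln (real n) * real n powr (-\<sigma>)) \<le> 1/\<delta> * real n powr (-(\<sigma> - \<delta>))" .
  qed
qed

lemma mangoldt_le_ln: "n > 0 \<Longrightarrow> (mangoldt n :: real) \<le> ln (real n)"
proof -
  assume n: "n > 0"
  have "(mangoldt n :: real) \<le> (\<Sum>d | d dvd n. mangoldt d)"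
    using n by (intro member_le_sum) (auto simp: mangoldt_nonneg)
  also have "\<dots> = ln (real n)" using mangoldt_sum[of n, where 'a = real] n by simp
  finally show ?thesis .
qed

lemma summable_mangoldt_powr:
  assumes "\<sigma> > 1" shows "summable (\<lambda>n. mangoldt n * real n powr (-\<sigma>))"
proof (rule summable_comparison_test'[OF summable_ln_powr[OF assms], where N=1])
  fix n :: nat assume n: "n \<ge> 1"
  then show "norm (mangoldt n * real n powr (-\<sigma>)) \<le> ln (real n) * real n powr (-\<sigma>)"
    by (auto simp: mangoldt_nonneg intro!: mult_right_mono mangoldt_le_ln)
qed

lemma dirichlet_series_deriv:
  fixes a :: "nat \<Rightarrow> complex"
  assumes a: "\<And>n. norm (a n) \<le> 1"
  defines "A \<equiv> \<lambda>s. (\<Sum>n. a n * of_nat n powr (-s))"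
  assumes s: "Re s > 1"
  shows "(A has_field_derivative (\<Sum>n. - (a n * of_real (ln (real n)) * of_nat n powr (-s)))) (at s)"
    and "(\<lambda>n. - (a n * of_real (ln (real n)) * of_nat n powr (-s))) sums (\<Sum>n. - (a n * of_real (ln (real n)) * of_nat n powr (-s)))"
proof -
  let ?S = "{s. Re s > 1}"
  let ?f = "\<lambda>n s. a n * of_nat n powr (-s)"
  let ?f' = "\<lambda>n s. - (a n * of_real (ln (real n)) * of_nat n powr (-s))"
  have op: "open ?S" by (rule open_halfspace_Re_gt)
  have "\<exists>g g'. \<forall>x \<in> ?S. ((\<lambda>n. ?f n x) sums g x) \<and> ((\<lambda>n. ?f' n x) sums g' x) \<and> (g has_field_derivative g' x) (at x)"
  proof (rule series_and_derivative_comparison_local[OF op])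
    fix n :: nat and x :: complex
    show "(?f n has_field_derivative ?f' n x) (at x)"
      by (cases "n = 0") (auto intro!: derivative_eq_intros simp: Ln_of_nat powr_def)
  next
    fix x assume x: "x \<in> ?S"
    define d where "d = (Re x - 1) / 2"
    have d: "d > 0" using x by (simp add: d_def)
    show "\<exists>d h. 0 < d \<and> summable h \<and> (\<forall>\<^sub>F n in sequentially. \<forall>y\<in>ball x d \<inter> ?S. norm (?f n y) \<le> h n)"
    proof (intro exI[of _ d] exI[of _ "\<lambda>n. real n powr (-(1+d))"] conjI always_eventually allI ballI)
      show "summable (\<lambda>n. real n powr (-(1+d)))" using d by (intro summable_powr) auto
      fix n y assume y: "y \<in> ball x d \<inter> ?S"
      then have "Re x - Re y \<le> d" using complex_Re_le_cmod[of "x-y"] by (simp add: dist_norm)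
      then have yd: "Re y \<ge> 1 + d" by (simp add: d_def field_simps)
      show "norm (?f n y) \<le> real n powr (-(1+d))"
      proof (cases "n = 0")
        case False
        have "norm (?f n y) \<le> 1 * real n powr (- Re y)"
          unfolding norm_mult norm_nat_powr by (intro mult_right_mono a) auto
        also have "\<dots> \<le> real n powr (-(1+d))" using False yd by (simp add: powr_mono)
        finally show ?thesis .
      qed simp
    qed (use d in auto)
  qed
  then obtain g g' where g: "\<And>x. x \<in> ?S \<Longrightarrow> (\<lambda>n. ?f n x) sums g x"
    "\<And>x. x \<in> ?S \<Longrightarrow> (\<lambda>n. ?f' n x) sums g' x" "\<And>x. x \<in> ?S \<Longrightarrow> (g has_field_derivative g' x) (at x)" by blast
  have sS: "s \<in> ?S" using s by simp
  have "(A has_field_derivative g' s) (at s)"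
  proof (rule has_field_derivative_transform_within_open[OF g(3)[OF sS] op sS])
    show "g x = A x" if "x \<in> ?S" for x using g(1)[OF that] unfolding A_def by (simp add: sums_iff)
  qed
  moreover have "g' s = (\<Sum>n. ?f' n s)" using g(2)[OF sS] by (simp add: sums_iff)
  ultimately show "(A has_field_derivative (\<Sum>n. ?f' n s)) (at s)" by simp
  show "(\<lambda>n. ?f' n s) sums (\<Sum>n. ?f' n s)" using g(2)[OF sS] by (simp add: sums_iff)
qed

context dchar
begin

definition L :: "complex \<Rightarrow> complex" where "L s = (\<Sum>n. \<psi> n * of_nat n powr (-s))"
text \<open>The Dirichlet series of -L'/L, as \<open>L_deriv\<close> shows.\<close>

definition M :: "complex \<Rightarrow> complex" where "M s = (\<Sum>n. mangoldt n * \<psi> n * of_nat n powr (-s))"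

lemma L_summable: assumes "Re s > 1" shows "summable (\<lambda>n. norm (\<psi> n * of_nat n powr (-s)))"
proof (rule summable_comparison_test'[OF summable_powr[OF assms], where N=0])
  fix n
  have "norm (\<psi> n * of_nat n powr (-s)) \<le> real n powr (- Re s)"
    unfolding norm_mult norm_nat_powr using mult_right_mono[OF norm_le1, of "real n powr (- Re s)" n]
    by simp
  then show "norm (norm (\<psi> n * of_nat n powr (-s))) \<le> real n powr (- Re s)"
    by (simp only: real_norm_def abs_norm_cancel)
qed

lemma L_sums: "Re s > 1 \<Longrightarrow> (\<lambda>n. \<psi> n * of_nat n powr (-s)) sums L s"
  unfolding L_def by (rule summable_sums[OF summable_norm_cancel[OF L_summable]])

lemma M_term_le: "norm (mangoldt n * \<psi> n * of_nat n powr (-s)) \<le> mangoldt n * real n powr (- Re s)"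
  unfolding norm_mult norm_nat_powr norm_mangoldt
  using mult_mono[OF order_refl norm_le1, of "mangoldt n" n]
  by (intro mult_right_mono) (auto simp: mangoldt_nonneg)

lemma M_summable: assumes "Re s > 1" shows "summable (\<lambda>n. norm (mangoldt n * \<psi> n * of_nat n powr (-s)))"
proof (rule summable_comparison_test'[OF summable_mangoldt_powr[OF assms], where N=0])
  fix n
  show "norm (norm (mangoldt n * \<psi> n * of_nat n powr (-s))) \<le> mangoldt n * real n powr (- Re s)"
    using M_term_le[of n s] by (simp only: real_norm_def abs_norm_cancel)
qed

lemma M_sums: "Re s > 1 \<Longrightarrow> (\<lambda>n. mangoldt n * \<psi> n * of_nat n powr (-s)) sums M s"
  unfolding M_def by (rule summable_sums[OF summable_norm_cancel[OF M_summable]])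

text \<open>Total multiplicativity turns the convolution of \<Lambda> \<psi> with \<psi> into \<psi>
  times the divisor sum of \<Lambda>, which is log n.\<close>

lemma L_deriv:
  assumes s: "Re s > 1"
  shows "(L has_field_derivative - (M s * L s)) (at s)"
proof -
  have conv: "(\<Sum>d | d dvd n. (mangoldt d * \<psi> d) * \<psi> (n div d)) = \<psi> n * of_real (ln (real n))" if "n > 0" for n
  proof -
    have "(\<Sum>d | d dvd n. (mangoldt d * \<psi> d) * \<psi> (n div d)) = (\<Sum>d | d dvd n. mangoldt d * \<psi> n)"
      by (intro sum.cong) (auto simp: mult.assoc mult[symmetric])
    then show ?thesis using mangoldt_sum[of n, where 'a = complex] that
      by (simp add: sum_distrib_right[symmetric] mult.commute)
  qed
  have "(\<lambda>n. (\<Sum>d | d dvd n. (mangoldt d * \<psi> d) * \<psi> (n div d)) * of_nat n powr (-s)) sums (M s * L s)"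
    by (intro dirichlet_product_sums M_summable M_sums L_summable L_sums s)
  also have "(\<lambda>n. (\<Sum>d | d dvd n. (mangoldt d * \<psi> d) * \<psi> (n div d)) * of_nat n powr (-s))
     = (\<lambda>n. \<psi> n * of_real (ln (real n)) * of_nat n powr (-s))"
  proof
    fix n show "(\<Sum>d | d dvd n. (mangoldt d * \<psi> d) * \<psi> (n div d)) * of_nat n powr (-s) =
      \<psi> n * of_real (ln (real n)) * of_nat n powr (-s)"
      by (cases "n = 0") (simp_all add: conv)
  qed
  finally have "(\<lambda>n. - (\<psi> n * of_real (ln (real n)) * of_nat n powr (-s))) sums - (M s * L s)"
    by (rule sums_minus)
  then have "(\<Sum>n. - (\<psi> n * of_real (ln (real n)) * of_nat n powr (-s))) = - (M s * L s)"
    by (simp add: sums_iff)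
  moreover have "(L has_field_derivative (\<Sum>n. - (\<psi> n * of_real (ln (real n)) * of_nat n powr (-s)))) (at s)"
    unfolding L_def[abs_def] by (rule dirichlet_series_deriv(1)) (use s norm_le1 in auto)
  ultimately show ?thesis by simp
qed

lemma sums_shift_Suc: "(\<lambda>n. \<psi> (Suc n) * of_nat (Suc n) powr (-s)) sums x \<longleftrightarrow> (\<lambda>n. \<psi> n * of_nat n powr (-s)) sums x"
  using sums_Suc_iff[of "\<lambda>n. \<psi> n * of_nat n powr (-s)" x] by simp

text \<open>For large \<sigma> the term n = 1 dominates, the rest being at most C 2^(2-\<sigma>).
  Orders of zeros only make sense for a function that is not identically zero, which is what this
  provides.\<close>

lemma L_nonzero_somewhere: "\<exists>\<sigma>::real. \<sigma> > 1 \<and> L (of_real \<sigma>) \<noteq> 0"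
proof (rule ccontr)
  assume "\<not> ?thesis"
  then have zero: "L (of_real \<sigma>) = 0" if "\<sigma> > 1" for \<sigma> :: real using that by blast
  define C where "C = (\<Sum>n. real (n + 2) powr (-2))"
  have smC: "summable (\<lambda>n. real (n + 2) powr (-2))"
    using summable_powr[of 2] summable_iff_shift[of "\<lambda>n. real n powr (-2)" 2] by simp
  have "1 \<le> C * 2 powr (2 - \<sigma>)" if \<sigma>: "\<sigma> > 2" for \<sigma> :: real
  proof -
    let ?f = "\<lambda>n. \<psi> n * of_nat n powr (- of_real \<sigma>)"
    have "?f sums 0" using L_sums[of "of_real \<sigma>"] zero[of \<sigma>] \<sigma> by simp
    then have "(\<lambda>n. ?f (n + 2)) sums (0 - (\<Sum>n<2. ?f n))" by (rule sums_split_initial_segment)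
    also have "(\<Sum>n<2. ?f n) = 1" using one by (simp add: numeral_2_eq_2)
    finally have s1: "(\<lambda>n. ?f (n + 2)) sums (-1)" by simp
    have bd: "norm (?f (n + 2)) \<le> real (n + 2) powr (-2) * 2 powr (2 - \<sigma>)" for n
    proof -
      have "norm (?f (n + 2)) \<le> 1 * real (n + 2) powr (- \<sigma>)"
        unfolding norm_mult norm_nat_powr by (intro mult_mono norm_le1) auto
      also have "\<dots> = real (n + 2) powr (-2) * real (n + 2) powr (2 - \<sigma>)"
        by (simp add: powr_add[symmetric] del: of_nat_add)
      also have "\<dots> \<le> real (n + 2) powr (-2) * 2 powr (2 - \<sigma>)"
        using \<sigma> by (intro mult_left_mono powr_mono2') auto
      finally show ?thesis .
    qed
    have "norm (\<Sum>n. ?f (n + 2)) \<le> (\<Sum>n. real (n + 2) powr (-2) * 2 powr (2 - \<sigma>))"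
      by (intro norm_suminf_le bd summable_mult2 smC)
    also have "\<dots> = C * 2 powr (2 - \<sigma>)" unfolding C_def by (rule suminf_mult2[OF smC, symmetric])
    also have "(\<Sum>n. ?f (n + 2)) = -1" using s1 by (rule sums_unique[symmetric])
    finally show ?thesis by simp
  qed
  note bound = this
  have "((\<lambda>\<sigma>::real. C * 2 powr (2 - \<sigma>)) \<longlongrightarrow> C * 0) at_top"
    by (intro tendsto_mult tendsto_const) real_asymp
  from order_tendstoD(2)[OF this, of 1]
  have "\<forall>\<^sub>F \<sigma> in at_top. C * 2 powr (2 - \<sigma>) < 1" by simp
  then have "\<forall>\<^sub>F \<sigma> in at_top. C * 2 powr (2 - \<sigma>) < 1 \<and> 2 < \<sigma>"
    using eventually_gt_at_top[of 2] by (rule eventually_conj)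
  then have "\<exists>\<sigma>. C * 2 powr (2 - \<sigma>) < 1 \<and> 2 < \<sigma>"
    by (rule eventually_happens'[rotated]) simp
  then obtain \<sigma> :: real where "C * 2 powr (2 - \<sigma>) < 1" "\<sigma> > 2" by blast
  with bound[of \<sigma>] show False by simp
qed

text \<open>The field arithmetic of a logarithmic derivative, isolated from the analysis:
  \<open>P\<close> and \<open>E\<close> stand for (w-z)^k and (w-1)^e, \<open>D\<close> and
  \<open>W\<close> for w-z and w-1.\<close>

lemma log_deriv_algebra:
  fixes m :: complex
  assumes "- (m * (g * P / E)) = ((g' * P + k * P / D * g) * E - g * P * (e * E / W)) / (E * E)"
    and nz: "P \<noteq> 0" "E \<noteq> 0" "g \<noteq> 0" "D \<noteq> 0" "W \<noteq> 0"
  shows "D * m = D * (e / W - g' / g) - k"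
proof -
  have "((g' * P + k * P / D * g) * E - g * P * (e * E / W)) / (E * E) = (g * P / E) * (g' / g + k / D - e / W)"
    using nz by (simp add: field_simps)
  with assms(1) have "(g * P / E) * (- m) = (g * P / E) * (g' / g + k / D - e / W)"
    by (simp add: mult.commute)
  then have "- m = g' / g + k / D - e / W" using nz by (simp only: mult_cancel_left) simp
  then have m: "m = e / W - g' / g - k / D" by (simp add: algebra_simps minus_equation_iff)
  have "D * m = D * (e / W - g' / g) - D * (k / D)" unfolding m by (simp only: right_diff_distrib)
  then show ?thesis using nz by simp
qed

text \<open>A zero of order k gives -L'/L a simple pole with residue -k, and a factor s - 1 in the
  denominator contributes +1 at s = 1. Carrying \<open>e\<close> along lets one statement serve zeta
  (\<open>e = 1\<close>) and L-functions without a pole (\<open>e = 0\<close>). The approach is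
  horizontal from the right, where \<open>M\<close> is a convergent series.\<close>

lemma log_deriv_limit:
  fixes e :: nat and t :: real
  assumes e: "e = 0 \<or> e = 1" and H: "H holomorphic_on {s. Re s > 0}"
    and HL: "\<And>s. Re s > 1 \<Longrightarrow> L s = H s / (s - 1) ^ e" and \<sigma>0: "\<sigma>0 \<ge> 1"
  shows "\<exists>k::nat. (k = 0 \<longleftrightarrow> H (Complex \<sigma>0 t) \<noteq> 0) \<and>
    ((\<lambda>\<sigma>. of_real (\<sigma> - \<sigma>0) * M (Complex \<sigma> t)) \<longlongrightarrow> (if t = 0 \<and> \<sigma>0 = 1 then of_nat e else 0) - of_nat k) (at_right \<sigma>0)"
proof -
  define z where "z = Complex \<sigma>0 t"
  let ?S = "{s. Re s > 0}"
  have op: "open ?S" by (rule open_halfspace_Re_gt)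
  have con: "connected ?S" by (intro convex_connected convex_halfspace_Re_gt)
  have zS: "z \<in> ?S" using \<sigma>0 by (simp add: z_def)
  obtain \<sigma>1 :: real where "\<sigma>1 > 1" "L (of_real \<sigma>1) \<noteq> 0" using L_nonzero_somewhere by blast
  then have nz: "\<exists>w\<in>?S. H w \<noteq> 0" using HL[of "of_real \<sigma>1"] by (intro bexI[of _ "of_real \<sigma>1"]) auto
  define n where "n = zorder H z"
  obtain r where r: "if H z = 0 then n > 0 else n = 0" "r > 0" "cball z r \<subseteq> ?S"
     "zor_poly H z holomorphic_on cball z r"
     "\<And>w. w \<in> cball z r \<Longrightarrow> H w = zor_poly H z w * (w - z) ^ nat n \<and> zor_poly H z w \<noteq> 0"
    using zorder_exist_zero[OF H op con zS nz] unfolding n_def by blast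
  define g where "g = zor_poly H z"
  define k where "k = nat n"
  have k0: "k = 0 \<longleftrightarrow> H z \<noteq> 0" using r(1) by (auto simp: k_def split: if_splits)
  have gnz: "g w \<noteq> 0" if "w \<in> cball z r" for w using r(5)[OF that] by (simp add: g_def)
  have g_hol: "g holomorphic_on ball z r" using r(4) ball_subset_cball by (auto simp: g_def intro: holomorphic_on_subset)
  have M_eq: "(w - z) * M w = (w - z) * (of_nat e / (w - 1) - deriv g w / g w) - of_nat k" if w: "w \<in> ball z r" "w \<noteq> z" "Re w > 1" for w
  proof -
    have w1: "w \<noteq> 1" using w by auto
    have Hw: "H v = g v * (v - z) ^ k" if "v \<in> ball z r" for v using r(5)[of v] that by (simp add: g_def k_def)
    have gw: "g w \<noteq> 0" using gnz w by auto
    have "(g has_field_derivative deriv g w) (at w)"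
      using g_hol w(1) by (meson holomorphic_derivI open_ball)
    then have "((\<lambda>v. g v * (v - z) ^ k / (v - 1) ^ e) has_field_derivative
      ((deriv g w * (w - z) ^ k + of_nat k * (w - z) ^ (k - 1) * g w) * (w - 1) ^ e - g w * (w - z) ^ k * (of_nat e * (w - 1) ^ (e - 1))) / ((w - 1) ^ e * (w - 1) ^ e)) (at w)"
      using w1 by (auto intro!: derivative_eq_intros simp: algebra_simps)
    then have "(L has_field_derivative
      ((deriv g w * (w - z) ^ k + of_nat k * (w - z) ^ (k - 1) * g w) * (w - 1) ^ e - g w * (w - z) ^ k * (of_nat e * (w - 1) ^ (e - 1))) / ((w - 1) ^ e * (w - 1) ^ e)) (at w)"
    proof (rule has_field_derivative_transform_within_open)
      show "open (ball z r \<inter> {s. Re s > 1})" by (intro open_Int open_ball open_halfspace_Re_gt)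
      show "w \<in> ball z r \<inter> {s. Re s > 1}" using w by auto
      show "g x * (x - z) ^ k / (x - 1) ^ e = L x" if "x \<in> ball z r \<inter> {s. Re s > 1}" for x
        using that Hw[of x] HL[of x] by auto
    qed
    then have "- (M w * L w) = ((deriv g w * (w - z) ^ k + of_nat k * (w - z) ^ (k - 1) * g w) * (w - 1) ^ e - g w * (w - z) ^ k * (of_nat e * (w - 1) ^ (e - 1))) / ((w - 1) ^ e * (w - 1) ^ e)"
      using L_deriv[OF w(3)] DERIV_unique by blast
    moreover have "L w = g w * (w - z) ^ k / (w - 1) ^ e" using HL[of w] Hw[of w] w by simp
    moreover have "of_nat k * (w - z) ^ (k - 1) = of_nat k * (w - z) ^ k / (w - z)"
      using w(2) by (cases k) auto
    ultimately have "- (M w * (g w * (w - z) ^ k / (w - 1) ^ e)) = ((deriv g w * (w - z) ^ k + of_nat k * (w - z) ^ k / (w - z) * g w) * (w - 1) ^ e - g w * (w - z) ^ k * (of_nat e * (w - 1) ^ (e - 1))) / ((w - 1) ^ e * (w - 1) ^ e)"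
      by simp
    moreover have "of_nat e * (w - 1) ^ (e - 1) = of_nat e * (w - 1) ^ e / (w - 1)"
      using w1 by (cases e) auto
    ultimately have "- (M w * (g w * (w - z) ^ k / (w - 1) ^ e)) = ((deriv g w * (w - z) ^ k + of_nat k * (w - z) ^ k / (w - z) * g w) * (w - 1) ^ e - g w * (w - z) ^ k * (of_nat e * (w - 1) ^ e / (w - 1))) / ((w - 1) ^ e * (w - 1) ^ e)"
      by simp
    then show ?thesis by (rule log_deriv_algebra) (use w w1 gw in auto)
  qed
  have lim: "((\<lambda>\<sigma>. Complex \<sigma> t) \<longlongrightarrow> z) (at_right \<sigma>0)"
    unfolding z_def by (intro tendsto_Complex tendsto_intros)
  have ev: "\<forall>\<^sub>F \<sigma> in at_right \<sigma>0. Complex \<sigma> t \<in> ball z r"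
    using topological_tendstoD[OF lim open_ball] r(2) by simp
  have diff: "Complex \<sigma> t - z = of_real (\<sigma> - \<sigma>0)" for \<sigma> by (simp add: z_def complex_eq_iff)
  have "isCont (\<lambda>w. deriv g w / g w) z"
  proof -
    have "deriv g holomorphic_on ball z r" by (intro holomorphic_deriv g_hol open_ball)
    then have "isCont (deriv g) z" "isCont g z"
      using g_hol r(2) by (auto simp: continuous_on_eq_continuous_at dest!: holomorphic_on_imp_continuous_on)
    then show ?thesis using gnz[of z] r(2) by (intro continuous_intros) auto
  qed
  then have lg: "((\<lambda>\<sigma>. deriv g (Complex \<sigma> t) / g (Complex \<sigma> t)) \<longlongrightarrow> deriv g z / g z) (at_right \<sigma>0)"
    using lim by (rule isCont_tendsto_compose)
  have l0: "((\<lambda>\<sigma>. complex_of_real (\<sigma> - \<sigma>0)) \<longlongrightarrow> of_real (\<sigma>0 - \<sigma>0)) (at_right \<sigma>0)"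
    by (intro tendsto_intros)
  have le: "((\<lambda>\<sigma>. of_real (\<sigma> - \<sigma>0) * (of_nat e / (Complex \<sigma> t - 1))) \<longlongrightarrow> (if t = 0 \<and> \<sigma>0 = 1 then of_nat e else 0)) (at_right \<sigma>0)"
  proof (cases "t = 0 \<and> \<sigma>0 = 1")
    case True
    have "\<forall>\<^sub>F \<sigma> in at_right \<sigma>0. of_real (\<sigma> - \<sigma>0) * (of_nat e / (Complex \<sigma> t - 1)) = complex_of_nat e"
      using eventually_at_right_less[of \<sigma>0]
    proof eventually_elim
      case (elim \<sigma>)
      have "Complex \<sigma> t - 1 = of_real (\<sigma> - \<sigma>0)" using True by (simp add: complex_eq_iff)
      then show ?case using elim by simp
    qed
    then show ?thesis using True by (simp add: tendsto_eventually)
  next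
    case False
    then have "z - 1 \<noteq> 0" by (auto simp: z_def complex_eq_iff)
    then have "((\<lambda>\<sigma>. of_real (\<sigma> - \<sigma>0) * (of_nat e / (Complex \<sigma> t - 1))) \<longlongrightarrow> of_real (\<sigma>0 - \<sigma>0) * (of_nat e / (z - 1))) (at_right \<sigma>0)"
      by (intro tendsto_intros lim l0)
    then show ?thesis by (simp only: if_not_P[OF False] diff_self of_real_0 mult_zero_left)
  qed
  have "((\<lambda>\<sigma>. of_real (\<sigma> - \<sigma>0) * (of_nat e / (Complex \<sigma> t - 1)) - of_real (\<sigma> - \<sigma>0) * (deriv g (Complex \<sigma> t) / g (Complex \<sigma> t)) - of_nat k)
      \<longlongrightarrow> (if t = 0 \<and> \<sigma>0 = 1 then of_nat e else 0) - of_real (\<sigma>0 - \<sigma>0) * (deriv g z / g z) - of_nat k) (at_right \<sigma>0)"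
    by (intro tendsto_diff le tendsto_mult l0 lg tendsto_const)
  moreover have "\<forall>\<^sub>F \<sigma> in at_right \<sigma>0. of_real (\<sigma> - \<sigma>0) * (of_nat e / (Complex \<sigma> t - 1)) - of_real (\<sigma> - \<sigma>0) * (deriv g (Complex \<sigma> t) / g (Complex \<sigma> t)) - of_nat k = of_real (\<sigma> - \<sigma>0) * M (Complex \<sigma> t)"
    using ev eventually_at_right_less[of \<sigma>0]
  proof eventually_elim
    case (elim \<sigma>)
    then have "Complex \<sigma> t \<noteq> z" by (auto simp: z_def)
    then show ?case using M_eq[of "Complex \<sigma> t"] elim \<sigma>0 unfolding diff by (simp add: algebra_simps)
  qed
  ultimately have "((\<lambda>\<sigma>. of_real (\<sigma> - \<sigma>0) * M (Complex \<sigma> t)) \<longlongrightarrow> (if t = 0 \<and> \<sigma>0 = 1 then of_nat e else 0) - of_real (\<sigma>0 - \<sigma>0) * (deriv g z / g z) - of_nat k) (at_right \<sigma>0)"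
    by (rule Lim_transform_eventually)
  then have "((\<lambda>\<sigma>. of_real (\<sigma> - \<sigma>0) * M (Complex \<sigma> t)) \<longlongrightarrow> (if t = 0 \<and> \<sigma>0 = 1 then of_nat e else 0) - of_nat k) (at_right \<sigma>0)"
    by (simp only: diff_self of_real_0 mult_zero_left diff_zero)
  with k0 show ?thesis unfolding z_def by (intro exI[of _ k] conjI)
qed

end

section \<open>Lambert series of real characters\<close>

lemma sum_divisors_coprime_mult:
  fixes f :: "nat \<Rightarrow> real"
  assumes "coprime a b" and f: "\<And>m n. f (m * n) = f m * f n"
  shows "(\<Sum>d | d dvd a * b. f d) = (\<Sum>d | d dvd a. f d) * (\<Sum>d | d dvd b. f d)"
proof -
  have gcds: "gcd (x * y) a = x" "gcd (x * y) b = y" if "x dvd a" "y dvd b" for x y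
  proof -
    have "coprime a y" "coprime b x" using assms(1) that
      by (meson coprime_commute coprime_divisors dvd_refl)+
    note c = this
    have "gcd (x * y) a = gcd x a" using c(1) by (rule gcd_mult_left_right_cancel)
    then show "gcd (x * y) a = x" using that by (simp add: gcd_nat.absorb1)
    have "gcd (x * y) b = gcd y b" using c(2) by (rule gcd_mult_left_left_cancel)
    then show "gcd (x * y) b = y" using that by (simp add: gcd_nat.absorb1)
  qed
  have "(\<Sum>d | d dvd a. f d) * (\<Sum>d | d dvd b. f d) = (\<Sum>(x, y)\<in>{d. d dvd a} \<times> {d. d dvd b}. f (x * y))"
    by (simp add: sum_product sum.cartesian_product f)
  also have "\<dots> = (\<Sum>d | d dvd a * b. f d)"
  proof (rule sum.reindex_bij_witness[where j = "\<lambda>(x, y). x * y" and i = "\<lambda>d. (gcd d a, gcd d b)"])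
    fix d assume "d \<in> {d. d dvd a * b}"
    then obtain x y where "d = x * y" "x dvd a" "y dvd b" using division_decomp by blast
    then show "(\<lambda>(x, y). x * y) (gcd d a, gcd d b) = d" using gcds[of x y] by simp
  next
    fix p assume "p \<in> {d. d dvd a} \<times> {d. d dvd b}"
    then show "(\<lambda>d. (gcd d a, gcd d b)) (case p of (x, y) \<Rightarrow> x * y) = p"
      using gcds by auto
  qed (auto simp: mult_dvd_mono)
  finally show ?thesis ..
qed

text \<open>On a prime power p^k the sum is 1 + f(p) + ... + f(p)^k, which is at least 1 except when
  f(p) = -1 and k is odd, and then it is 0. Multiplicativity over coprime factors does the rest; the
  condition on multiplicities says that n is a square.\<close>

lemma divisor_sum_real_char_ge:
  fixes f :: "nat \<Rightarrow> real"
  assumes mult: "\<And>m n. f (m * n) = f m * f n" and f1: "f 1 = 1"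
    and vals: "\<And>n. f n \<in> {-1, 0, 1}" and "n > 0"
  shows "(\<Sum>d | d dvd n. f d) \<ge> (if \<forall>p. prime p \<longrightarrow> even (multiplicity p n) then 1 else 0)"
  using \<open>n > 0\<close>
proof (induction n rule: less_induct)
  case (less n)
  show ?case
  proof (cases "n = 1")
    case True
    have "{d. d dvd Suc 0} = {1}" by auto
    then show ?thesis using True f1 by simp
  next
    case False
    then obtain p where p: "prime p" "p dvd n" using less.prems prime_factor_nat by blast
    define k where "k = multiplicity p n"
    obtain m where m: "n = p ^ k * m" "\<not> p dvd m"
    proof (rule multiplicity_decompose'[of n p])
      show "n \<noteq> 0" "\<not> is_unit p" using less.prems p prime_gt_1_nat[OF p(1)] by auto
    qed (use that in \<open>auto simp: k_def\<close>)
    have k: "k > 0" using p less.prems prime_multiplicity_gt_zero_iff[of p n] by (simp add: k_def)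
    have "p ^ k > 1" using k one_less_power[OF prime_gt_1_nat[OF p(1)]] by blast
    then have mn: "m < n" "m > 0" using m less.prems by auto
    have cop: "coprime (p ^ k) m" using m p by (simp add: prime_imp_coprime)
    have multeq: "multiplicity r n = (if r = p then k else multiplicity r m)" if "prime r" for r
    proof (cases "r = p")
      case False
      then have "\<not> r dvd p ^ k" using that p by (meson prime_dvd_power primes_dvd_imp_eq)
      then have "multiplicity r (p ^ k) = 0" by (rule not_dvd_imp_multiplicity_0)
      then show ?thesis using False that mn m p prime_gt_0_nat[OF p(1)]
        by (simp add: prime_elem_multiplicity_mult_distrib)
    qed (simp add: k_def)
    have fp: "f (p ^ j) = f p ^ j" for j by (induction j) (use f1 mult in auto)
    have "(\<Sum>d | d dvd p ^ k. f d) = (\<Sum>j\<le>k. f (p ^ j))"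
    proof -
      have "{d. d dvd p ^ k} = (\<lambda>j. p ^ j) ` {..k}" using p by (auto simp: divides_primepow_nat)
      moreover have "inj_on (\<lambda>j. p ^ j) {..k}" using prime_gt_1_nat[OF p(1)] by (auto intro: inj_onI)
      ultimately show ?thesis by (simp add: sum.reindex)
    qed
    also have "\<dots> = (\<Sum>j\<le>k. f p ^ j)" by (simp add: fp)
    finally have P: "(\<Sum>d | d dvd p ^ k. f d) = (\<Sum>j\<le>k. f p ^ j)" .
    have m1: "(\<Sum>j\<le>k. (-1::real) ^ j) = (if even k then 1 else 0)" by (induction k) auto
    have Q: "(\<Sum>j\<le>k. f p ^ j) \<ge> (if even k then 1 else 0)"
      using vals[of p] m1 by (auto simp: power_0_left sum.delta)
    have R: "(\<Sum>d | d dvd m. f d) \<ge> (if \<forall>p. prime p \<longrightarrow> even (multiplicity p m) then 1 else 0)"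
      using less.IH[OF mn] .
    have "(if \<forall>r. prime r \<longrightarrow> even (multiplicity r n) then 1 else 0 :: real)
       \<le> (if even k then 1 else 0) * (if \<forall>p. prime p \<longrightarrow> even (multiplicity p m) then 1 else 0)"
    proof -
      have "even (multiplicity r m)" if "\<forall>r. prime r \<longrightarrow> even (multiplicity r n)" "prime r" for r
        using that multeq[of r] m(2) by (cases "r = p") (auto simp: not_dvd_imp_multiplicity_0)
      moreover have "even k" if "\<forall>r. prime r \<longrightarrow> even (multiplicity r n)" using that p by (simp add: k_def)
      ultimately show ?thesis by auto
    qed
    also have "\<dots> \<le> (\<Sum>j\<le>k. f p ^ j) * (\<Sum>d | d dvd m. f d)"
      using Q R by (intro mult_mono) (auto split: if_splits)
    also have "\<dots> = (\<Sum>d | d dvd n. f d)"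
      using sum_divisors_coprime_mult[OF cop mult] by (simp add: m(1) P)
    finally show ?thesis .
  qed
qed

text \<open>Expanding x^n / (1 - x^n) as a geometric series gives an absolutely convergent double
  sum over (n, k), which is regrouped by the product n k.\<close>

lemma lambert_sums:
  fixes f :: "nat \<Rightarrow> real" and x :: real
  assumes f: "\<And>n. \<bar>f n\<bar> \<le> 1" and x: "0 < x" "x < 1"
  shows "\<exists>S. (\<lambda>n. f (Suc n) * (x ^ Suc n / (1 - x ^ Suc n))) sums S \<and>
     ((\<lambda>n. (\<Sum>d | d dvd n. f d) * x ^ n) has_sum S) {0<..}"
proof -
  let ?P = "{0<..} :: nat set"
  have geo: "((\<lambda>k. y ^ k) has_sum (y / (1 - y))) ?P" if "0 < y" "y < 1" for y :: real
  proof -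
    have "(\<lambda>k. y ^ Suc k) sums (y * (1 / (1 - y)))"
      using sums_mult[OF geometric_sums[of y], of y] that by simp
    then have "((\<lambda>k. y ^ Suc k) has_sum (y / (1 - y))) UNIV"
      using that by (intro norm_summable_imp_has_sum) (auto simp: abs_mult power_abs intro!: summable_mult summable_geometric)
    then show ?thesis
      by (subst (asm) has_sum_reindex_bij_betw[of Suc UNIV ?P "\<lambda>k. y ^ k", unfolded o_def])
         (auto simp: bij_betw_def image_def gr0_conv_Suc)
  qed
  have xn: "0 < x ^ n" "x ^ n < 1" if "n > 0" for n using x that by (auto simp: power_Suc_less_one power_less_one_iff)
  have inner: "((\<lambda>k. f n * x ^ (n * k)) has_sum (f n * (x ^ n / (1 - x ^ n)))) ?P" if "n \<in> ?P" for n
    using has_sum_cmult_right[OF geo[OF xn[of n]], of "f n"] that by (simp add: power_mult)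
  have bd: "x ^ n / (1 - x ^ n) \<le> x ^ n / (1 - x)" if "n > 0" for n
  proof -
    have "x ^ n \<le> x" using x that power_decreasing[of 1 n x] by simp
    then show ?thesis using x xn[OF that] by (intro divide_left_mono) auto
  qed
  have outer: "(\<lambda>n. x ^ n / (1 - x ^ n)) summable_on ?P"
  proof (rule summable_on_comparison_test)
    show "(\<lambda>n. x ^ n / (1 - x)) summable_on ?P"
      using summable_on_cmult_left[OF has_sum_imp_summable[OF geo[OF x]], of "1/(1-x)"] by simp
  qed (use bd xn in \<open>auto simp: less_imp_le\<close>)
  have "(\<lambda>p. norm (case p of (n, k) \<Rightarrow> f n * x ^ (n * k))) summable_on ?P \<times> ?P"
  proof (rule summable_on_comparison_test)
    show "(\<lambda>(n, k). x ^ (n * k)) summable_on ?P \<times> ?P"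
    proof (rule summable_on_SigmaI[OF _ outer])
      show "((\<lambda>k. case (n, k) of (n, k) \<Rightarrow> x ^ (n * k)) has_sum x ^ n / (1 - x ^ n)) ?P" if "n \<in> ?P" for n
        using geo[OF xn[of n]] that by (simp add: power_mult)
    qed (use x in auto)
  qed (use f x in \<open>auto simp: abs_mult power_abs intro!: mult_left_le_one_le\<close>)
  then have "(\<lambda>(n, k). f n * x ^ (n * k)) summable_on ?P \<times> ?P" by (rule abs_summable_summable)
  then obtain S where S: "((\<lambda>(n, k). f n * x ^ (n * k)) has_sum S) (?P \<times> ?P)"
    by (auto simp: summable_on_def)
  have "((\<lambda>n. f n * (x ^ n / (1 - x ^ n))) has_sum S) ?P"
    by (rule has_sum_SigmaD[OF S]) (use inner in auto)
  then have "((\<lambda>n. f (Suc n) * (x ^ Suc n / (1 - x ^ Suc n))) has_sum S) UNIV"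
    by (subst has_sum_reindex_bij_betw[of Suc UNIV ?P "\<lambda>n. f n * (x ^ n / (1 - x ^ n))", unfolded o_def])
         (auto simp: bij_betw_def image_def gr0_conv_Suc)
  then have 1: "(\<lambda>n. f (Suc n) * (x ^ Suc n / (1 - x ^ Suc n))) sums S" by (rule has_sum_imp_sums)
  have "((\<lambda>(n, d). f d * x ^ n) has_sum S) (SIGMA n:?P. {d. d dvd n})"
  proof (rule iffD1[OF has_sum_reindex_bij_witness S])
    show "(case (\<lambda>(d, e). (d * e, d)) a' of (n, d) \<Rightarrow> f d * x ^ n)
       = (case a' of (n, k) \<Rightarrow> f n * x ^ (n * k))" if "a' \<in> ?P \<times> ?P" for a'
      using that by auto
  next
    show "(\<lambda>(n, d). (d, n div d)) ((\<lambda>(d, e). (d * e, d)) a) = a" if "a \<in> ?P \<times> ?P" for a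
      using that by auto
  qed (auto simp: dvd_div_eq_0_iff elim!: dvdE)
  then have "((\<lambda>n. (\<Sum>d | d dvd n. f d) * x ^ n) has_sum S) ?P"
    by (rule has_sum_SigmaD) (auto simp: sum_distrib_right intro!: has_sum_finite finite_divisors_nat)
  with 1 show ?thesis by blast
qed

lemma lambert_unbounded:
  fixes f :: "nat \<Rightarrow> real"
  assumes mult: "\<And>m n. f (m * n) = f m * f n" and f1: "f 1 = 1"
    and vals: "\<And>n. f n \<in> {-1, 0, 1}"
  shows "\<exists>x. 0 < x \<and> x < 1 \<and> (\<forall>S. (\<lambda>n. f (Suc n) * (x ^ Suc n / (1 - x ^ Suc n))) sums S \<longrightarrow> S \<ge> real K)"
proof -
  \<comment> \<open>Each of the squares 1, 4, ..., N^2 contributes at least x^(N^2) > 1/2, so 2K + 1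
    of them exceed K; the remaining terms are nonnegative.\<close>
  define N where "N = 2 * K + 1"
  have "((\<lambda>x::real. x ^ (N ^ 2)) \<longlongrightarrow> 1 ^ (N^2)) (at_left 1)" by (intro tendsto_intros)
  then have "\<forall>\<^sub>F x in at_left 1. x ^ (N^2) > (1/2::real)" by (intro order_tendstoD(1)[where y=1]) simp_all
  then have "\<forall>\<^sub>F x in at_left 1. x ^ (N^2) > (1/2::real) \<and> 0 < x \<and> x < 1"
    using eventually_at_left_real[of 0 "1::real"] by (auto intro: eventually_conj)
  then obtain x :: real where x: "x ^ (N^2) > 1/2" "0 < x" "x < 1"
    using eventually_happens'[OF trivial_limit_at_left_real] by blast
  have ge: "(\<Sum>d | d dvd n. f d) \<ge> 0" "(\<exists>m. n = m ^ 2) \<Longrightarrow> (\<Sum>d | d dvd n. f d) \<ge> 1" if "n > 0" for n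
  proof -
    note * = divisor_sum_real_char_ge[OF mult f1 vals that]
    show "(\<Sum>d | d dvd n. f d) \<ge> 0" using * by (rule order_trans[rotated]) auto
    assume "\<exists>m. n = m ^ 2"
    then obtain m where "n = m ^ 2" by blast
    then have "\<forall>p. prime p \<longrightarrow> even (multiplicity p n)"
      using that by (auto simp: prime_elem_multiplicity_power_distrib)
    then show "(\<Sum>d | d dvd n. f d) \<ge> 1" using * by simp
  qed
  have fb: "\<bar>f n\<bar> \<le> 1" for n using vals[of n] by auto
  have "S \<ge> real K" if S: "(\<lambda>n. f (Suc n) * (x ^ Suc n / (1 - x ^ Suc n))) sums S" for S
  proof -
    obtain S' where S': "(\<lambda>n. f (Suc n) * (x ^ Suc n / (1 - x ^ Suc n))) sums S'"
     "((\<lambda>n. (\<Sum>d | d dvd n. f d) * x ^ n) has_sum S') {0<..}" using lambert_sums[of f, OF fb x(2,3)] by blast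
    have "S' = S" using S S' sums_unique2 by blast
    have sq: "inj_on (\<lambda>m::nat. m ^ 2) {1..N}" by (auto intro: inj_onI)
    have "real K \<le> (\<Sum>m=1..N. 1/2)" by (simp add: N_def)
    also have "\<dots> \<le> (\<Sum>m=1..N. (\<Sum>d | d dvd m^2. f d) * x ^ (m^2))"
    proof (rule sum_mono)
      fix m assume m: "m \<in> {1..N}"
      have xx: "x ^ (N^2) \<le> x ^ (m^2)" using m x by (intro power_decreasing) (auto intro: power_mono)
      have "1/2 \<le> x ^ (m^2)" using xx x(1) by linarith
      moreover have "1 \<le> (\<Sum>d | d dvd m^2. f d)" by (rule ge(2)) (use m in auto)
      ultimately have "1 * (1/2) \<le> (\<Sum>d | d dvd m^2. f d) * x ^ (m^2)"
        by (intro mult_mono) auto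
      then show "1/2 \<le> (\<Sum>d | d dvd m^2. f d) * x ^ (m^2)" by simp
    qed
    also have "\<dots> = (\<Sum>n\<in>(\<lambda>m. m ^ 2) ` {1..N}. (\<Sum>d | d dvd n. f d) * x ^ n)"
      by (subst sum.reindex[OF sq]) (simp add: o_def)
    also have "\<dots> \<le> S'"
      by (rule has_sum_mono2[OF has_sum_finite S'(2)]) (use ge(1) x in auto)
    finally show ?thesis using \<open>S' = S\<close> by simp
  qed
  then show ?thesis using x by blast
qed

lemma dchar_one: "dchar (\<lambda>_. 1) 1"
  by unfold_locales auto

lemma decreasing_sum_by_parts_bound:
  fixes b :: "nat \<Rightarrow> real" and f :: "nat \<Rightarrow> real"
  assumes dec: "\<And>n. b (Suc n) \<le> b n" and nn: "\<And>n. b n \<ge> 0"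
    and bd: "\<And>n. \<bar>\<Sum>k<n. f k\<bar> \<le> C"
  shows "\<bar>\<Sum>k<n. f k * b k\<bar> \<le> C * b 0"
proof -
  define F where "F n = (\<Sum>k<n. f k)" for n
  have C: "C \<ge> 0" using bd[of 0] by simp
  have parts: "(\<Sum>k<n. f k * b k) = (\<Sum>k<n. F (Suc k) * (b k - b (Suc k))) + F n * b n" for n
    by (induction n) (simp_all add: F_def algebra_simps)
  have "\<bar>\<Sum>k<n. f k * b k\<bar> \<le> \<bar>\<Sum>k<n. F (Suc k) * (b k - b (Suc k))\<bar> + \<bar>F n * b n\<bar>"
    unfolding parts by (rule abs_triangle_ineq)
  also have "\<dots> \<le> (\<Sum>k<n. C * (b k - b (Suc k))) + C * b n"
  proof (rule add_mono)
    show "\<bar>\<Sum>k<n. F (Suc k) * (b k - b (Suc k))\<bar> \<le> (\<Sum>k<n. C * (b k - b (Suc k)))"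
    proof (rule order_trans[OF sum_abs sum_mono])
      fix k
      have "\<bar>F (Suc k)\<bar> * (b k - b (Suc k)) \<le> C * (b k - b (Suc k))"
        using bd[of "Suc k"] dec[of k] by (intro mult_right_mono) (auto simp: F_def)
      then show "\<bar>F (Suc k) * (b k - b (Suc k))\<bar> \<le> C * (b k - b (Suc k))"
        using dec[of k] by (simp add: abs_mult)
    qed
    show "\<bar>F n * b n\<bar> \<le> C * b n" using bd[of n] nn[of n] by (simp add: abs_mult F_def mult_right_mono)
  qed
  also have "(\<Sum>k<n. C * (b k - b (Suc k))) = C * (b 0 - b n)"
    by (induction n) (simp_all add: algebra_simps)
  finally show ?thesis by (simp add: algebra_simps)
qed

lemma geometric_sum_rec: "(\<Sum>i<Suc n. x ^ i) = 1 + x * (\<Sum>i<n. x ^ i)" for x :: real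
  unfolding sum.lessThan_Suc_shift by (simp add: sum_distrib_left)

text \<open>Pairing the term (i, j) with its mirror image gives exponents adding up to 2n - 1; by
  the arithmetic-geometric mean inequality and x \<le> 1 each pair is at least 2 x^n. This is what
  makes the sequence \<open>b\<close> in \<open>L_one_real_nonzero\<close> decrease.\<close>

lemma geometric_sums_amgm:
  fixes x :: real assumes "0 \<le> x" "x \<le> 1"
  shows "real n * real (Suc n) * x ^ n \<le> (\<Sum>i<n. x ^ i) * (\<Sum>i<Suc n. x ^ i)"
proof -
  have main: "2 * x ^ n \<le> x ^ a + x ^ b" if "a + b + 1 = 2 * n" "a \<le> b" for a b
  proof -
    define c where "c = n - 1 - a"
    have b: "b = a + (2 * c + 1)" and n: "n = a + (c + 1)" using that by (auto simp: c_def)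
    have "0 \<le> (1 - x ^ (c + 1))\<^sup>2" by simp
    also have "\<dots> = 1 + (x ^ (c + 1))\<^sup>2 - 2 * x ^ (c + 1)"
      by (simp add: power2_diff)
    also have "(x ^ (c + 1))\<^sup>2 = x ^ (2 * c + 2)"
      unfolding power_mult[symmetric] by (simp add: algebra_simps)
    also have "x ^ (2 * c + 2) \<le> x ^ (2 * c + 1)" using assms by (intro power_decreasing) auto
    finally have "0 \<le> x ^ a * (1 + x ^ (2 * c + 1) - 2 * x ^ (c + 1))" using assms by simp
    then show ?thesis unfolding b n power_add by (simp add: algebra_simps)
  qed
  have main': "2 * x ^ n \<le> x ^ a + x ^ b" if "a + b + 1 = 2 * n" for a b
    using main[of a b] main[of b a] that by (cases "a \<le> b") (auto simp: add.commute)
  have r1: "(\<Sum>i<n. x ^ i) = (\<Sum>i<n. x ^ (n - Suc i))" for n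
    by (rule sum.nat_diff_reindex[symmetric])
  have "2 * ((\<Sum>i<n. x ^ i) * (\<Sum>i<Suc n. x ^ i)) = (\<Sum>i<n. x ^ i) * (\<Sum>i<Suc n. x ^ i) + (\<Sum>i<n. x ^ (n - Suc i)) * (\<Sum>i<Suc n. x ^ (Suc n - Suc i))"
    unfolding r1[symmetric] by simp
  also have "\<dots> = (\<Sum>i<n. \<Sum>j<Suc n. x ^ (i + j) + x ^ ((n - Suc i) + (Suc n - Suc j)))"
    unfolding sum_product sum.distrib power_add ..
  also have "\<dots> \<ge> (\<Sum>i<n. \<Sum>j<Suc n. 2 * x ^ n)"
    by (intro sum_mono main') auto
  finally show ?thesis by (simp add: algebra_simps)
qed

section \<open>Non-vanishing of L-functions for Re s \<ge> 1\<close>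

context dchar
begin

lemma M_bounded:
  assumes "1 < a" "a \<le> Re s" shows "norm (M s) \<le> (\<Sum>n. mangoldt n * real n powr (- a))"
  unfolding M_def
proof (rule norm_suminf_le)
  fix n
  have "norm (mangoldt n * \<psi> n * of_nat n powr (-s)) \<le> mangoldt n * real n powr (- Re s)" by (rule M_term_le)
  also have "\<dots> \<le> mangoldt n * real n powr (- a)"
  proof (cases "n = 0")
    case False
    then show ?thesis using assms by (intro mult_left_mono powr_mono) (auto simp: mangoldt_nonneg)
  qed simp
  finally show "norm (mangoldt n * \<psi> n * of_nat n powr (-s)) \<le> mangoldt n * real n powr (- a)" .
qed (use assms in \<open>auto intro: summable_mangoldt_powr\<close>)

text \<open>A zero would give -L'/L a pole, but the series \<open>M\<close> is bounded near every
  point with Re s > 1.\<close>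

lemma H_nonzero_gt_1:
  fixes e :: nat
  assumes e: "e = 0 \<or> e = 1" and H: "H holomorphic_on {s. Re s > 0}"
    and HL: "\<And>s. Re s > 1 \<Longrightarrow> L s = H s / (s - 1) ^ e" and s: "Re s > 1"
  shows "H s \<noteq> 0"
proof -
  obtain k :: nat where k: "k = 0 \<longleftrightarrow> H (Complex (Re s) (Im s)) \<noteq> 0"
    "((\<lambda>\<sigma>. of_real (\<sigma> - Re s) * M (Complex \<sigma> (Im s))) \<longlongrightarrow> (if Im s = 0 \<and> Re s = 1 then of_nat e else 0) - of_nat k) (at_right (Re s))"
    using log_deriv_limit[OF e H HL, of "Re s" "Im s"] s by auto
  define B where "B = (\<Sum>n. mangoldt n * real n powr (- Re s))"
  have "((\<lambda>\<sigma>. of_real (\<sigma> - Re s) * M (Complex \<sigma> (Im s))) \<longlongrightarrow> 0) (at_right (Re s))"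
  proof (rule Lim_null_comparison)
    show "\<forall>\<^sub>F \<sigma> in at_right (Re s). norm (of_real (\<sigma> - Re s) * M (Complex \<sigma> (Im s))) \<le> (\<sigma> - Re s) * B"
      using eventually_at_right_less[of "Re s"]
    proof eventually_elim
      case (elim \<sigma>)
      then show ?case unfolding norm_mult B_def norm_of_real
        using M_bounded[OF s, of "Complex \<sigma> (Im s)"] by (auto intro!: mult_left_mono)
    qed
    have "((\<lambda>\<sigma>. (\<sigma> - Re s) * B) \<longlongrightarrow> (Re s - Re s) * B) (at_right (Re s))" by (intro tendsto_intros)
    then show "((\<lambda>\<sigma>. (\<sigma> - Re s) * B) \<longlongrightarrow> 0) (at_right (Re s))" by simp
  qed
  with k(2) have "(if Im s = 0 \<and> Re s = 1 then of_nat e else 0) - of_nat k = (0::complex)"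
    by (rule tendsto_unique[rotated]) simp
  then have "k = 0" using s by simp
  with k(1) show ?thesis by simp
qed

text \<open>The classical 3 + 4 cos t + cos 2t \<ge> 0 in the form 3 + 4 Re w + Re w^2 \<ge> 2 (1 +
  Re w)^2 for |w| \<le> 1. Allowing |w| < 1 covers the n with \<psi>(n) = 0, so that zeta itself can
  stand in for the principal character modulo q.\<close>

lemma three_four_one:
  assumes "\<sigma> > 1"
  shows "3 * Re (dchar.M (\<lambda>_. 1) (Complex \<sigma> 0)) + 4 * Re (M (Complex \<sigma> t)) + Re (dchar.M (\<lambda>n. \<psi> n ^ 2) (Complex \<sigma> (2 * t))) \<ge> 0"
proof -
  interpret o: dchar "\<lambda>_. 1" 1 by (rule dchar_one)
  interpret sq: dchar "\<lambda>n. \<psi> n ^ 2" q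
    using q_pos mult one periodic zero by unfold_locales (auto simp: power_mult_distrib)
  have 1: "(\<lambda>n. 3 * Re (mangoldt n * 1 * of_nat n powr (- Complex \<sigma> 0)) + 4 * Re (mangoldt n * \<psi> n * of_nat n powr (- Complex \<sigma> t))
     + Re (mangoldt n * (\<psi> n)\<^sup>2 * of_nat n powr (- Complex \<sigma> (2 * t)))) sums
     (3 * Re (o.M (Complex \<sigma> 0)) + 4 * Re (M (Complex \<sigma> t)) + Re (sq.M (Complex \<sigma> (2 * t))))"
    by (intro sums_add sums_mult sums_Re o.M_sums M_sums sq.M_sums) (use assms in auto)
  show ?thesis
  proof (rule sums_le[OF _ sums_zero 1])
    fix n
    show "0 \<le> 3 * Re (mangoldt n * 1 * of_nat n powr (- Complex \<sigma> 0)) + 4 * Re (mangoldt n * \<psi> n * of_nat n powr (- Complex \<sigma> t))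
     + Re (mangoldt n * (\<psi> n)\<^sup>2 * of_nat n powr (- Complex \<sigma> (2 * t)))"
    proof (cases "n = 0")
      case False
      define u where "u = complex_of_nat n powr (- Complex 0 t)"
      define r where "r = real n powr (- \<sigma>)"
      have eq: "of_nat n powr (- Complex \<sigma> \<tau>) = of_real r * of_nat n powr (- Complex 0 \<tau>)" for \<tau>
      proof -
        have "- Complex \<sigma> \<tau> = of_real (-\<sigma>) + (- Complex 0 \<tau>)" by (simp add: complex_eq_iff)
        then show ?thesis using False powr_of_real[of "real n" "-\<sigma>"] by (simp only: powr_add r_def) simp
      qed
      have u2: "of_nat n powr (- Complex 0 (2*t)) = u ^ 2"
      proof -
        have "- Complex 0 (2*t) = (- Complex 0 t) + (- Complex 0 t)" by (simp add: complex_eq_iff)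
        then show ?thesis by (simp only: powr_add u_def power2_eq_square)
      qed
      have u0: "of_nat n powr (- Complex 0 0) = (1::complex)" using False by (simp add: zero_complex.code[symmetric])
      define w where "w = \<psi> n * u"
      have "norm u = 1" using norm_nat_powr[of n "Complex 0 t"] False by (simp add: u_def)
      then have "norm w \<le> 1" using norm_le1 by (simp add: w_def norm_mult)
      then have "(norm w)\<^sup>2 \<le> 1" by (simp add: power_le_one)
      then have w: "(Re w)\<^sup>2 + (Im w)\<^sup>2 \<le> 1" by (simp add: cmod_power2)
      have "2 * (1 + Re w)\<^sup>2 \<ge> 0" by simp
      then have "0 \<le> 3 + 4 * Re w + Re (w\<^sup>2)" using w by (simp add: power2_eq_square algebra_simps)
      then have "0 \<le> mangoldt n * r * (3 + 4 * Re w + Re (w\<^sup>2))"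
        by (intro mult_nonneg_nonneg) (auto simp: mangoldt_nonneg r_def)
      also have "\<dots> = 3 * Re (of_real (mangoldt n * r)) + 4 * Re (of_real (mangoldt n * r) * w) + Re (of_real (mangoldt n * r) * w\<^sup>2)"
        by (simp add: algebra_simps)
      also have "\<dots> = 3 * Re (mangoldt n * 1 * of_nat n powr (- Complex \<sigma> 0)) + 4 * Re (mangoldt n * \<psi> n * of_nat n powr (- Complex \<sigma> t))
     + Re (mangoldt n * (\<psi> n)\<^sup>2 * of_nat n powr (- Complex \<sigma> (2 * t)))"
        unfolding eq[of 0] eq[of t] eq[of "2*t"] u2 u0 u_def[symmetric] w_def
        by (simp add: power_mult_distrib ac_simps)
      finally show ?thesis .
    qed simp
  qed
qed

text \<open>Multiplication by a unit permutes the residues, so the sum over a period does not change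
  when multiplied by \<psi>(a).\<close>

lemma mean_nonzero_imp_trivial:
  assumes "mean \<noteq> 0" "coprime a q" shows "\<psi> a = 1"
proof -
  have "(\<Sum>k<q. \<psi> (a * k)) = (\<Sum>k<q. \<psi> ((a * k) mod q))" by (simp add: psi_mod)
  also have "\<dots> = (\<Sum>k<q. \<psi> k)"
  proof (rule sum.reindex_bij_betw)
    have inj: "inj_on (\<lambda>k. (a * k) mod q) {..<q}"
    proof (rule inj_onI)
      fix x y assume "x \<in> {..<q}" "y \<in> {..<q}" "(a * x) mod q = (a * y) mod q"
      then have "[a * x = a * y] (mod q)" "x < q" "y < q" by (auto simp: cong_def)
      then show "x = y" using assms(2) by (metis cong_mult_lcancel_nat cong_less_modulus_unique_nat)
    qed
    have "(\<lambda>k. (a * k) mod q) ` {..<q} = {..<q}"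
      by (rule endo_inj_surj[OF _ _ inj]) (use q_pos in auto)
    with inj show "bij_betw (\<lambda>k. (a * k) mod q) {..<q} {..<q}" by (simp add: bij_betw_def)
  qed
  finally have "\<psi> a * (\<Sum>k<q. \<psi> k) = (\<Sum>k<q. \<psi> k)" by (simp add: mult sum_distrib_left)
  moreover have "(\<Sum>k<q. \<psi> k) \<noteq> 0" using assms(1) by (auto simp: mean_def)
  ultimately show ?thesis by simp
qed

text \<open>Monsky's argument. If L(1) = 0, the Lambert series of f equals, up to sign, a series
  with weights that decrease from 1 to nonnegative values, so summation by parts bounds it by 2q for
  every x in (0, 1). But \<open>lambert_unbounded\<close> makes it arbitrarily large.\<close>

lemma L_one_real_nonzero:
  assumes m0: "mean = 0" and re: "\<And>n. \<psi> n \<in> {-1, 0, 1}"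
    and h: "(\<lambda>n. \<psi> (Suc n) * of_nat (Suc n) powr (-1)) sums h1"
  shows "h1 \<noteq> 0"
proof
  assume h10: "h1 = 0"
  define f where "f n = Re (\<psi> n)" for n
  have psif: "\<psi> n = of_real (f n)" for n using re[of n] by (auto simp: f_def complex_eq_iff)
  have f_mult: "f (m * n) = f m * f n" for m n
    using mult[of m n] unfolding psif by (metis of_real_eq_iff of_real_mult)
  have f1: "f 1 = 1" using one by (simp add: f_def)
  have fv: "f n \<in> {-1, 0, 1}" for n using re[of n] by (auto simp: f_def)
  have fb: "\<bar>\<Sum>k<n. f (Suc k)\<bar> \<le> 2 * real q" for n
    using bounded_partial_sums[of n] unfolding m0 psif by (simp flip: of_real_sum)
  have fs: "(\<lambda>n. f (Suc n) / real (Suc n)) sums 0"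
  proof -
    have "(\<lambda>n. Re (\<psi> (Suc n) * of_nat (Suc n) powr (-1))) sums Re h1" by (intro sums_Re h)
    moreover have "Re (\<psi> (Suc n) * of_nat (Suc n) powr (-1)) = f (Suc n) / real (Suc n)" for n
    proof -
      have "complex_of_nat (Suc n) powr (-1) = of_real (inverse (real (Suc n)))"
        by (simp add: powr_minus del: of_nat_Suc)
      then show ?thesis unfolding psif by (simp only: of_real_mult[symmetric] Re_complex_of_real divide_inverse)
    qed
    ultimately show ?thesis using h10 by simp
  qed
  obtain K :: nat where K: "real K > 2 * real q" using reals_Archimedean2 by blast
  obtain x :: real where x: "0 < x" "x < 1"
    "\<And>S. (\<lambda>n. f (Suc n) * (x ^ Suc n / (1 - x ^ Suc n))) sums S \<Longrightarrow> S \<ge> real K"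
    using lambert_unbounded[of f K, OF f_mult f1 fv] by blast
  \<comment> \<open>Since the sum of f(n)/n is 0, subtracting the Lambert terms from f(n)/(n(1-x))
    only changes the sign of the total. Unlike x^n/(1-x^n), these weights stay bounded as x tends to
    1; in particular \<open>b 0 = 1\<close>.\<close>
  define b where "b n = 1 / (real (Suc n) * (1 - x)) - x ^ Suc n / (1 - x ^ Suc n)" for n
  obtain S where S: "(\<lambda>n. f (Suc n) * (x ^ Suc n / (1 - x ^ Suc n))) sums S"
  proof -
    have "\<bar>f n\<bar> \<le> 1" for n using fv[of n] by auto
    then show ?thesis using that lambert_sums[of f x] x(1,2) by blast
  qed
  have "(\<lambda>n. f (Suc n) / real (Suc n) * (1 / (1 - x)) - f (Suc n) * (x ^ Suc n / (1 - x ^ Suc n))) sums (0 * (1/(1-x)) - S)"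
    by (intro sums_diff sums_mult2 fs S)
  then have bS: "(\<lambda>n. f (Suc n) * b n) sums (- S)"
    by (simp add: b_def algebra_simps)
  define G where "G n = (\<Sum>i<n. x ^ i)" for n
  have G: "1 - x ^ n = (1 - x) * G n" for n
    unfolding G_def by (rule one_diff_power_eq)
  have Gpos: "G (Suc n) > 0" for n unfolding G_def using x by (intro sum_pos) auto
  have b_alt: "(1 - x) * b n = 1 / real (Suc n) - x ^ Suc n / G (Suc n)" for n
  proof -
    have c: "d * (1 / (c * d)) = 1 / c" "d * (p / (d * g)) = p / g" if "d \<noteq> 0" for c d p g :: real
      using that by auto
    have "(1 - x) * b n = (1 - x) * (1 / (real (Suc n) * (1 - x))) - (1 - x) * (x ^ Suc n / ((1 - x) * G (Suc n)))"
      unfolding b_def G by (rule right_diff_distrib)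
    moreover have nz: "1 - x \<noteq> 0" using x by simp
    ultimately show ?thesis by (simp only: c(1)[OF nz] c(2)[OF nz])
  qed
  have G_lower: "real n * x ^ n \<le> G n" for n
  proof -
    have "real n * x ^ n = (\<Sum>i<n. x ^ n)" by simp
    also have "\<dots> \<le> G n" unfolding G_def using x by (intro sum_mono power_decreasing) auto
    finally show ?thesis .
  qed
  have b_nonneg: "b n \<ge> 0" for n
  proof -
    have "x ^ Suc n / G (Suc n) \<le> 1 / real (Suc n)"
      using G_lower[of "Suc n"] Gpos[of n] by (simp add: field_simps)
    then have "(1 - x) * b n \<ge> 0" unfolding b_alt by simp
    then show ?thesis using x by (simp add: zero_le_mult_iff)
  qed
  have b_dec: "b (Suc n) \<le> b n" for n
  proof -
    let ?N = "Suc n"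
    have rec: "G (Suc ?N) = 1 + x * G ?N"
      using geometric_sum_rec[of x ?N] by (simp only: G_def)
    \<comment> \<open>The recursion G(N+1) - x G(N) = 1 collapses the difference of the two
      fractions, and monotonicity becomes \<open>geometric_sums_amgm\<close>.\<close>
    have "(1 - x) * b n - (1 - x) * b (Suc n) = 1 / (real ?N * real (Suc ?N)) - x ^ ?N / (G ?N * G (Suc ?N))"
    proof -
      have "x ^ ?N / G ?N - x ^ Suc ?N / G (Suc ?N) = x ^ ?N * (G (Suc ?N) - x * G ?N) / (G ?N * G (Suc ?N))"
        using Gpos[of n] Gpos[of ?N] by (simp add: field_simps)
      also have "\<dots> = x ^ ?N / (G ?N * G (Suc ?N))" by (simp add: rec)
      finally have "x ^ ?N / G ?N - x ^ Suc ?N / G (Suc ?N) = x ^ ?N / (G ?N * G (Suc ?N))" .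
      moreover have "1 / real ?N - 1 / real (Suc ?N) = 1 / (real ?N * real (Suc ?N))" by (simp add: field_simps)
      ultimately show ?thesis unfolding b_alt by linarith
    qed
    moreover have "x ^ ?N / (G ?N * G (Suc ?N)) \<le> 1 / (real ?N * real (Suc ?N))"
    proof -
      have "real ?N * real (Suc ?N) * x ^ ?N \<le> G ?N * G (Suc ?N)"
        unfolding G_def by (rule geometric_sums_amgm) (use x in auto)
      then show ?thesis using Gpos[of n] Gpos[of ?N] by (simp add: divide_le_eq le_divide_eq mult.commute del: of_nat_Suc)
    qed
    ultimately have "(1 - x) * b (Suc n) \<le> (1 - x) * b n" by linarith
    then show ?thesis using x by simp
  qed
  have "\<bar>\<Sum>k<n. f (Suc k) * b k\<bar> \<le> 2 * real q * b 0" for n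
    by (rule decreasing_sum_by_parts_bound[of b "\<lambda>k. f (Suc k)"]) (rule b_dec b_nonneg fb)+
  moreover have "b 0 = 1" using x by (simp add: b_def field_simps)
  ultimately have bound: "\<bar>\<Sum>k<n. f (Suc k) * b k\<bar> \<le> 2 * real q" for n by simp
  have "(\<lambda>n. \<bar>\<Sum>k<n. f (Suc k) * b k\<bar>) \<longlonglongrightarrow> \<bar>- S\<bar>"
    using bS unfolding sums_def by (rule tendsto_rabs)
  then have "\<bar>- S\<bar> \<le> 2 * real q"
    by (rule LIMSEQ_le_const2) (use bound in blast)
  then show False using x(3)[OF S] K by linarith
qed

end

context dchar
begin

lemma dchar_square: "dchar (\<lambda>n. \<psi> n ^ 2) q"
  using q_pos mult one periodic zero by unfold_locales (auto simp: power_mult_distrib)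

text \<open>Together with \<open>L_factor_entire\<close> this brings L into the common shape H(s) /
  (s-1)^e on which the non-vanishing lemmas operate.\<close>

lemma L_factor_pole: "\<exists>Z. Z holomorphic_on {s. Re s > 0} \<and> Z 1 = mean \<and> (\<forall>s. Re s > 1 \<longrightarrow> L s = Z s / (s - 1) ^ 1)"
  using L_series unfolding sums_shift_Suc by (metis L_sums power_one_right sums_unique2)

lemma L_factor_entire:
  assumes "mean = 0"
  shows "\<exists>h. h holomorphic_on {s. Re s > 0} \<and> (\<forall>s. Re s > 1 \<longrightarrow> L s = h s / (s - 1) ^ 0) \<and>
    (\<lambda>n. \<psi> (Suc n) * of_nat (Suc n) powr (-1)) sums h 1"
proof -
  obtain h where h: "h holomorphic_on {s. Re s > 0}"
     "\<And>s. Re s > 0 \<Longrightarrow> (\<lambda>n. \<psi> (Suc n) * of_nat (Suc n) powr (-s)) sums h s"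
    using L_minus_mean_series assms by auto
  have "L s = h s" if "Re s > 1" for s
    using h(2)[of s] that L_sums[of s] sums_unique2 unfolding sums_shift_Suc by fastforce
  then show ?thesis using h(1) h(2)[of 1] by (intro exI[of _ h]) auto
qed

text \<open>If \<open>H\<close> had a zero of order k at 1 + it, multiplying the 3-4-1 inequality by
  \<sigma> - 1 and letting \<sigma> tend to 1 would give 3 - 4k - k' \<ge> 0, so k = 0. The
  assumption on \<open>t\<close> keeps 1 + it away from a pole of L and 1 + 2it away from a pole of
  the L-function of \<psi>^2.\<close>

lemma nonvanishing_line:
  fixes e :: nat
  assumes e: "e = 0 \<or> e = 1" and H: "H holomorphic_on {s. Re s > 0}"
    and HL: "\<And>s. Re s > 1 \<Longrightarrow> L s = H s / (s - 1) ^ e"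
    and t: "t \<noteq> 0 \<or> e = 0 \<and> dchar.mean (\<lambda>n. \<psi> n ^ 2) q = 0"
  shows "H (Complex 1 t) \<noteq> 0"
proof -
  interpret o: dchar "\<lambda>_. 1" 1 by (rule dchar_one)
  interpret sq: dchar "\<lambda>n. \<psi> n ^ 2" q by (rule dchar_square)
  obtain Z where Z: "Z holomorphic_on {s. Re s > 0}" "Z 1 = o.mean" "\<And>s. Re s > 1 \<Longrightarrow> o.L s = Z s / (s - 1) ^ 1"
    using o.L_factor_pole by blast
  have Z1: "Z (Complex 1 0) \<noteq> 0"
  proof -
    have "Complex 1 0 = 1" by (simp add: complex_eq_iff)
    then show ?thesis using Z(2) unfolding o.mean_def by simp
  qed
  obtain k0 :: nat where k0: "(k0 = 0) = (Z (Complex 1 0) \<noteq> 0)"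
    "((\<lambda>\<sigma>. of_real (\<sigma> - 1) * o.M (Complex \<sigma> 0)) \<longlongrightarrow> (if (0::real) = 0 \<and> (1::real) = 1 then of_nat 1 else 0) - of_nat k0) (at_right 1)"
    using o.log_deriv_limit[of 1 Z 1 0, OF _ Z(1) Z(3)] by auto
  then have l0: "((\<lambda>\<sigma>. of_real (\<sigma> - 1) * o.M (Complex \<sigma> 0)) \<longlongrightarrow> 1) (at_right 1)" using Z1 by simp
  obtain k :: nat where k: "(k = 0) = (H (Complex 1 t) \<noteq> 0)"
    "((\<lambda>\<sigma>. of_real (\<sigma> - 1) * M (Complex \<sigma> t)) \<longlongrightarrow> (if t = 0 \<and> (1::real) = 1 then of_nat e else 0) - of_nat k) (at_right 1)"
    using log_deriv_limit[OF e H HL, of 1 t] by auto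
  then have l1: "((\<lambda>\<sigma>. of_real (\<sigma> - 1) * M (Complex \<sigma> t)) \<longlongrightarrow> - of_nat k) (at_right 1)" using t by (cases "t = 0") auto
  have "\<exists>k'::nat. ((\<lambda>\<sigma>. of_real (\<sigma> - 1) * sq.M (Complex \<sigma> (2 * t))) \<longlongrightarrow> - of_nat k') (at_right 1)"
  proof (cases "sq.mean = 0")
    case True
    obtain h where h: "h holomorphic_on {s. Re s > 0}" "\<And>s. Re s > 1 \<Longrightarrow> sq.L s = h s / (s - 1) ^ 0"
      using sq.L_factor_entire[OF True] by blast
    obtain k' :: nat where "((\<lambda>\<sigma>. of_real (\<sigma> - 1) * sq.M (Complex \<sigma> (2 * t))) \<longlongrightarrow> (if 2 * t = 0 \<and> (1::real) = 1 then of_nat 0 else 0) - of_nat k') (at_right 1)"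
      using sq.log_deriv_limit[of 0 h 1 "2*t", OF _ h] by blast
    then show ?thesis by (intro exI[of _ k']) (cases "t = 0"; simp)
  next
    case False
    then have "t \<noteq> 0" using t by blast
    obtain Z' where Z': "Z' holomorphic_on {s. Re s > 0}" "\<And>s. Re s > 1 \<Longrightarrow> sq.L s = Z' s / (s - 1) ^ 1"
      using sq.L_factor_pole by blast
    obtain k' :: nat where "((\<lambda>\<sigma>. of_real (\<sigma> - 1) * sq.M (Complex \<sigma> (2 * t))) \<longlongrightarrow> (if 2 * t = 0 \<and> (1::real) = 1 then of_nat 1 else 0) - of_nat k') (at_right 1)"
      using sq.log_deriv_limit[of 1 Z' 1 "2*t", OF _ Z'] by blast
    then show ?thesis using \<open>t \<noteq> 0\<close> by (intro exI[of _ k']) simp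
  qed
  then obtain k' :: nat where l2: "((\<lambda>\<sigma>. of_real (\<sigma> - 1) * sq.M (Complex \<sigma> (2 * t))) \<longlongrightarrow> - of_nat k') (at_right 1)" by blast
  have "((\<lambda>\<sigma>. 3 * Re (of_real (\<sigma> - 1) * o.M (Complex \<sigma> 0)) + 4 * Re (of_real (\<sigma> - 1) * M (Complex \<sigma> t)) + Re (of_real (\<sigma> - 1) * sq.M (Complex \<sigma> (2 * t))))
    \<longlongrightarrow> 3 * Re 1 + 4 * Re (- of_nat k) + Re (- of_nat k')) (at_right 1)"
    by (intro tendsto_add tendsto_mult tendsto_const tendsto_Re l0 l1 l2)
  moreover have "\<forall>\<^sub>F \<sigma> in at_right 1. 3 * Re (of_real (\<sigma> - 1) * o.M (Complex \<sigma> 0)) + 4 * Re (of_real (\<sigma> - 1) * M (Complex \<sigma> t)) + Re (of_real (\<sigma> - 1) * sq.M (Complex \<sigma> (2 * t))) \<ge> 0"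
    using eventually_at_right_less[of "1::real"]
  proof eventually_elim
    case (elim \<sigma>)
    have "0 \<le> (\<sigma> - 1) * (3 * Re (o.M (Complex \<sigma> 0)) + 4 * Re (M (Complex \<sigma> t)) + Re (sq.M (Complex \<sigma> (2 * t))))"
      using three_four_one[OF elim, of t] elim by (intro mult_nonneg_nonneg) auto
    then show ?case by (simp add: algebra_simps)
  qed
  ultimately have "0 \<le> 3 * Re 1 + 4 * Re (- of_nat k) + Re (- of_nat k')"
    by (intro tendsto_lowerbound[of _ _ "at_right (1::real)"]) auto
  then have "4 * real k + real k' \<le> 3" by simp
  then have "k = 0" by linarith
  with k(1) show ?thesis by simp
qed

lemma M_eq_log_deriv:
  assumes H: "H holomorphic_on {s. Re s > 0}"
    and HL: "\<And>s. Re s > 1 \<Longrightarrow> L s = H s / (s - 1) ^ 0" and s: "Re s > 1" and nz: "H s \<noteq> 0"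
  shows "M s = - deriv H s / H s"
proof -
  have "(H has_field_derivative deriv H s) (at s)"
    using H s by (intro holomorphic_derivI[OF H open_halfspace_Re_gt]) auto
  moreover have "(H has_field_derivative - (M s * L s)) (at s)"
    by (rule has_field_derivative_transform_within_open[OF L_deriv[OF s] open_halfspace_Re_gt[of 1]]) (use HL s in auto)
  ultimately have "deriv H s = - (M s * L s)" by (rule DERIV_unique)
  then show ?thesis using HL[OF s] nz by simp
qed

theorem nontrivial_log_deriv_continuous:
  assumes m0: "mean = 0"
  shows "\<exists>G. continuous_on {s. Re s \<ge> 1} G \<and> (\<forall>s. Re s > 1 \<longrightarrow> (\<lambda>n. mangoldt n * \<psi> n * of_nat n powr (-s)) sums G s)"
proof -
  interpret sq: dchar "\<lambda>n. \<psi> n ^ 2" q by (rule dchar_square)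
  obtain h where h: "h holomorphic_on {s. Re s > 0}" "\<And>s. Re s > 1 \<Longrightarrow> L s = h s / (s - 1) ^ 0"
     "(\<lambda>n. \<psi> (Suc n) * of_nat (Suc n) powr (-1)) sums h 1"
    using L_factor_entire[OF m0] by blast
  have nz: "h s \<noteq> 0" if "Re s \<ge> 1" for s
  proof (cases "Re s > 1")
    case True
    then show ?thesis using H_nonzero_gt_1[OF _ h(1,2)] by blast
  next
    case False
    then have s: "s = Complex 1 (Im s)" using that by (simp add: complex_eq_iff)
    show ?thesis
    proof (cases "Im s \<noteq> 0 \<or> sq.mean = 0")
      case True
      then show ?thesis using nonvanishing_line[OF _ h(1,2), of "Im s"] by (subst s) blast
    next
      case False
      \<comment> \<open>The only point left is s = 1 with \<psi>^2 principal, that is, a real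
        character; here the Lambert series argument takes over.\<close>
      have "\<psi> n \<in> {-1, 0, 1}" for n
      proof (cases "coprime n q")
        case True
        then have "(\<psi> n)\<^sup>2 = 1" using False sq.mean_nonzero_imp_trivial by blast
        then show ?thesis by (auto simp: power2_eq_1_iff)
      qed (simp add: zero)
      then have "h 1 \<noteq> 0" using L_one_real_nonzero[OF m0 _ h(3)] by blast
      moreover have "s = 1" using s False by (simp add: complex_eq_iff)
      ultimately show ?thesis by simp
    qed
  qed
  show ?thesis
  proof (intro exI[of _ "\<lambda>s. - deriv h s / h s"] conjI allI impI)
    have "deriv h holomorphic_on {s. Re s > 0}" by (intro holomorphic_deriv h open_halfspace_Re_gt)
    then have "continuous_on {s. Re s \<ge> 1} (deriv h)" "continuous_on {s. Re s \<ge> 1} h"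
      using h(1) by (auto intro!: continuous_on_subset[of "{s. Re s > 0}" _ "{s. Re s \<ge> 1}"] holomorphic_on_imp_continuous_on)
    then show "continuous_on {s. Re s \<ge> 1} (\<lambda>s. - deriv h s / h s)"
      using nz by (intro continuous_intros) auto
    fix s assume "Re s > 1"
    then show "(\<lambda>n. mangoldt n * \<psi> n * of_nat n powr (-s)) sums (- deriv h s / h s)"
      using M_eq_log_deriv[OF h(1,2)] nz[of s] M_sums[of s] by simp
  qed
qed

end

text \<open>Subtracting zeta from -zeta'/zeta cancels the pole at 1; on the coefficients this
  replaces \<Lambda>(n) by \<Lambda>(n) - 1.\<close>

theorem zeta_log_deriv_continuous:
  "\<exists>G. continuous_on {s. Re s \<ge> 1} G \<and> (\<forall>s. Re s > 1 \<longrightarrow> (\<lambda>n. (mangoldt n - 1) * of_nat n powr (-s)) sums G s)"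
proof -
  interpret o: dchar "\<lambda>_. 1" 1 by (rule dchar_one)
  let ?S = "{s. Re s > 0}"
  obtain Z where Z: "Z holomorphic_on ?S" "Z 1 = o.mean" "\<And>s. Re s > 1 \<Longrightarrow> o.L s = Z s / (s - 1) ^ 1"
    using o.L_factor_pole by blast
  have Z1: "Z 1 = 1" using Z(2) unfolding o.mean_def by simp
  have nz: "Z s \<noteq> 0" if "Re s \<ge> 1" for s
  proof (cases "Re s > 1")
    case True
    then show ?thesis using o.H_nonzero_gt_1[OF _ Z(1,3)] by blast
  next
    case False
    then have s: "s = Complex 1 (Im s)" using that by (simp add: complex_eq_iff)
    show ?thesis
    proof (cases "Im s = 0")
      case False
      then show ?thesis using o.nonvanishing_line[OF _ Z(1,3), of "Im s"] by (subst s) blast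
    next
      case True
      then have "s = 1" using s by (simp add: complex_eq_iff)
      then show ?thesis using Z1 by simp
    qed
  qed
  \<comment> \<open>The difference quotient of \<open>Z\<close> at 1 with its singularity filled in;
    -Z'/Z - R is the continuation of -zeta'/zeta - zeta.\<close>
  define R where "R s = (if s = 1 then deriv Z 1 else (Z s - Z 1) / (s - 1))" for s
  have R: "R holomorphic_on ?S"
    unfolding R_def[abs_def] using open_halfspace_Re_gt[of 0] by (intro pole_lemma Z(1)) (simp add: interior_open)
  show ?thesis
  proof (intro exI[of _ "\<lambda>s. - deriv Z s / Z s - R s"] conjI allI impI)
    have "deriv Z holomorphic_on ?S" by (intro holomorphic_deriv Z open_halfspace_Re_gt)
    then have "continuous_on {s. Re s \<ge> 1} (deriv Z)" "continuous_on {s. Re s \<ge> 1} Z" "continuous_on {s. Re s \<ge> 1} R"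
      using Z(1) R by (auto intro!: continuous_on_subset[of "{s. Re s > 0}" _ "{s. Re s \<ge> 1}"] holomorphic_on_imp_continuous_on)
    then show "continuous_on {s. Re s \<ge> 1} (\<lambda>s. - deriv Z s / Z s - R s)"
      using nz by (intro continuous_intros) auto
    fix s :: complex assume s: "Re s > 1"
    then have s1: "s \<noteq> 1" by auto
    have "(Z has_field_derivative deriv Z s) (at s)"
      using s by (intro holomorphic_derivI[OF Z(1) open_halfspace_Re_gt]) auto
    then have "((\<lambda>s. Z s / (s - 1)) has_field_derivative (deriv Z s * (s - 1) - Z s) / (s - 1)\<^sup>2) (at s)"
      using s1 by (auto intro!: derivative_eq_intros simp: power2_eq_square)
    then have "(o.L has_field_derivative (deriv Z s * (s - 1) - Z s) / (s - 1)\<^sup>2) (at s)"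
      by (rule has_field_derivative_transform_within_open[OF _ open_halfspace_Re_gt[of 1]]) (use Z(3) s in auto)
    then have "- (o.M s * o.L s) = (deriv Z s * (s - 1) - Z s) / (s - 1)\<^sup>2"
      using o.L_deriv[OF s] by (rule DERIV_unique[rotated])
    then have "o.M s * o.L s = - ((deriv Z s * (s - 1) - Z s) / (s - 1)\<^sup>2)" by (metis minus_minus)
    also have "\<dots> = (Z s - deriv Z s * (s - 1)) / (s - 1)\<^sup>2" by (simp only: minus_divide_left minus_diff_eq)
    finally have MZ: "o.M s * (Z s / (s - 1)) = (Z s - deriv Z s * (s - 1)) / (s - 1)\<^sup>2"
      using Z(3)[OF s] by simp
    have M: "o.M s = 1 / (s - 1) - deriv Z s / Z s"
    proof -
      have "m = 1 / W - d / z" if "m * (z / W) = (z - d * W) / W\<^sup>2" "W \<noteq> 0" "z \<noteq> 0" for m z d W :: complex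
        using that by (simp add: field_simps power2_eq_square)
      from this[of "o.M s" "Z s" "s - 1" "deriv Z s"] show ?thesis using MZ s1 nz[of s] s by simp
    qed
    have "(\<lambda>n. mangoldt n * 1 * of_nat n powr (-s) - 1 * of_nat n powr (-s)) sums (o.M s - o.L s)"
      by (intro sums_diff o.M_sums o.L_sums s)
    moreover have "o.M s - o.L s = - deriv Z s / Z s - R s"
      using s1 Z1 Z(3)[OF s] unfolding M R_def by (simp add: diff_divide_distrib)
    ultimately show "(\<lambda>n. (mangoldt n - 1) * of_nat n powr (-s)) sums (- deriv Z s / Z s - R s)"
      by (simp add: left_diff_distrib)
  qed
qed

section \<open>Primes in logarithmic windows\<close>

definition tri :: "real \<Rightarrow> real \<Rightarrow> real" where "tri T t = max 0 (1 - \<bar>t\<bar> / T)"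

text \<open>The Fourier transform of \<open>tri T\<close>, with its limit value T at 0. The windows
  use its positivity and quadratic decay, while \<open>tri T\<close> confines the frequencies to
  [-T, T].\<close>

definition fejer :: "real \<Rightarrow> real \<Rightarrow> real" where
  "fejer T y = (if y = 0 then T else 2 * (1 - cos (T * y)) / (T * y\<^sup>2))"

lemma fejer_even: "fejer T (- y) = fejer T y"
  by (simp add: fejer_def)

lemma fejer_nonneg: "T > 0 \<Longrightarrow> fejer T y \<ge> 0"
  by (simp add: fejer_def)

lemma one_minus_cos: "1 - cos u = 2 * (sin (u / 2))\<^sup>2" for u :: real
  using cos_double_sin[of "u/2"] by simp

lemma fejer_le: "T > 0 \<Longrightarrow> fejer T y \<le> T"
proof (cases "y = 0")
  case False
  assume T: "T > 0"
  have "(sin (T * y / 2))\<^sup>2 \<le> (T * y / 2)\<^sup>2"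
    using abs_sin_x_le_abs_x[of "T * y / 2"] by (simp only: abs_le_square_iff)
  then have "2 * (1 - cos (T * y)) \<le> T * (T * y\<^sup>2)"
    unfolding one_minus_cos by (simp add: power_mult_distrib power_divide power2_eq_square[of T])
  then show ?thesis using False T by (simp add: fejer_def pos_divide_le_eq)
qed (simp add: fejer_def)

lemma fejer_decay:
  assumes T: "T > 0" and "y \<noteq> 0" shows "fejer T y \<le> 4 / (T * y\<^sup>2)"
proof -
  have "2 * (1 - cos (T * y)) \<le> 4" by (smt (verit) cos_ge_minus_one)
  then show ?thesis using assms by (simp add: fejer_def divide_right_mono)
qed

lemma fejer_ge_half:
  assumes T: "T > 0" and y: "\<bar>y\<bar> \<le> 1 / T" shows "fejer T y \<ge> T / 2"
proof (cases "y = 0")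
  case False
  define x where "x = T * y / 2"
  have x1: "\<bar>x\<bar> \<le> 1" using T y by (simp add: x_def abs_mult field_simps)
  have "\<bar>sin x - x\<bar> \<le> \<bar>x\<bar> ^ 3 / 6"
    using Maclaurin_sin_bound[of x 3] by (simp add: eval_nat_numeral sin_coeff_def)
  also have "\<dots> \<le> \<bar>x\<bar> / 6" using x1 power_decreasing[of 1 3 "\<bar>x\<bar>"] by simp
  finally have "\<bar>sin x\<bar> \<ge> \<bar>x\<bar> * (5/6)" by linarith
  then have "(\<bar>x\<bar> * (5/6))\<^sup>2 \<le> \<bar>sin x\<bar>\<^sup>2" by (intro power_mono) auto
  then have "x\<^sup>2 * (25/36) \<le> (sin x)\<^sup>2" by (simp add: power_mult_distrib power2_eq_square)
  then have "(sin x)\<^sup>2 \<ge> x\<^sup>2 / 2" using zero_le_power2[of x] by linarith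
  moreover have "fejer T y = T * ((sin x)\<^sup>2 / x\<^sup>2)"
    using False T by (simp add: fejer_def one_minus_cos x_def field_simps power2_eq_square)
  moreover have "x\<^sup>2 > 0" using False T by (simp add: x_def)
  moreover have "T * (1/2) \<le> T * ((sin x)\<^sup>2 / x\<^sup>2)"
    using calculation T by (intro mult_left_mono) (simp_all add: le_divide_eq)
  ultimately show ?thesis by simp
qed (use T in \<open>simp add: fejer_def\<close>)

text \<open>A single Fejer kernel has zeros and cannot dominate 1/(1+x^2). Shifting by pi turns 1 -
  cos x into 1 + cos x, so the two numerators have constant sum.\<close>

lemma fejer_one_shift_lower:
  "1 / (1 + x\<^sup>2) \<le> 6 * (fejer 1 x + fejer 1 (x + pi))"
proof -
  \<comment> \<open>A common bound for x^2 and (x + pi)^2, from (x + pi)^2 \<le> 2 x^2 + 2 pi^2 and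
    pi^2 \<le> 11.\<close>
  define A where "A = 22 * (1 + x\<^sup>2)"
  have A: "A > 0" by (simp add: A_def add_pos_nonneg)
  have low: "fejer 1 y \<ge> 2 * (1 - cos y) / A" if "y\<^sup>2 \<le> A" for y
  proof (cases "y = 0")
    case False
    then show ?thesis using that A unfolding fejer_def by (simp add: frac_le)
  qed (simp add: fejer_def)
  have "pi \<le> 22/7" using pi_less_4 pi_approx by simp
  then have "pi\<^sup>2 \<le> (22/7)\<^sup>2" by (intro power_mono) auto
  then have p: "pi\<^sup>2 \<le> 11" by (simp add: power2_eq_square)
  have "0 \<le> (x - pi)\<^sup>2" by simp
  then have "(x + pi)\<^sup>2 \<le> 2 * x\<^sup>2 + 2 * pi\<^sup>2" by (simp add: power2_sum power2_diff)
  then have 2: "(x + pi)\<^sup>2 \<le> A" using p zero_le_power2[of x] unfolding A_def distrib_left by linarith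
  have 1: "x\<^sup>2 \<le> A" by (simp add: A_def)
  have "4 / A = 2 * (1 - cos x) / A + 2 * (1 - cos (x + pi)) / A" by (simp flip: add_divide_distrib)
  also have "\<dots> \<le> fejer 1 x + fejer 1 (x + pi)" using low[OF 1] low[OF 2] by linarith
  finally have "6 * (4 / A) \<le> 6 * (fejer 1 x + fejer 1 (x + pi))" by (intro mult_left_mono) simp_all
  moreover have "1 / (1 + x\<^sup>2) \<le> 6 * (4 / A)" unfolding A_def
    by (simp add: divide_simps add_pos_nonneg add_nonneg_eq_0_iff)
  ultimately show ?thesis by linarith
qed

lemma fejer_one_upper: "fejer 1 y \<le> 5 / (1 + y\<^sup>2)"
proof (cases "y = 0")
  case False
  have "y\<^sup>2 * fejer 1 y \<le> 4" using fejer_decay[of 1 y] False by (simp add: field_simps)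
  moreover have "fejer 1 y \<le> 1" using fejer_le[of 1 y] by simp
  ultimately have "fejer 1 y * (1 + y\<^sup>2) \<le> 5" by (simp add: algebra_simps)
  then show ?thesis by (simp add: pos_le_divide_eq add_pos_nonneg)
qed (simp add: fejer_def)

lemma fejer_has_integral:
  assumes T: "T > 0"
  shows "((\<lambda>t. of_real (tri T t) * exp (\<i> * of_real (t * y))) has_integral of_real (fejer T y)) {-T..T}"
proof -
  let ?f = "\<lambda>t. of_real (tri T t) * exp (\<i> * of_real (t * y))"
  have tri1: "tri T t = 1 - t / T" if "0 \<le> t" "t \<le> T" for t using that T by (simp add: tri_def)
  have tri2: "tri T t = 1 + t / T" if "-T \<le> t" "t \<le> 0" for t
  proof -
    have "- 1 \<le> t / T" using that T pos_le_divide_eq[of T "-1" t] by simp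
    then show ?thesis using that by (simp add: tri_def)
  qed
  have "\<exists>I1 I2. (?f has_integral I1) {0..T} \<and> (?f has_integral I2) {-T..0} \<and> I2 + I1 = of_real (fejer T y)"
  proof (cases "y = 0")
    case True
    define F1 where "F1 t = complex_of_real (t - t * t / (2*T))" for t
    define F2 where "F2 t = complex_of_real (t + t * t / (2*T))" for t
    have 1: "((\<lambda>t. of_real (1 - t / T)) has_integral (F1 T - F1 0)) {0..T}"
      by (rule fundamental_theorem_of_calculus) (use T in \<open>auto simp: F1_def intro!: derivative_eq_intros\<close>)
    have 2: "((\<lambda>t. of_real (1 + t / T)) has_integral (F2 0 - F2 (-T))) {-T..0}"
      by (rule fundamental_theorem_of_calculus) (use T in \<open>auto simp: F2_def intro!: derivative_eq_intros\<close>)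
    have i1: "(?f has_integral (F1 T - F1 0)) {0..T}"
      by (rule has_integral_eq[OF _ 1]) (use True tri1 in auto)
    have i2: "(?f has_integral (F2 0 - F2 (-T))) {-T..0}"
      by (rule has_integral_eq[OF _ 2]) (use True tri2 in auto)
    have "(F2 0 - F2 (-T)) + (F1 T - F1 0) = of_real (fejer T y)"
      using True T by (simp add: F1_def F2_def fejer_def field_simps power2_eq_square flip: of_real_diff of_real_add)
    with i1 i2 show ?thesis by blast
  next
    case False
    define c where "c = \<i> * of_real y"
    have c: "c \<noteq> 0" using False by (simp add: c_def)
    \<comment> \<open>Antiderivatives of the two linear pieces times exp(c z), found by one
      integration by parts; y = 0 is treated apart because of the divisions by c.\<close>
    define f1 where "f1 z = (1 - z / of_real T) * exp (c * z) / c + exp (c * z) / (of_real T * c\<^sup>2)" for z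
    define f2 where "f2 z = (1 + z / of_real T) * exp (c * z) / c - exp (c * z) / (of_real T * c\<^sup>2)" for z
    define F1 where "F1 t = f1 (of_real t)" for t
    define F2 where "F2 t = f2 (of_real t)" for t
    have e: "exp (\<i> * of_real (t * y)) = exp (c * of_real t)" for t by (simp add: c_def ac_simps)
    have d1: "(f1 has_field_derivative (1 - z / of_real T) * exp (c * z)) (at z)" for z
      unfolding f1_def using c T by (auto intro!: derivative_eq_intros simp: field_simps power2_eq_square)
    have d2: "(f2 has_field_derivative (1 + z / of_real T) * exp (c * z)) (at z)" for z
      unfolding f2_def using c T by (auto intro!: derivative_eq_intros simp: field_simps power2_eq_square)
    have 1: "((\<lambda>t. of_real (1 - t / T) * exp (c * of_real t)) has_integral (F1 T - F1 0)) {0..T}"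
    proof (rule fundamental_theorem_of_calculus)
      show "(F1 has_vector_derivative of_real (1 - t / T) * exp (c * of_real t)) (at t within {0..T})" for t
        using has_vector_derivative_real_field[OF d1[of "of_real t"]] by (simp add: F1_def[abs_def])
    qed (use T in auto)
    have 2: "((\<lambda>t. of_real (1 + t / T) * exp (c * of_real t)) has_integral (F2 0 - F2 (-T))) {-T..0}"
    proof (rule fundamental_theorem_of_calculus)
      show "(F2 has_vector_derivative of_real (1 + t / T) * exp (c * of_real t)) (at t within {-T..0})" for t
        using has_vector_derivative_real_field[OF d2[of "of_real t"]] by (simp add: F2_def[abs_def])
    qed (use T in auto)
    have i1: "(?f has_integral (F1 T - F1 0)) {0..T}"
      by (rule has_integral_eq[OF _ 1]) (simp only: e tri1 atLeastAtMost_iff)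
    have i2: "(?f has_integral (F2 0 - F2 (-T))) {-T..0}"
      by (rule has_integral_eq[OF _ 2]) (simp only: e tri2 atLeastAtMost_iff)
    have "(F2 0 - F2 (-T)) + (F1 T - F1 0) = (exp (c * of_real T) + exp (- (c * of_real T)) - 2) / (of_real T * c\<^sup>2)"
      using T c by (simp add: F1_def F2_def f1_def f2_def field_simps)
    also have "exp (c * of_real T) + exp (- (c * of_real T)) = 2 * of_real (cos (T * y))"
      by (simp add: c_def exp_Euler exp_minus_Euler ac_simps flip: cos_of_real)
    also have "(2 * of_real (cos (T * y)) - 2) / (of_real T * c\<^sup>2) = of_real (fejer T y)"
      using False by (simp add: fejer_def c_def power_mult_distrib) (simp only: minus_divide_left minus_diff_eq)
    finally show ?thesis using i1 i2 by blast
  qed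
  then obtain I1 I2 where I: "(?f has_integral I1) {0..T}" "(?f has_integral I2) {-T..0}" "I2 + I1 = of_real (fejer T y)" by blast
  have "(?f has_integral (I2 + I1)) {-T..T}"
    by (rule has_integral_combine[OF _ _ I(2,1)]) (use T in auto)
  then show ?thesis using I(3) by simp
qed

lemma tri_bounds: "0 \<le> tri T t" "T > 0 \<Longrightarrow> tri T t \<le> 1"
  by (auto simp: tri_def)

lemma continuous_on_tri: "T > 0 \<Longrightarrow> continuous_on A (tri T)"
  unfolding tri_def by (intro continuous_intros) auto

lemma norm_tri_exp: "T > 0 \<Longrightarrow> norm (complex_of_real (tri T t) * exp (\<i> * of_real x)) \<le> 1"
  using tri_bounds[of T t] by (simp add: norm_mult)

section \<open>Fejer-smoothed sums of Dirichlet coefficients\<close>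

lemma nat_powr_Complex:
  "complex_of_nat n powr (- Complex \<sigma> t) = of_real (real n powr (- \<sigma>)) * exp (\<i> * of_real (t * - ln (real n)))"
proof (cases "n = 0")
  case False
  have "- Complex \<sigma> t = of_real (-\<sigma>) + (- (\<i> * of_real t))" by (simp add: complex_eq_iff)
  then have "complex_of_nat n powr (- Complex \<sigma> t) = complex_of_nat n powr (of_real (- \<sigma>)) * complex_of_nat n powr (- (\<i> * of_real t))"
    by (simp only: powr_add)
  also have "complex_of_nat n powr (of_real (- \<sigma>)) = of_real (real n powr (- \<sigma>))"
    using False powr_of_real[of "real n" "-\<sigma>"] by simp
  also have "complex_of_nat n powr (- (\<i> * of_real t)) = exp (\<i> * of_real (t * - ln (real n)))"
    using False by (simp add: powr_def Ln_of_nat ac_simps)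
  finally show ?thesis .
qed simp

text \<open>The Dirichlet series is integrated termwise along Re s = \<sigma> against the triangle
  weight: n^(-it) e^(itv) yields \<open>fejer T\<close> at v - log n. Only a bounded segment of the
  line enters.\<close>

lemma fejer_convolution:
  fixes b :: "nat \<Rightarrow> complex"
  assumes T: "T > 0" and sm: "summable (\<lambda>n. norm (b n) * real n powr (- \<sigma>))"
    and B: "\<And>t. (\<lambda>n. b n * of_nat n powr (- Complex \<sigma> t)) sums B t"
  shows "\<exists>S. ((\<lambda>t. of_real (tri T t) * exp (\<i> * of_real (t * v)) * B t) has_integral S) {-T..T} \<and>
     (\<lambda>n. b n * of_real (real n powr (- \<sigma>) * fejer T (v - ln (real n)))) sums S"
proof -
  define w where "w n t = b n * of_real (real n powr (- \<sigma>)) * (of_real (tri T t) * exp (\<i> * of_real (t * (v - ln (real n)))))" for n t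
  have eq: "of_real (tri T t) * exp (\<i> * of_real (t * v)) * (b n * of_nat n powr (- Complex \<sigma> t)) = w n t" for n t
  proof -
    have "exp (\<i> * of_real (t * (v - ln (real n)))) = exp (\<i> * of_real (t * v)) * exp (\<i> * of_real (t * - ln (real n)))"
      unfolding exp_add[symmetric] by (simp add: algebra_simps)
    then show ?thesis unfolding w_def nat_powr_Complex by (simp add: ac_simps)
  qed
  have sums: "(\<lambda>n. w n t) sums (of_real (tri T t) * exp (\<i> * of_real (t * v)) * B t)" for t
    using sums_mult[OF B[of t], of "of_real (tri T t) * exp (\<i> * of_real (t * v))"] unfolding eq .
  have "uniform_limit {-T..T} (\<lambda>N t. \<Sum>n<N. w n t) (\<lambda>t. suminf (\<lambda>n. w n t)) sequentially"
  proof (rule Weierstrass_m_test[OF _ sm])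
    fix n t
    have "norm (w n t) = norm (b n) * real n powr (- \<sigma>) * norm (of_real (tri T t) * exp (\<i> * of_real (t * (v - ln (real n)))))"
      by (simp add: w_def norm_mult)
    also have "\<dots> \<le> norm (b n) * real n powr (- \<sigma>) * 1" by (intro mult_left_mono norm_tri_exp T) auto
    finally show "norm (w n t) \<le> norm (b n) * real n powr (- \<sigma>)" by simp
  qed
  moreover have "(\<lambda>t. suminf (\<lambda>n. w n t)) = (\<lambda>t. of_real (tri T t) * exp (\<i> * of_real (t * v)) * B t)"
    using sums by (auto simp: sums_iff)
  ultimately have ul: "uniform_limit {-T..T} (\<lambda>N t. \<Sum>n<N. w n t) (\<lambda>t. of_real (tri T t) * exp (\<i> * of_real (t * v)) * B t) sequentially"
    by simp
  have cont: "continuous_on {-T..T} (\<lambda>t. \<Sum>n<N. w n t)" for N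
    unfolding w_def by (intro continuous_intros continuous_on_tri T)
  obtain I J where IJ: "\<And>N. ((\<lambda>t. \<Sum>n<N. w n t) has_integral I N) {-T..T}"
    "((\<lambda>t. of_real (tri T t) * exp (\<i> * of_real (t * v)) * B t) has_integral J) {-T..T}" "I \<longlonglongrightarrow> J"
    using uniform_limit_integral[OF ul cont] by auto
  have "((\<lambda>t. \<Sum>n<N. w n t) has_integral (\<Sum>n<N. b n * of_real (real n powr (- \<sigma>)) * of_real (fejer T (v - ln (real n))))) {-T..T}" for N
    unfolding w_def by (intro has_integral_sum has_integral_mult_right fejer_has_integral T) auto
  then have "I = (\<lambda>N. \<Sum>n<N. b n * of_real (real n powr (- \<sigma>)) * of_real (fejer T (v - ln (real n))))"
    using IJ(1) has_integral_unique by blast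
  with IJ(3) have "(\<lambda>n. b n * of_real (real n powr (- \<sigma>)) * of_real (fejer T (v - ln (real n)))) sums J"
    by (simp add: sums_def)
  then show ?thesis using IJ(2) by (intro exI[of _ J]) (simp add: mult.assoc)
qed

text \<open>Each term is at most 6 times an increment of arctan(log n - v), and arctan varies by at
  most pi in total. In 6 = 2 * 3 the factor 2 comes from log(1 + 1/n) \<ge> 1/(2n), the factor 3
  from comparing 1 + z^2 at neighbouring points.\<close>

lemma sum_inverse_window:
  assumes "\<sigma> \<ge> 1"
  shows "(\<Sum>n\<in>{1..<Suc N}. real n powr (- \<sigma>) / (1 + (v - ln (real n))\<^sup>2)) \<le> 6 * pi"
proof -
  define \<Theta> where "\<Theta> n = arctan (ln (real n) - v)" for n
  have step: "real n powr (- \<sigma>) / (1 + (v - ln (real n))\<^sup>2) \<le> 6 * (\<Theta> (Suc n) - \<Theta> n)" if n: "n \<ge> 1" for n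
  proof -
    define x y where "x = ln (real n) - v" and "y = ln (real (Suc n)) - v"
    have xy: "x < y" using n by (simp add: x_def y_def)
    have "\<exists>z. x < z \<and> z < y \<and> arctan y - arctan x = (y - x) * inverse (1 + z\<^sup>2)"
      by (rule MVT2[OF xy]) (auto intro: DERIV_arctan)
    then obtain z where z: "x < z" "z < y" "arctan y - arctan x = (y - x) * inverse (1 + z\<^sup>2)" by blast
    have yx: "y - x = ln (1 + 1 / real n)"
    proof -
      have "y - x = ln (real (Suc n) / real n)" using n by (simp add: x_def y_def ln_div)
      also have "real (Suc n) / real n = 1 + 1 / real n" using n by (simp add: field_simps)
      finally show ?thesis .
    qed
    have le1: "y - x \<le> 1 / real n" unfolding yx using ln_add_one_self_le_self[of "1 / real n"] by simp
    have ge1: "y - x \<ge> 1 / (2 * real n)"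
    proof -
      have "ln (1 / (1 + 1 / real n)) \<le> 1 / (1 + 1 / real n) - 1" by (rule ln_le_minus_one) (simp add: add_pos_nonneg)
      moreover have "ln (1 / (1 + 1 / real n)) = - ln (1 + 1 / real n)" by (simp add: ln_div add_pos_nonneg)
      moreover have "1 - 1 / (1 + 1 / real n) = 1 / (real n + 1)" using n by (simp add: field_simps)
      moreover have "1 / (real n + 1) \<ge> 1 / (2 * real n)" using n by (intro divide_left_mono) auto
      ultimately show ?thesis unfolding yx by linarith
    qed
    have n1: "1 / real n \<le> 1" using n by simp
    have "\<bar>z\<bar> \<le> \<bar>x\<bar> + 1" using z le1 n1 by linarith
    then have "\<bar>z\<bar>\<^sup>2 \<le> (\<bar>x\<bar> + 1)\<^sup>2" by (intro power_mono) auto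
    moreover have "(\<bar>x\<bar> - 1)\<^sup>2 \<ge> 0" by simp
    ultimately have "z\<^sup>2 \<le> 2 * x\<^sup>2 + 2" by (simp add: power2_sum power2_diff)
    then have "1 + z\<^sup>2 \<le> 3 * (1 + x\<^sup>2)" using zero_le_power2[of x] unfolding distrib_left by linarith
    then have "inverse (3 * (1 + x\<^sup>2)) \<le> inverse (1 + z\<^sup>2)" by (intro le_imp_inverse_le) (auto simp: add_pos_nonneg)
    then have "1 / (2 * real n) * inverse (3 * (1 + x\<^sup>2)) \<le> (y - x) * inverse (1 + z\<^sup>2)"
      using ge1 xy by (intro mult_mono) (auto simp: add_nonneg_nonneg)
    then have "6 * (1 / (2 * real n) * inverse (3 * (1 + x\<^sup>2))) \<le> 6 * (\<Theta> (Suc n) - \<Theta> n)"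
      using z(3) by (simp add: \<Theta>_def x_def y_def)
    moreover have "6 * (1 / (2 * real n) * inverse (3 * (1 + x\<^sup>2))) = (1 / real n) / (1 + x\<^sup>2)"
      using n by (simp add: divide_simps add_nonneg_eq_0_iff)
    moreover have "real n powr (- \<sigma>) \<le> 1 / real n"
      using powr_mono[of "-\<sigma>" "-1" "real n"] assms n by (simp add: powr_minus divide_inverse)
    then have "real n powr (- \<sigma>) / (1 + x\<^sup>2) \<le> (1 / real n) / (1 + x\<^sup>2)" by (intro divide_right_mono) auto
    moreover have "(v - ln (real n))\<^sup>2 = x\<^sup>2" by (simp add: x_def power2_commute)
    ultimately show ?thesis by simp
  qed
  have "(\<Sum>n\<in>{1..<Suc N}. real n powr (- \<sigma>) / (1 + (v - ln (real n))\<^sup>2)) \<le> (\<Sum>n\<in>{1..<Suc N}. 6 * (\<Theta> (Suc n) - \<Theta> n))"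
    by (intro sum_mono step) auto
  also have "\<dots> = 6 * (\<Theta> (Suc N) - \<Theta> 1)"
    unfolding sum_distrib_left[symmetric] by (subst sum_Suc_diff') auto
  also have "\<dots> \<le> 6 * pi"
    using arctan_bounded[of "ln (real (Suc N)) - v"] arctan_bounded[of "ln (real 1) - v"]
    by (intro mult_left_mono) (auto simp: \<Theta>_def)
  finally show ?thesis .
qed

text \<open>Shifting t by pi/v changes the sign of e^(itv), so twice the integral is that of h(t) -
  h(t + pi/v) against the exponential, which is small by uniform continuity.\<close>

lemma riemann_lebesgue_tri:
  fixes g :: "real \<Rightarrow> complex"
  assumes T: "T > 0" and g: "continuous_on UNIV g"
  shows "((\<lambda>v. integral {-T..T} (\<lambda>t. of_real (tri T t) * exp (\<i> * of_real (t * v)) * g t)) \<longlongrightarrow> 0) at_top"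
proof -
  define h where "h t = of_real (tri T t) * g t" for t
  have h: "continuous_on A h" for A
    unfolding h_def using g by (intro continuous_intros continuous_on_tri T) (auto intro: continuous_on_subset)
  have h0: "h t = 0" if "t \<notin> {-T..T}" for t
  proof -
    have "\<bar>t\<bar> / T \<ge> 1" using that T by (auto simp: le_divide_eq)
    then show ?thesis by (simp add: h_def tri_def)
  qed
  define E where "E v t = exp (\<i> * of_real (t * v))" for v t
  have E: "continuous_on A (E v)" for A v unfolding E_def by (intro continuous_intros)
  \<comment> \<open>One unit of margin: displacements pi/v \<le> 1 keep the support of
    \<open>h\<close> inside the interval.\<close>
  define a where "a = T + 1"
  define I where "I v = integral {-T..T} (\<lambda>t. h t * E v t)" for v
  have big: "((\<lambda>t. h t * E v t) has_integral I v) {c..d}" if "c \<le> -T" "T \<le> d" for c d v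
  proof (rule has_integral_on_superset[of _ _ "{-T..T}"])
    show "((\<lambda>t. h t * E v t) has_integral I v) {-T..T}"
      unfolding I_def by (intro integrable_integral integrable_continuous_interval continuous_intros h E)
  qed (use that h0 in auto)
  have key: "2 * norm (I v) \<le> e * (2 * a)" if v: "v \<ge> pi" and e: "e \<ge> 0" "\<And>t. t \<in> {-a..a} \<Longrightarrow> norm (h t - h (t + pi / v)) \<le> e" for v e
  proof -
    define s where "s = pi / v"
    have v0: "v > 0" using v pi_gt_zero by linarith
    then have s: "0 < s" "s \<le> 1" using v by (auto simp: s_def)
    have vs: "s * v = pi" using v0 by (simp add: s_def)
    have Es: "E v (s + t) = - E v t" for t
    proof -
      have "E v (s + t) = exp (\<i> * of_real pi) * E v t"
        unfolding E_def exp_add[symmetric] distrib_right vs of_real_add distrib_left ..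
      then show ?thesis by simp
    qed
    have "((\<lambda>t. h t * E v t) has_integral I v) {-a + s..a + s}" using s by (intro big) (auto simp: a_def)
    then have "((\<lambda>t. h t * E v t) \<circ> (+) s has_integral I v) {-a..a}"
      by (simp only: has_integral_shift_Icc_real)
    then have 1: "((\<lambda>t. - (h (s + t) * E v t)) has_integral I v) {-a..a}" by (simp add: o_def Es)
    have 2: "((\<lambda>t. h t * E v t) has_integral I v) {-a..a}" by (intro big) (auto simp: a_def)
    have 3: "((\<lambda>t. (h t - h (s + t)) * E v t) has_integral I v + I v) {-a..a}"
      using has_integral_add[OF 2 1] by (simp add: algebra_simps)
    have "norm (I v + I v) \<le> e * measure lborel (cbox (-a) a)"
    proof (rule has_integral_bound[OF e(1)])
      show "((\<lambda>t. (h t - h (s + t)) * E v t) has_integral I v + I v) (cbox (-a) a)" using 3 by simp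
      show "norm ((h x - h (s + x)) * E v x) \<le> e" if "x \<in> cbox (-a) a" for x
        using e(2)[of x] that by (simp add: norm_mult E_def s_def add.commute)
    qed
    then show ?thesis using T by (simp add: a_def norm_mult flip: mult_2)
  qed
  have "((\<lambda>v. I v) \<longlongrightarrow> 0) at_top"
  proof (rule tendstoI)
    fix \<epsilon> :: real assume \<epsilon>: "\<epsilon> > 0"
    define e where "e = \<epsilon> / (2 * a)"
    have a0: "a > 0" using T by (simp add: a_def)
    have e: "e > 0" using \<epsilon> a0 by (simp add: e_def)
    have "uniformly_continuous_on {-a-1..a+1} h" by (intro compact_uniformly_continuous h) auto
    then obtain d where d: "d > 0" "\<And>x y. x \<in> {-a-1..a+1} \<Longrightarrow> y \<in> {-a-1..a+1} \<Longrightarrow> dist y x < d \<Longrightarrow> dist (h y) (h x) < e"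
      using e unfolding uniformly_continuous_on_def by metis
    have "\<forall>\<^sub>F v in at_top. v \<ge> max pi (pi / d + 1)" by (rule eventually_ge_at_top)
    then show "\<forall>\<^sub>F v in at_top. dist (I v) 0 < \<epsilon>"
    proof eventually_elim
      case (elim v)
      then have v: "v \<ge> pi" "v > pi / d" by auto
      have v0: "v > 0" using v pi_gt_zero by linarith
      have sd: "pi / v < d" using v(2) d v0 by (simp add: field_simps)
      have s1: "0 < pi / v" "pi / v \<le> 1" using v v0 by (auto simp: divide_le_eq)
      have "2 * norm (I v) \<le> e * (2 * a)"
      proof (rule key[OF v(1)])
        show "e \<ge> 0" using e by simp
        fix t assume "t \<in> {-a..a}"
        then have "t \<in> {-a-1..a+1}" "t + pi / v \<in> {-a-1..a+1}" using s1 by auto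
        then have "dist (h (t + pi / v)) (h t) < e" using sd s1 by (intro d(2)) (auto simp: dist_real_def)
        then show "norm (h t - h (t + pi / v)) \<le> e" by (simp add: dist_norm norm_minus_commute)
      qed
      then show ?case using \<epsilon> a0 by (simp add: e_def)
    qed
  qed
  then show ?thesis unfolding I_def h_def E_def by (simp add: ac_simps)
qed

text \<open>A Chebyshev-type bound, uniform in \<sigma> so that \<sigma> can later tend to 1. Write
  \<Lambda> + 1 = (\<Lambda> - 1) + 2: after Fejer smoothing the first part is bounded because
  \<open>G\<close> is bounded on a compact rectangle, the second by
  \<open>sum_inverse_window\<close>. The kernels at v and v + pi together dominate
  1/(1+x^2).\<close>

lemma mangoldt_window_bound:
  "\<exists>C>0. \<forall>v \<sigma>. 1 < \<sigma> \<and> \<sigma> \<le> 2 \<longrightarrow>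
     summable (\<lambda>n. (mangoldt n + 1) * real n powr (-\<sigma>) / (1 + (v - ln (real n))\<^sup>2)) \<and>
     (\<Sum>n. (mangoldt n + 1) * real n powr (-\<sigma>) / (1 + (v - ln (real n))\<^sup>2)) \<le> C"
proof -
  obtain G where G: "continuous_on {s. Re s \<ge> 1} G"
    "\<And>s. Re s > 1 \<Longrightarrow> (\<lambda>n. (mangoldt n - 1) * of_nat n powr (-s)) sums G s"
    using zeta_log_deriv_continuous by blast
  have "compact (G ` cbox (Complex 1 (-1)) (Complex 2 1))"
    by (intro compact_continuous_image continuous_on_subset[OF G(1)] compact_cbox) (auto simp: in_cbox_complex_iff)
  then have "bounded (G ` cbox (Complex 1 (-1)) (Complex 2 1))" by (rule compact_imp_bounded)
  then obtain K where K: "\<And>s. s \<in> cbox (Complex 1 (-1)) (Complex 2 1) \<Longrightarrow> norm (G s) \<le> K"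
    unfolding bounded_iff by blast
  define K' where "K' = max K 0"
  \<comment> \<open>The bound \<open>U\<close> is used for two shifts and multiplied by the 6 of
    \<open>fejer_one_shift_lower\<close>; 60 pi is 2 (from the splitting) times 5 (from
    \<open>fejer_one_upper\<close>) times 6 pi.\<close>
  define C where "C = 12 * (2 * K' + 60 * pi)"
  have U: "summable (\<lambda>n. (mangoldt n + 1) * real n powr (-\<sigma>) * fejer 1 (v - ln (real n))) \<and>
     (\<Sum>n. (mangoldt n + 1) * real n powr (-\<sigma>) * fejer 1 (v - ln (real n))) \<le> 2 * K' + 60 * pi"
    if \<sigma>: "1 < \<sigma>" "\<sigma> \<le> 2" for v \<sigma>
  proof -
    have nb: "norm (mangoldt n - 1 :: complex) \<le> mangoldt n + 1" for n
      using norm_triangle_ineq4[of "mangoldt n :: complex" 1] by simp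
    have s0: "summable (\<lambda>n. (mangoldt n + 1) * real n powr (-\<sigma>))"
      using summable_add[OF summable_mangoldt_powr[OF \<sigma>(1)] summable_powr[OF \<sigma>(1)]] by (simp add: distrib_right)
    have sm: "summable (\<lambda>n. norm (mangoldt n - 1 :: complex) * real n powr (-\<sigma>))"
      by (rule summable_comparison_test'[OF s0, where N=0]) (auto intro!: mult_right_mono nb simp: abs_mult)
    obtain S where S: "((\<lambda>t. of_real (tri 1 t) * exp (\<i> * of_real (t * v)) * G (Complex \<sigma> t)) has_integral S) {-1..1}"
     "(\<lambda>n. (mangoldt n - 1) * of_real (real n powr (- \<sigma>) * fejer 1 (v - ln (real n)))) sums S"
      using fejer_convolution[of 1 "\<lambda>n. mangoldt n - 1" \<sigma> "\<lambda>t. G (Complex \<sigma> t)" v, OF _ sm G(2)] \<sigma> by auto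
    have "norm S \<le> K' * measure lborel (cbox (-1) (1::real))"
    proof (rule has_integral_bound)
      show "0 \<le> K'" by (simp add: K'_def)
      show "((\<lambda>t. of_real (tri 1 t) * exp (\<i> * of_real (t * v)) * G (Complex \<sigma> t)) has_integral S) (cbox (- 1) 1)"
        using S(1) by simp
      fix t :: real assume "t \<in> cbox (-1) 1"
      then have "norm (G (Complex \<sigma> t)) \<le> K'" using \<sigma> K[of "Complex \<sigma> t"] by (auto simp: in_cbox_complex_iff K'_def)
      then have "norm (of_real (tri 1 t) * exp (\<i> * of_real (t * v))) * norm (G (Complex \<sigma> t)) \<le> 1 * K'"
        by (intro mult_mono norm_tri_exp) auto
      then show "norm (of_real (tri 1 t) * exp (\<i> * of_real (t * v)) * G (Complex \<sigma> t)) \<le> K'"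
        by (simp add: norm_mult)
    qed
    then have S2: "norm S \<le> 2 * K'" by simp
    have "(\<lambda>n. Re ((mangoldt n - 1) * of_real (real n powr (- \<sigma>) * fejer 1 (v - ln (real n))))) sums Re S"
      by (intro sums_Re S)
    then have r1: "(\<lambda>n. (mangoldt n - 1) * (real n powr (- \<sigma>) * fejer 1 (v - ln (real n)))) sums Re S"
      by simp
    define p where "p n = real n powr (- \<sigma>) * fejer 1 (v - ln (real n))" for n
    have p0: "p n \<ge> 0" for n by (simp add: p_def fejer_nonneg)
    have psum: "sum p {..<Suc N} \<le> 30 * pi" for N
    proof -
      have "sum p {..<Suc N} = sum p {1..<Suc N}"
        by (rule sum.mono_neutral_right) (auto simp: p_def not_le)
      also have "\<dots> \<le> (\<Sum>n\<in>{1..<Suc N}. 5 * (real n powr (- \<sigma>) / (1 + (v - ln (real n))\<^sup>2)))"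
      proof (rule sum_mono)
        fix n
        have "p n \<le> real n powr (- \<sigma>) * (5 / (1 + (v - ln (real n))\<^sup>2))"
          unfolding p_def by (intro mult_left_mono fejer_one_upper) auto
        then show "p n \<le> 5 * (real n powr (- \<sigma>) / (1 + (v - ln (real n))\<^sup>2))" by (simp add: mult.commute)
      qed
      also have "\<dots> = 5 * (\<Sum>n\<in>{1..<Suc N}. real n powr (- \<sigma>) / (1 + (v - ln (real n))\<^sup>2))"
        by (simp add: sum_distrib_left)
      also have "\<dots> \<le> 5 * (6 * pi)" using \<sigma> by (intro mult_left_mono sum_inverse_window) auto
      finally show ?thesis by simp
    qed
    have psum': "sum p {..<N} \<le> 30 * pi" for N
      using psum[of N] p0[of N] by (auto intro: order_trans[of _ "sum p {..<Suc N}"])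
    have ps: "summable p" by (rule summableI_nonneg_bounded[OF p0 psum'])
    have pl: "suminf p \<le> 30 * pi" by (rule suminf_le_const[OF ps psum'])
    have "(\<lambda>n. (mangoldt n - 1) * p n + 2 * p n) sums (Re S + 2 * suminf p)"
      using r1 ps unfolding p_def[symmetric] by (intro sums_add sums_mult summable_sums)
    then have "(\<lambda>n. (mangoldt n + 1) * p n) sums (Re S + 2 * suminf p)" by (simp add: algebra_simps)
    moreover have "Re S + 2 * suminf p \<le> 2 * K' + 60 * pi"
      using S2 complex_Re_le_cmod[of S] pl by linarith
    ultimately show ?thesis by (simp add: sums_iff p_def mult.assoc)
  qed
  show ?thesis
  proof (intro exI[of _ C] conjI allI impI)
    show "C > 0" using pi_gt_zero by (simp add: C_def K'_def add_nonneg_pos)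
    fix v \<sigma> :: real assume "1 < \<sigma> \<and> \<sigma> \<le> 2"
    then have \<sigma>: "1 < \<sigma>" "\<sigma> \<le> 2" by auto
    let ?w = "\<lambda>n. (mangoldt n + 1) * real n powr (-\<sigma>)"
    let ?f = "\<lambda>n. ?w n / (1 + (v - ln (real n))\<^sup>2)"
    let ?g = "\<lambda>n. 6 * (?w n * fejer 1 (v - ln (real n)) + ?w n * fejer 1 ((v + pi) - ln (real n)))"
    note U1 = U[OF \<sigma>, of v] and U2 = U[OF \<sigma>, of "v + pi"]
    have le: "?f n \<le> ?g n" for n
    proof -
      have "?f n = ?w n * (1 / (1 + (v - ln (real n))\<^sup>2))" by simp
      also have "\<dots> \<le> ?w n * (6 * (fejer 1 (v - ln (real n)) + fejer 1 ((v - ln (real n)) + pi)))"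
        by (intro mult_left_mono fejer_one_shift_lower) (auto simp: mangoldt_nonneg add_nonneg_nonneg)
      also have "\<dots> = ?g n" by (simp add: algebra_simps)
      finally show ?thesis .
    qed
    have f0: "0 \<le> ?f n" for n by (intro divide_nonneg_nonneg mult_nonneg_nonneg) (auto simp: mangoldt_nonneg add_nonneg_nonneg)
    have sg: "summable ?g" using U1 U2 by (intro summable_mult summable_add) auto
    show sf: "summable ?f"
      by (rule summable_comparison_test'[OF sg, where N=0]) (use le f0 in \<open>simp only: real_norm_def abs_of_nonneg\<close>)
    have "suminf ?f \<le> suminf ?g" by (rule suminf_le[OF le sf sg])
    also have "\<dots> = 6 * (suminf (\<lambda>n. ?w n * fejer 1 (v - ln (real n))) + suminf (\<lambda>n. ?w n * fejer 1 ((v + pi) - ln (real n))))"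
      using U1 U2 by (subst suminf_mult) (auto intro!: summable_add simp: suminf_add)
    also have "\<dots> \<le> 6 * ((2 * K' + 60 * pi) + (2 * K' + 60 * pi))"
      using U1 U2 by (intro mult_left_mono add_mono) auto
    also have "\<dots> = C" by (simp add: C_def)
    finally show "suminf ?f \<le> C" .
  qed
qed

section \<open>Restriction to logarithmic windows and passage to Re s = 1\<close>

definition window :: "real \<Rightarrow> real \<Rightarrow> nat set" where
  "window \<rho> v = {n. n \<ge> 1 \<and> \<bar>v - ln (real n)\<bar> \<le> \<rho>}"

lemma finite_window: "finite (window \<rho> v)"
proof (rule finite_subset)
  show "window \<rho> v \<subseteq> {..nat \<lfloor>exp (v + \<rho>)\<rfloor>}"
  proof
    fix n assume "n \<in> window \<rho> v"
    then have n: "n \<ge> 1" "ln (real n) \<le> v + \<rho>" by (auto simp: window_def abs_le_iff)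
    have "exp (ln (real n)) \<le> exp (v + \<rho>)" using n(2) by simp
    then have "real n \<le> exp (v + \<rho>)" using n(1) by simp
    then show "n \<in> {..nat \<lfloor>exp (v + \<rho>)\<rfloor>}" by (simp add: le_nat_floor)
  qed
qed simp

text \<open>Outside the window, where |x| > \<rho>, the kernel is at most 4/(T x^2) \<le> 8/(T
  \<rho>^2 (1 + x^2)), so the discarded terms are controlled by the Chebyshev-type bound. Everything
  is uniform in \<sigma>; as the window is finite and \<open>G\<close> is continuous up to the
  boundary, \<sigma> may tend to 1.\<close>

lemma fejer_window_bound:
  fixes b :: "nat \<Rightarrow> complex"
  assumes C: "\<And>v \<sigma>. 1 < \<sigma> \<Longrightarrow> \<sigma> \<le> 2 \<Longrightarrow>
     summable (\<lambda>n. (mangoldt n + 1) * real n powr (-\<sigma>) / (1 + (v - ln (real n))\<^sup>2)) \<and>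
     (\<Sum>n. (mangoldt n + 1) * real n powr (-\<sigma>) / (1 + (v - ln (real n))\<^sup>2)) \<le> C"
   and b: "\<And>n. norm (b n) \<le> mangoldt n + 1"
   and G: "continuous_on {s. Re s \<ge> 1} G" "\<And>s. Re s > 1 \<Longrightarrow> (\<lambda>n. b n * of_nat n powr (-s)) sums G s"
   and T: "T > 0" and \<rho>: "0 < \<rho>" "\<rho> \<le> 1"
 shows "norm (\<Sum>n\<in>window \<rho> v. b n / of_nat n * of_real (fejer T (v - ln (real n)))) \<le>
    norm (integral {-T..T} (\<lambda>t. of_real (tri T t) * exp (\<i> * of_real (t * v)) * G (Complex 1 t))) + 8 * C / (T * \<rho>\<^sup>2)"
proof -
  let ?A = "window \<rho> v"
  define I where "I \<sigma> = integral {-T..T} (\<lambda>t. of_real (tri T t) * exp (\<i> * of_real (t * v)) * G (Complex \<sigma> t))" for \<sigma>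
  define w where "w \<sigma> n = b n * of_real (real n powr (- \<sigma>) * fejer T (v - ln (real n)))" for \<sigma> n
  define D where "D = 8 / (T * \<rho>\<^sup>2)"
  have D: "D \<ge> 0" using T by (simp add: D_def)
  have main: "norm (\<Sum>n\<in>?A. w \<sigma> n) \<le> norm (I \<sigma>) + D * C" if \<sigma>: "1 < \<sigma>" "\<sigma> \<le> 2" for \<sigma>
  proof -
    have s0: "summable (\<lambda>n. (mangoldt n + 1) * real n powr (-\<sigma>))"
      using summable_add[OF summable_mangoldt_powr[OF \<sigma>(1)] summable_powr[OF \<sigma>(1)]] by (simp add: distrib_right)
    have sm: "summable (\<lambda>n. norm (b n) * real n powr (-\<sigma>))"
      by (rule summable_comparison_test'[OF s0, where N=0]) (auto intro!: mult_right_mono b simp: abs_mult)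
    obtain S where S: "((\<lambda>t. of_real (tri T t) * exp (\<i> * of_real (t * v)) * G (Complex \<sigma> t)) has_integral S) {-T..T}"
     "w \<sigma> sums S"
      using fejer_convolution[of T b \<sigma> "\<lambda>t. G (Complex \<sigma> t)" v, OF T sm G(2)] \<sigma> unfolding w_def by auto
    have SI: "S = I \<sigma>" using S(1) unfolding I_def by (rule integral_unique[symmetric])
    have "(\<lambda>n. if n \<in> ?A then w \<sigma> n else 0) sums (\<Sum>n\<in>?A. w \<sigma> n)"
      by (rule sums_If_finite_set[OF finite_window])
    then have "(\<lambda>n. w \<sigma> n - (if n \<in> ?A then w \<sigma> n else 0)) sums (S - (\<Sum>n\<in>?A. w \<sigma> n))"
      by (rule sums_diff[OF S(2)])
    then have rest: "(\<lambda>n. if n \<in> ?A then 0 else w \<sigma> n) sums (S - (\<Sum>n\<in>?A. w \<sigma> n))"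
      by (rule sums_cong[THEN iffD1, rotated]) auto
    let ?f = "\<lambda>n. (mangoldt n + 1) * real n powr (-\<sigma>) / (1 + (v - ln (real n))\<^sup>2)"
    have bd: "norm (if n \<in> ?A then 0 else w \<sigma> n) \<le> D * ?f n" for n
    proof (cases "n \<in> ?A \<or> n = 0")
      case True
      have "0 \<le> ?f n" by (intro divide_nonneg_nonneg mult_nonneg_nonneg) (auto simp: mangoldt_nonneg add_nonneg_nonneg)
      from mult_nonneg_nonneg[OF D this] show ?thesis using True by (auto simp: w_def)
    next
      case False
      define x where "x = v - ln (real n)"
      have x: "\<bar>x\<bar> > \<rho>" using False by (auto simp: window_def x_def)
      then have x0: "x \<noteq> 0" using \<rho> by auto
      have "\<rho>\<^sup>2 \<le> \<bar>x\<bar>\<^sup>2" using x \<rho> by (intro power_mono) auto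
      moreover have "\<rho>\<^sup>2 * x\<^sup>2 \<le> 1 * x\<^sup>2" using \<rho> by (intro mult_right_mono) (auto simp: power_le_one)
      ultimately have "\<rho>\<^sup>2 * (1 + x\<^sup>2) \<le> 2 * x\<^sup>2" by (simp add: distrib_left)
      then have "T * (\<rho>\<^sup>2 * (1 + x\<^sup>2)) \<le> T * (2 * x\<^sup>2)" using T by (intro mult_left_mono) auto
      then have "8 / (T * (2 * x\<^sup>2)) \<le> 8 / (T * (\<rho>\<^sup>2 * (1 + x\<^sup>2)))"
        using T \<rho> x0 by (intro divide_left_mono mult_pos_pos) (auto simp: add_pos_nonneg)
      moreover have "8 / (T * (2 * x\<^sup>2)) = 4 / (T * x\<^sup>2)" by simp
      moreover have "8 / (T * (\<rho>\<^sup>2 * (1 + x\<^sup>2))) = D / (1 + x\<^sup>2)" by (simp add: D_def mult.assoc)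
      ultimately have "4 / (T * x\<^sup>2) \<le> D / (1 + x\<^sup>2)" by simp
      then have k: "fejer T x \<le> D / (1 + x\<^sup>2)" using fejer_decay[OF T x0] by linarith
      have "norm (w \<sigma> n) = norm (b n) * (real n powr (- \<sigma>) * fejer T x)"
        using fejer_nonneg[OF T, of x] by (simp add: w_def norm_mult x_def)
      also have "\<dots> \<le> (mangoldt n + 1) * (real n powr (- \<sigma>) * (D / (1 + x\<^sup>2)))"
        by (intro mult_mono b mult_left_mono k) (use fejer_nonneg[OF T, of x] in \<open>auto simp: mangoldt_nonneg add_nonneg_nonneg\<close>)
      also have "\<dots> = D * ?f n" by (simp add: x_def)
      finally show ?thesis using False by simp
    qed
    have "norm (\<Sum>n. if n \<in> ?A then 0 else w \<sigma> n) \<le> (\<Sum>n. D * ?f n)"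
      by (rule norm_suminf_le[OF bd summable_mult]) (use C[OF \<sigma>] in blast)
    also have "\<dots> = D * suminf ?f" by (rule suminf_mult) (use C[OF \<sigma>] in auto)
    also have "\<dots> \<le> D * C" using C[OF \<sigma>] D by (intro mult_left_mono) auto
    finally have "norm (S - (\<Sum>n\<in>?A. w \<sigma> n)) \<le> D * C" using rest by (simp add: sums_iff)
    moreover have "norm (\<Sum>n\<in>?A. w \<sigma> n) \<le> norm S + norm (S - (\<Sum>n\<in>?A. w \<sigma> n))"
      by (metis norm_minus_commute norm_triangle_sub)
    ultimately show ?thesis unfolding SI by linarith
  qed
  define \<sigma> where "\<sigma> k = 1 + 1 / real (Suc k)" for k
  have sig: "1 < \<sigma> k" "\<sigma> k \<le> 2" for k by (auto simp: \<sigma>_def)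
  have siglim: "\<sigma> \<longlonglongrightarrow> 1"
  proof -
    have "(\<lambda>k. 1 + 1 / real (Suc k)) \<longlonglongrightarrow> 1 + 0" by (intro tendsto_intros LIMSEQ_Suc[OF lim_1_over_n[unfolded inverse_eq_divide]])
    then show ?thesis by (simp add: \<sigma>_def[abs_def])
  qed
  have "continuous_on {1..2} I"
  proof -
    have "continuous_on {1..2} (\<lambda>\<sigma>. integral (cbox (-T) T) (\<lambda>t. of_real (tri T t) * exp (\<i> * of_real (t * v)) * G (Complex \<sigma> t)))"
    proof (rule integral_continuous_on_param)
      have gc: "continuous_on ({1..2} \<times> cbox (-T) T) (\<lambda>z. G (Complex (fst z) (snd z)))"
      proof (rule continuous_on_compose2[OF G(1)])
        have "continuous_on A (\<lambda>z::real\<times>real. of_real (fst z) + \<i> * of_real (snd z))" for A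
          by (intro continuous_intros)
        moreover have "(\<lambda>z. Complex (fst z) (snd z)) = (\<lambda>z. of_real (fst z) + \<i> * of_real (snd z))"
          by (auto simp: complex_eq_iff)
        ultimately show "continuous_on ({1..2} \<times> cbox (-T) T) (\<lambda>z. Complex (fst z) (snd z))" by (simp only:)
      qed auto
      have tc: "continuous_on ({1..2::real} \<times> cbox (-T) T) (\<lambda>z. tri T (snd z))"
        by (rule continuous_on_compose2[OF continuous_on_tri[OF T, of UNIV]]) (auto intro: continuous_intros)
      show "continuous_on ({1..2} \<times> cbox (-T) T) (\<lambda>(\<sigma>, t). of_real (tri T t) * exp (\<i> * of_real (t * v)) * G (Complex \<sigma> t))"
        unfolding case_prod_unfold by (intro continuous_intros gc tc)
    qed
    then show ?thesis by (simp add: I_def[abs_def])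
  qed
  then have Ilim: "(\<lambda>k. I (\<sigma> k)) \<longlonglongrightarrow> I 1"
    using siglim sig by (intro continuous_on_tendsto_compose[of "{1..2}" I \<sigma> 1]) (auto simp: less_imp_le)
  have wlim: "(\<lambda>k. w (\<sigma> k) n) \<longlonglongrightarrow> w 1 n" if "n \<in> ?A" for n
    unfolding w_def using that by (intro tendsto_intros siglim) (auto simp: window_def)
  have "(\<lambda>k. norm (\<Sum>n\<in>?A. w (\<sigma> k) n)) \<longlonglongrightarrow> norm (\<Sum>n\<in>?A. w 1 n)"
    by (intro tendsto_intros wlim)
  moreover have "(\<lambda>k. norm (I (\<sigma> k)) + D * C) \<longlonglongrightarrow> norm (I 1) + D * C"
    by (intro tendsto_intros Ilim)
  ultimately have "norm (\<Sum>n\<in>?A. w 1 n) \<le> norm (I 1) + D * C"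
    by (rule LIMSEQ_le) (intro exI allI impI main sig)
  moreover have "w 1 n = b n / of_nat n * of_real (fejer T (v - ln (real n)))" if "n \<in> ?A" for n
    using that by (simp add: w_def window_def powr_minus divide_inverse)
  ultimately show ?thesis by (simp add: I_def D_def)
qed

text \<open>The constant precedes all other quantifiers, so that T can be chosen in terms of
  \<open>C\<close> and \<rho>. The integral in \<open>fejer_window_bound\<close> tends to 0 by
  Riemann-Lebesgue.\<close>

theorem fejer_window_small:
  "\<exists>C>0. \<forall>b G T \<rho> \<epsilon>. (\<forall>n. norm (b n) \<le> mangoldt n + 1) \<longrightarrow> continuous_on {s. Re s \<ge> 1} G \<longrightarrow>
     (\<forall>s. Re s > 1 \<longrightarrow> (\<lambda>n. b n * of_nat n powr (-s)) sums G s) \<longrightarrow> T > 0 \<longrightarrow> 0 < \<rho> \<longrightarrow> \<rho> \<le> 1 \<longrightarrow> \<epsilon> > 0 \<longrightarrow>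
     (\<forall>\<^sub>F v in at_top. norm (\<Sum>n\<in>window \<rho> v. b n / of_nat n * of_real (fejer T (v - ln (real n)))) \<le> C / (T * \<rho>\<^sup>2) + \<epsilon>)"
proof -
  obtain C where C0: "C > 0" and C1: "\<forall>v \<sigma>. 1 < \<sigma> \<and> \<sigma> \<le> 2 \<longrightarrow>
     summable (\<lambda>n. (mangoldt n + 1) * real n powr (-\<sigma>) / (1 + (v - ln (real n))\<^sup>2)) \<and>
     (\<Sum>n. (mangoldt n + 1) * real n powr (-\<sigma>) / (1 + (v - ln (real n))\<^sup>2)) \<le> C"
    using mangoldt_window_bound by (elim exE conjE) (rule that)
  note C = C0 C1[rule_format, OF conjI]
  show ?thesis
  proof (intro exI[of _ "8 * C"] conjI allI impI)
    show "8 * C > 0" using C by simp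
    fix b :: "nat \<Rightarrow> complex" and G :: "complex \<Rightarrow> complex" and T \<rho> \<epsilon> :: real
    assume b: "\<forall>n. norm (b n) \<le> mangoldt n + 1" and G: "continuous_on {s. Re s \<ge> 1} G"
     "\<forall>s. Re s > 1 \<longrightarrow> (\<lambda>n. b n * of_nat n powr (-s)) sums G s" and T: "T > 0" and \<rho>: "0 < \<rho>" "\<rho> \<le> 1" and \<epsilon>: "\<epsilon> > 0"
    have "continuous_on UNIV (\<lambda>t. G (Complex 1 t))"
    proof (rule continuous_on_compose2[OF G(1)])
      have "continuous_on UNIV (\<lambda>t. 1 + \<i> * of_real t)" by (intro continuous_intros)
      moreover have "(\<lambda>t. Complex 1 t) = (\<lambda>t. 1 + \<i> * of_real t)" by (auto simp: complex_eq_iff)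
      ultimately show "continuous_on UNIV (\<lambda>t. Complex 1 t)" by simp
    qed auto
    from tendstoD[OF riemann_lebesgue_tri[OF T this] \<epsilon>]
    show "\<forall>\<^sub>F v in at_top. norm (\<Sum>n\<in>window \<rho> v. b n / of_nat n * of_real (fejer T (v - ln (real n)))) \<le> 8 * C / (T * \<rho>\<^sup>2) + \<epsilon>"
    proof eventually_elim
      case (elim v)
      have "norm (\<Sum>n\<in>window \<rho> v. b n / of_nat n * of_real (fejer T (v - ln (real n)))) \<le>
        norm (integral {-T..T} (\<lambda>t. of_real (tri T t) * exp (\<i> * of_real (t * v)) * G (Complex 1 t))) + 8 * C / (T * \<rho>\<^sup>2)"
        by (rule fejer_window_bound[OF C(2) _ G(1) _ T \<rho>]) (use b G(2) in blast)+
      then show ?case using elim by (simp only: dist_norm diff_zero)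
    qed
  qed
qed

section \<open>Smoothed prime sums in windows\<close>

text \<open>The support consists of the p^k with k \<ge> 2; for fixed p the sum over k is geometric
  and at most 2 log p / p^2.\<close>

lemma summable_mangoldt_nonprime: "summable (\<lambda>n. if prime n then 0 else mangoldt n / real n)"
proof -
  let ?Q = "SIGMA p:{p::nat. prime p}. {2::nat..}"
  let ?h = "\<lambda>(p::nat, k::nat). p ^ k"
  have ln0: "0 \<le> ln (real n)" for n by (cases "n = 0") auto
  have out: "(\<lambda>p. 2 * (ln (real p) * real p powr (-2))) summable_on {p. prime p}"
    by (rule summable_on_subset_banach[OF norm_summable_imp_summable_on])
       (use summable_mult[OF summable_ln_powr[of 2], of 2] ln0 in \<open>auto simp: abs_mult\<close>)
  have "(\<lambda>(p, k). ln (real p) / real p ^ k) summable_on ?Q"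
  proof (rule summable_on_SigmaI)
    fix p :: nat assume "p \<in> {p. prime p}"
    then have p: "p \<ge> 2" using prime_ge_2_nat by blast
    have "(\<lambda>k. (1 / real p) ^ k) sums (1 / (1 - 1 / real p))" by (rule geometric_sums) (use p in auto)
    then have "(\<lambda>k. ln (real p) * (1 / real p)^2 * (1 / real p) ^ k) sums (ln (real p) * (1 / real p)^2 * (1 / (1 - 1 / real p)))"
      by (rule sums_mult)
    then have "((\<lambda>k. ln (real p) * (1 / real p)^2 * (1 / real p) ^ k) has_sum (ln (real p) * (1 / real p)^2 * (1 / (1 - 1 / real p)))) UNIV"
      by (rule norm_summable_imp_has_sum[rotated]) (use p in \<open>auto simp: abs_mult intro!: summable_mult summable_geometric\<close>)
    then show "((\<lambda>k. case (p, k) of (p, k) \<Rightarrow> ln (real p) / real p ^ k) has_sum (ln (real p) * (1 / real p)^2 * (1 / (1 - 1 / real p)))) {2..}"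
    proof (subst (asm) has_sum_reindex_bij_witness[where T = "{2..}" and j = "\<lambda>k. k + 2" and i = "\<lambda>k. k - 2" and h = "\<lambda>k. case (p, k) of (p, k) \<Rightarrow> ln (real p) / real p ^ k"], goal_cases)
      case (5 a)
      then show ?case by (simp add: power_add power_divide divide_inverse power2_eq_square power_inverse mult_ac)
    qed auto
  next
    show "(\<lambda>p. ln (real p) * (1 / real p)^2 * (1 / (1 - 1 / real p))) summable_on {p. prime p}"
    proof (rule summable_on_comparison_test[OF out])
      fix p :: nat assume "p \<in> {p. prime p}"
      then have p: "p \<ge> 2" using prime_ge_2_nat by blast
      have "1 / (1 - 1 / real p) \<le> 2" using p by (simp add: field_simps)
      then have "ln (real p) * (1 / real p)^2 * (1 / (1 - 1 / real p)) \<le> ln (real p) * (1 / real p)^2 * 2"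
        using p by (intro mult_left_mono) auto
      also have "\<dots> = 2 * (ln (real p) * real p powr (-2))"
        using p by (simp add: powr_minus powr_numeral power_divide divide_inverse power_inverse mult_ac)
      finally show "ln (real p) * (1 / real p)^2 * (1 / (1 - 1 / real p)) \<le> 2 * (ln (real p) * real p powr (-2))" .
      show "0 \<le> ln (real p) * (1 / real p)^2 * (1 / (1 - 1 / real p))"
        using p by (intro mult_nonneg_nonneg) auto
    qed
  qed (use ln0 in auto)
  also have "?this \<longleftrightarrow> ((\<lambda>n. mangoldt n / real n) \<circ> ?h) summable_on ?Q"
    by (intro summable_on_cong) (auto simp: mangoldt_primepow)
  finally have s: "((\<lambda>n. mangoldt n / real n) \<circ> ?h) summable_on ?Q" .
  have inj: "inj_on ?h ?Q"
  proof (rule inj_onI)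
    fix u v assume uv: "u \<in> ?Q" "v \<in> ?Q" "?h u = ?h v"
    obtain p k r l where e: "u = (p, k)" "v = (r, l)" by (cases u, cases v) blast
    show "u = v" using uv prime_power_inj'[of p r k l] by (auto simp: e)
  qed
  from s have s2: "(\<lambda>n. mangoldt n / real n) summable_on (?h ` ?Q)"
    by (simp add: summable_on_reindex[OF inj])
  have "(\<lambda>n. mangoldt n / real n) summable_on (?h ` ?Q) \<longleftrightarrow> (\<lambda>n. if prime n then 0 else mangoldt n / real n) summable_on UNIV"
  proof (rule summable_on_cong_neutral)
    fix n assume "n \<in> UNIV - ?h ` ?Q"
    then have n: "n \<notin> ?h ` ?Q" by simp
    show "(if prime n then 0 else mangoldt n / real n) = 0"
    proof (cases "primepow n \<and> \<not> prime n")
      case True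
      then obtain p k where pk: "prime p" "k > 0" "n = p ^ k" by (auto simp: primepow_def)
      then have "k \<noteq> 1" using True by auto
      then have "k \<ge> 2" using pk by linarith
      then have "n \<in> ?h ` ?Q" using pk by (auto intro!: image_eqI[of _ _ "(p, k)"])
      with n show ?thesis by simp
    qed (auto simp: mangoldt_def)
  next
    fix n assume "n \<in> ?h ` ?Q \<inter> UNIV"
    then obtain p k where pk: "prime p" "k \<ge> 2" "n = p ^ k" by auto
    then have "\<not> prime n" by (simp add: prime_power_iff)
    then show "mangoldt n / real n = (if prime n then 0 else mangoldt n / real n)" by simp
  qed auto
  with s2 have "(\<lambda>n. if prime n then 0 else mangoldt n / real n :: real) summable_on UNIV" by simp
  then obtain x where "((\<lambda>n. if prime n then 0 else mangoldt n / real n :: real) has_sum x) UNIV"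
    unfolding summable_on_def by blast
  then show ?thesis by (rule sums_summable[OF has_sum_imp_sums])
qed

lemma window_tail_small:
  fixes g :: "nat \<Rightarrow> real"
  assumes g: "summable g" "\<And>n. g n \<ge> 0" and \<epsilon>: "\<epsilon> > 0"
  shows "\<forall>\<^sub>F v in at_top. sum g (window \<rho> v) \<le> \<epsilon>"
proof -
  have "(\<lambda>N. sum g {..<N}) \<longlonglongrightarrow> suminf g" using g(1) by (simp add: summable_LIMSEQ)
  then have "\<forall>\<^sub>F N in sequentially. sum g {..<N} > suminf g - \<epsilon>" by (rule order_tendstoD) (use \<epsilon> in simp)
  then obtain N where N: "sum g {..<N} > suminf g - \<epsilon>" by (auto simp: eventually_sequentially)
  have "\<forall>\<^sub>F v in at_top. v \<ge> ln (real (Suc N)) + \<rho>" by (rule eventually_ge_at_top)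
  then show ?thesis
  proof eventually_elim
    case (elim v)
    have disj: "window \<rho> v \<inter> {..<N} = {}"
    proof (rule ccontr)
      assume "\<not> ?thesis"
      then obtain n where n: "n \<ge> 1" "v - ln (real n) \<le> \<rho>" "n < N" by (auto simp: window_def abs_le_iff)
      then have "ln (real n) < ln (real (Suc N))" by simp
      with n elim show False by linarith
    qed
    have "sum g (window \<rho> v \<union> {..<N}) \<le> suminf g"
      using g by (intro sum_le_suminf) (auto simp: finite_window)
    then have "sum g (window \<rho> v) + sum g {..<N} \<le> suminf g"
      using disj by (subst (asm) sum.union_disjoint) (auto simp: finite_window)
    then show ?case using N by linarith
  qed
qed

text \<open>Read off from the integral representation, which takes care of the removable singularity
  at 0.\<close>

lemma continuous_on_fejer:
  assumes T: "T > 0" shows "continuous_on UNIV (fejer T)"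
proof -
  have "continuous_on UNIV (\<lambda>y. integral (cbox (-T) T) (\<lambda>t. complex_of_real (tri T t) * exp (\<i> * of_real (t * y))))"
  proof (rule integral_continuous_on_param)
    have tc: "continuous_on (UNIV \<times> cbox (-T) T) (\<lambda>z::real\<times>real. tri T (snd z))"
      by (rule continuous_on_compose2[OF continuous_on_tri[OF T, of UNIV]]) (auto intro: continuous_intros)
    show "continuous_on (UNIV \<times> cbox (-T) T) (\<lambda>(y, t). complex_of_real (tri T t) * exp (\<i> * of_real (t * y)))"
      unfolding case_prod_unfold by (intro continuous_intros tc)
  qed
  moreover have "(\<lambda>y. integral (cbox (-T) T) (\<lambda>t. complex_of_real (tri T t) * exp (\<i> * of_real (t * y)))) = (\<lambda>y. of_real (fejer T y))"
    using integral_unique[OF fejer_has_integral[OF T]] by auto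
  ultimately have "continuous_on UNIV (\<lambda>y. complex_of_real (fejer T y))" by (simp only:)
  then have "continuous_on UNIV (\<lambda>y. Re (complex_of_real (fejer T y)))" by (rule continuous_on_Re)
  then show ?thesis by simp
qed

lemma ln_Suc_diff_bounds:
  assumes "n \<ge> 1"
  shows "ln (real (Suc n)) - ln (real n) \<le> 1 / real n" "ln (real (Suc n)) - ln (real n) \<ge> 1 / real n - 1 / (real n)\<^sup>2"
    "ln (real (Suc n)) - ln (real n) > 0"
proof -
  have n: "real n > 0" using assms by simp
  have eq: "ln (real (Suc n)) - ln (real n) = ln (1 + 1 / real n)"
  proof -
    have "ln (real (Suc n)) - ln (real n) = ln (real (Suc n) / real n)" using n by (simp add: ln_div)
    also have "real (Suc n) / real n = 1 + 1 / real n" using n by (simp add: field_simps)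
    finally show ?thesis .
  qed
  show "ln (real (Suc n)) - ln (real n) \<le> 1 / real n" unfolding eq by (rule ln_add_one_self_le_self) simp
  show "ln (real (Suc n)) - ln (real n) \<ge> 1 / real n - 1 / (real n)\<^sup>2"
    unfolding eq using ln_one_plus_pos_lower_bound[of "1 / real n"] assms by (simp add: power_divide)
  show "ln (real (Suc n)) - ln (real n) > 0" using n by simp
qed

text \<open>The points log n - v have gaps log(1 + 1/n), which differ from the weights 1/n by at
  most 1/n^2, so this is nearly a Riemann sum whose mesh tends to 0. It is compared termwise with
  the increments of an antiderivative.\<close>

lemma window_riemann_sum:
  fixes f :: "real \<Rightarrow> real"
  assumes f: "continuous_on UNIV f" and \<rho>: "0 < \<rho>" "\<rho> \<le> 1"
  shows "((\<lambda>v. \<Sum>n\<in>window \<rho> v. f (ln (real n) - v) / real n) \<longlongrightarrow> integral {-\<rho>..\<rho>} f) at_top"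
proof -
  \<comment> \<open>The interval [-3, 3] leaves room for the last point, which overshoots \<rho>
    \<le> 1 slightly.\<close>
  obtain F where F: "\<And>x. x \<in> {-3..3} \<Longrightarrow> (F has_vector_derivative f x) (at x within {-3..3})"
    using antiderivative_continuous[of "-3" 3 f] continuous_on_subset[OF f] by blast
  have F': "(F has_real_derivative f x) (at x)" if "-3 < x" "x < 3" for x
    using F[of x] that by (simp add: has_real_derivative_iff_has_vector_derivative at_within_Icc_at)
  have int: "integral {-\<rho>..\<rho>} f = F \<rho> - F (-\<rho>)"
  proof (rule integral_unique, rule fundamental_theorem_of_calculus)
    fix x assume "x \<in> {-\<rho>..\<rho>}"
    then have "x \<in> {-3..3}" "{-\<rho>..\<rho>} \<subseteq> {-3..3}" using \<rho> by auto
    then show "(F has_vector_derivative f x) (at x within {-\<rho>..\<rho>})"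
      using has_vector_derivative_within_subset[OF F] by blast
  qed (use \<rho> in simp)
  have "bounded (f ` {-3..3})"
    by (intro compact_imp_bounded compact_continuous_image continuous_on_subset[OF f]) auto
  then obtain K where "\<forall>y\<in>f ` {-3..3}. norm y \<le> K" unfolding bounded_iff by blast
  then have K: "\<bar>f x\<bar> \<le> K" if "x \<in> {-3..3}" for x using that by auto
  have K0: "K \<ge> 0" using K[of 0] by simp
  have mvt: "\<exists>\<xi>. x \<le> \<xi> \<and> \<xi> \<le> y \<and> F y - F x = f \<xi> * (y - x)" if "-3 < x" "x \<le> y" "y < 3" for x y
  proof (cases "x = y")
    case False
    then have xy: "x < y" using that by simp
    have "\<exists>z. x < z \<and> z < y \<and> F y - F x = (y - x) * f z"
      by (rule MVT2[OF xy]) (use that F' in auto)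
    then show ?thesis by (auto simp: mult.commute intro: less_imp_le)
  qed auto
  have Flip: "\<bar>F y - F x\<bar> \<le> K * (y - x)" if xy: "-3 < x" "x \<le> y" "y < 3" for x y
  proof -
    obtain \<xi> where "x \<le> \<xi>" "\<xi> \<le> y" "F y - F x = f \<xi> * (y - x)" using mvt[OF xy] by blast
    then show ?thesis using K[of \<xi>] xy by (simp add: abs_mult mult_right_mono)
  qed
  show ?thesis
  proof (rule tendstoI)
    fix \<epsilon> :: real assume \<epsilon>: "\<epsilon> > 0"
    \<comment> \<open>The interior errors add up to 12 e and the two ends cost e each, 14 e in
      all.\<close>
    define e where "e = \<epsilon> / 24"
    have e: "e > 0" using \<epsilon> by (simp add: e_def)
    have "uniformly_continuous_on {-3..3} f" by (intro compact_uniformly_continuous continuous_on_subset[OF f]) auto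
    then obtain d where d: "d > 0" "\<And>x y. x \<in> {-3..3} \<Longrightarrow> y \<in> {-3..3} \<Longrightarrow> \<bar>y - x\<bar> < d \<Longrightarrow> \<bar>f y - f x\<bar> < e"
      using e unfolding uniformly_continuous_on_def dist_real_def by metis
    \<comment> \<open>For n \<ge> B the gaps stay below the modulus of continuity \<open>d\<close>,
      and the weight error K/n^2 is at most e/n.\<close>
    define B where "B = max 2 (max (2 / d) ((K + 1) / e))"
    have "\<forall>\<^sub>F v in at_top. v \<ge> 1 + ln B" by (rule eventually_ge_at_top)
    then show "\<forall>\<^sub>F v in at_top. dist (\<Sum>n\<in>window \<rho> v. f (ln (real n) - v) / real n) (integral {-\<rho>..\<rho>} f) < \<epsilon>"
    proof eventually_elim
      case (elim v)
      define p where "p = nat \<lceil>exp (v - \<rho>)\<rceil>"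
      define q where "q = nat \<lfloor>exp (v + \<rho>)\<rfloor>"
      define a where "a n = ln (real n) - v" for n
      have B2: "B \<ge> 2" "B \<ge> 2 / d" "B \<ge> (K + 1) / e" by (auto simp: B_def)
      have "B = exp (ln B)" using B2 by simp
      also have "\<dots> \<le> exp (v - \<rho>)" using elim \<rho> by simp
      finally have Bv: "B \<le> exp (v - \<rho>)" .
      have pb: "exp (v - \<rho>) \<le> real p" "real p < exp (v - \<rho>) + 1"
        by (auto simp: p_def of_nat_nat) (linarith+)
      have qb: "real q \<le> exp (v + \<rho>)" "exp (v + \<rho>) < real q + 1"
        by (auto simp: q_def of_nat_nat)
      have pB: "real p \<ge> B" using Bv pb by linarith
      have p1: "p \<ge> 1" using pB B2 by linarith
      have win: "window \<rho> v = {p..q}"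
      proof (intro equalityI subsetI)
        fix n assume "n \<in> window \<rho> v"
        then have n: "n \<ge> 1" "v - \<rho> \<le> ln (real n)" "ln (real n) \<le> v + \<rho>" by (auto simp: window_def abs_le_iff)
        have "exp (v - \<rho>) \<le> exp (ln (real n))" "exp (ln (real n)) \<le> exp (v + \<rho>)" using n by (simp_all only: exp_le_cancel_iff)
        then have "exp (v - \<rho>) \<le> real n" "real n \<le> exp (v + \<rho>)" using n(1) by simp_all
        then show "n \<in> {p..q}" by (simp add: p_def q_def le_nat_floor nat_ceiling_le_eq)
      next
        fix n assume n: "n \<in> {p..q}"
        then have "exp (v - \<rho>) \<le> real n" "real n \<le> exp (v + \<rho>)" using pb qb by (auto intro: order_trans)
        moreover have "n \<ge> 1" using n p1 by simp
        ultimately have "ln (exp (v - \<rho>)) \<le> ln (real n)" "ln (real n) \<le> ln (exp (v + \<rho>))"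
          by (subst ln_le_cancel_iff; simp)+
        then have "v - \<rho> \<le> ln (real n)" "ln (real n) \<le> v + \<rho>" by simp_all
        then show "n \<in> window \<rho> v" using \<open>n \<ge> 1\<close> by (auto simp: window_def abs_le_iff)
      qed
      have pq: "p \<le> Suc q"
      proof -
        have "exp (v - \<rho>) \<le> exp (v + \<rho>)" using \<rho> by simp
        then have "real p < real q + 2" using pb qb by linarith
        then show ?thesis by linarith
      qed
      have an: "-\<rho> \<le> a n" "a n \<le> \<rho>" if "n \<in> {p..q}" for n
        using that unfolding win[symmetric] by (auto simp: window_def a_def abs_le_iff)
      have step: "\<bar>f (a n) / real n - (F (a (Suc n)) - F (a n))\<bar> \<le> 4 * e * (a (Suc n) - a n)" if n: "n \<in> {p..q}" for n
      proof -
        have n1: "n \<ge> 1" "real n \<ge> B" using n p1 pB by auto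
        have n0: "real n > 0" using n1 by simp
        note lb = ln_Suc_diff_bounds[OF n1(1)]
        define h where "h = a (Suc n) - a n"
        have h: "h \<le> 1 / real n" "h \<ge> 1 / real n - 1 / (real n)\<^sup>2" "h > 0" using lb by (auto simp: h_def a_def)
        have n2: "1 / real n \<le> 1/2" using n1 B2 by (simp add: field_simps)
        have "1 / real n < d"
        proof -
          have "2 / d \<le> real n" using n1 B2 by linarith
          then have "2 / real n \<le> d" using d(1) n0 by (simp add: field_simps)
          then show ?thesis using d(1) n0 by (simp add: field_simps)
        qed
        then have hd: "h < d" using h by linarith
        have a3: "-3 < a n" "a n \<le> a (Suc n)" "a (Suc n) < 3" using an[OF n] \<rho> h n2 by (auto simp: h_def)
        obtain \<xi> where \<xi>: "a n \<le> \<xi>" "\<xi> \<le> a (Suc n)" "F (a (Suc n)) - F (a n) = f \<xi> * h"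
          using mvt[OF a3] by (auto simp: h_def)
        have "\<bar>f (a n) - f \<xi>\<bar> < e" by (rule d(2)) (use \<xi> a3 hd in \<open>auto simp: h_def\<close>)
        then have 1: "\<bar>(f (a n) - f \<xi>) * h\<bar> \<le> e * h" using h by (simp add: abs_mult)
        have "\<bar>1 / real n - h\<bar> \<le> 1 / (real n)\<^sup>2" using h by simp
        then have "\<bar>f (a n) * (1 / real n - h)\<bar> \<le> K * (1 / (real n)\<^sup>2)"
          unfolding abs_mult using K[of "a n"] a3 K0 by (intro mult_mono) auto
        also have "\<dots> = (K / real n) * (1 / real n)" by (simp add: power2_eq_square)
        also have "\<dots> \<le> e * (2 * h)"
        proof (rule mult_mono)
          have "(K + 1) / e \<le> real n" using n1 B2 by linarith
          then have "K + 1 \<le> e * real n" using e by (simp add: field_simps)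
          then show "K / real n \<le> e" using n0 by (simp add: field_simps)
          have "1 / (real n)\<^sup>2 = (1 / real n) * (1 / real n)" by (simp add: power2_eq_square)
          also have "\<dots> \<le> (1 / real n) * (1/2)" using n2 n0 by (intro mult_left_mono) auto
          finally have s: "1 / (real n)\<^sup>2 \<le> (1 / real n) * (1/2)" .
          have "u \<le> 2 * h" if "u - s \<le> h" "s \<le> u * (1/2)" for u s :: real using that by linarith
          from this[OF h(2) s] show "1 / real n \<le> 2 * h" .
        qed (use e n0 in auto)
        finally have 2: "\<bar>f (a n) * (1 / real n - h)\<bar> \<le> e * (2 * h)" .
        have "f (a n) / real n - (F (a (Suc n)) - F (a n)) = (f (a n) - f \<xi>) * h + f (a n) * (1 / real n - h)"
          unfolding \<xi>(3) by (simp add: algebra_simps)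
        then have "\<bar>f (a n) / real n - (F (a (Suc n)) - F (a n))\<bar> \<le> e * h + e * (2 * h)"
          using 1 2 by linarith
        also have "\<dots> \<le> 4 * e * h" using e h by (simp add: algebra_simps)
        finally show ?thesis by (simp add: h_def)
      qed
      have tel: "(\<Sum>n\<in>{p..q}. g (Suc n) - g n) = g (Suc q) - g p" for g :: "nat \<Rightarrow> real"
        using pq sum_Suc_diff'[of p "Suc q" g] by (simp add: atLeastLessThanSuc_atLeastAtMost)
      have aq: "\<rho> \<le> a (Suc q)" "a (Suc q) \<le> \<rho> + exp (- (v - \<rho>))"
      proof -
        have "v + \<rho> = ln (exp (v + \<rho>))" by simp
        also have "\<dots> \<le> ln (real (Suc q))" using qb by (subst ln_le_cancel_iff) auto
        finally show "\<rho> \<le> a (Suc q)" by (simp add: a_def)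
        have "ln (real (Suc q)) \<le> ln (exp (v + \<rho>) * (1 + exp (- (v + \<rho>))))"
          using qb by (subst ln_le_cancel_iff) (auto simp: distrib_left exp_add[symmetric] add_pos_pos)
        also have "\<dots> = (v + \<rho>) + ln (1 + exp (- (v + \<rho>)))" by (subst ln_mult_pos) (auto simp: add_pos_pos)
        also have "\<dots> \<le> (v + \<rho>) + exp (- (v + \<rho>))" by (intro add_left_mono ln_add_one_self_le_self) auto
        also have "\<dots> \<le> (v + \<rho>) + exp (- (v - \<rho>))" using \<rho> by simp
        finally show "a (Suc q) \<le> \<rho> + exp (- (v - \<rho>))" by (simp add: a_def)
      qed
      have ap: "-\<rho> \<le> a p" "a p \<le> -\<rho> + exp (- (v - \<rho>))"
      proof -
        have "v - \<rho> = ln (exp (v - \<rho>))" by simp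
        also have "\<dots> \<le> ln (real p)" using pb p1 by (subst ln_le_cancel_iff) auto
        finally show "-\<rho> \<le> a p" by (simp add: a_def)
        have "ln (real p) \<le> ln (exp (v - \<rho>) * (1 + exp (- (v - \<rho>))))"
          using pb p1 by (subst ln_le_cancel_iff) (auto simp: distrib_left exp_add[symmetric] add_pos_pos)
        also have "\<dots> = (v - \<rho>) + ln (1 + exp (- (v - \<rho>)))" by (subst ln_mult_pos) (auto simp: add_pos_pos)
        also have "\<dots> \<le> (v - \<rho>) + exp (- (v - \<rho>))" by (intro add_left_mono ln_add_one_self_le_self) auto
        finally show "a p \<le> -\<rho> + exp (- (v - \<rho>))" by (simp add: a_def)
      qed
      define s where "s = exp (- (v - \<rho>))"
      have s_eq: "s = 1 / exp (v - \<rho>)" unfolding s_def exp_minus by (simp only: inverse_eq_divide)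
      have "s \<le> 1 / B" unfolding s_eq using Bv B2 by (intro divide_left_mono) auto
      moreover have "1 / B \<le> 1/2" using B2 by (intro divide_left_mono) auto
      ultimately have s1: "s \<le> 1/2" by linarith
      have sK: "K * s \<le> e"
      proof -
        have "(K + 1) / e \<le> exp (v - \<rho>)" using B2 Bv by linarith
        then have "K + 1 \<le> e * exp (v - \<rho>)" using e by (simp add: field_simps)
        then have "K / exp (v - \<rho>) \<le> e" by (simp add: field_simps)
        then show ?thesis unfolding s_eq by simp
      qed
      have e1: "\<bar>F (a (Suc q)) - F \<rho>\<bar> \<le> e"
      proof -
        have "\<bar>F (a (Suc q)) - F \<rho>\<bar> \<le> K * (a (Suc q) - \<rho>)" by (rule Flip) (use aq \<rho> s1 in \<open>auto simp: s_def\<close>)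
        also have "\<dots> \<le> K * s" using aq K0 by (intro mult_left_mono) (auto simp: s_def)
        finally show ?thesis using sK by linarith
      qed
      have e2: "\<bar>F (a p) - F (-\<rho>)\<bar> \<le> e"
      proof -
        have "\<bar>F (a p) - F (-\<rho>)\<bar> \<le> K * (a p - (-\<rho>))" by (rule Flip) (use ap \<rho> s1 in \<open>auto simp: s_def\<close>)
        also have "\<dots> \<le> K * s" using ap K0 by (intro mult_left_mono) (auto simp: s_def)
        finally show ?thesis using sK by linarith
      qed
      have "\<bar>(\<Sum>n\<in>{p..q}. f (a n) / real n) - (\<Sum>n\<in>{p..q}. F (a (Suc n)) - F (a n))\<bar> \<le> (\<Sum>n\<in>{p..q}. 4 * e * (a (Suc n) - a n))"
        unfolding sum_subtractf[symmetric] by (rule order_trans[OF sum_abs sum_mono]) (rule step)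
      also have "\<dots> = 4 * e * (a (Suc q) - a p)" unfolding sum_distrib_left[symmetric] tel ..
      also have "\<dots> \<le> 4 * e * 3" using aq ap \<rho> s1 e by (intro mult_left_mono) (auto simp: s_def)
      finally have e3: "\<bar>(\<Sum>n\<in>{p..q}. f (a n) / real n) - (F (a (Suc q)) - F (a p))\<bar> \<le> 12 * e" unfolding tel[of "\<lambda>n. F (a n)"] by simp
      have "\<bar>(\<Sum>n\<in>{p..q}. f (a n) / real n) - (F \<rho> - F (-\<rho>))\<bar> \<le> 14 * e" using e1 e2 e3 by linarith
      then show ?case unfolding win int dist_real_def a_def using \<epsilon> by (simp add: e_def)
    qed
  qed
qed

lemma fejer_integral_ge_1:
  assumes T: "T > 0" "1 / T \<le> \<rho>" shows "integral {-\<rho>..\<rho>} (fejer T) \<ge> 1"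
proof -
  have io: "fejer T integrable_on {c..d}" for c d
    by (intro integrable_continuous_interval continuous_on_subset[OF continuous_on_fejer[OF T(1)]]) auto
  have "1 = integral {-(1/T)..1/T} (\<lambda>_. T / 2)" using T by simp
  also have "\<dots> \<le> integral {-(1/T)..1/T} (fejer T)"
    by (intro integral_le io integrable_const_ivl fejer_ge_half T) auto
  also have "\<dots> \<le> integral {-\<rho>..\<rho>} (fejer T)"
    by (intro integral_subset_le io) (use T fejer_nonneg in auto)
  finally show ?thesis .
qed

text \<open>\<open>k\<close> is \<open>fejer T\<close>, \<kappa> its integral over
  [-\<rho>, \<rho>]; since \<kappa> \<ge> 1, absolute errors \<eta> are also relative ones. For the
  plain prime sum, \<Lambda> - 1 is small on average and the constant 1 yields the Riemann sum for
  \<kappa>; if \<open>mean = 0\<close>, then \<Lambda> \<psi> is itself small on average.\<close>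

theorem (in dchar) prime_window:
  assumes \<rho>: "0 < \<rho>" "\<rho> \<le> 1" and \<eta>: "\<eta> > 0"
  shows "\<exists>k \<kappa> M. \<kappa> > 0 \<and> M > 0 \<and> (\<forall>x::real. 0 \<le> k x \<and> k x \<le> M) \<and>
    (\<forall>\<^sub>F v in at_top. \<bar>(\<Sum>p | p \<in> window \<rho> v \<and> prime p. k (ln (real p) - v) * (ln (real p) / real p)) - \<kappa>\<bar> \<le> \<eta> * \<kappa> \<and>
      (mean = 0 \<longrightarrow> norm (\<Sum>p | p \<in> window \<rho> v \<and> prime p. of_real (k (ln (real p) - v) * (ln (real p) / real p)) * \<psi> p) \<le> \<eta> * \<kappa>))"
proof -
  obtain C where C: "C > 0" and small0: "\<forall>b G T \<rho> \<epsilon>. (\<forall>n. norm (b n) \<le> mangoldt n + 1) \<longrightarrow> continuous_on {s. Re s \<ge> 1} G \<longrightarrow>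
     (\<forall>s. Re s > 1 \<longrightarrow> (\<lambda>n. b n * of_nat n powr (-s)) sums G s) \<longrightarrow> T > 0 \<longrightarrow> 0 < \<rho> \<longrightarrow> \<rho> \<le> 1 \<longrightarrow> \<epsilon> > 0 \<longrightarrow>
     (\<forall>\<^sub>F v in at_top. norm (\<Sum>n\<in>window \<rho> v. b n / of_nat n * of_real (fejer T (v - ln (real n)))) \<le> C / (T * \<rho>\<^sup>2) + \<epsilon>)"
    using fejer_window_small by (elim exE conjE) (rule that)
  note small = small0[rule_format (no_asm)]
  \<comment> \<open>The first entry makes the mass of the kernel in the window at least 1, the
    second makes the tail C/(T \<rho>^2) at most \<eta>/4.\<close>
  define T where "T = max (1 / \<rho>) (4 * C / (\<eta> * \<rho>\<^sup>2))"
  have T: "T > 0" using \<rho> by (simp add: T_def less_max_iff_disj)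
  have T1: "1 / T \<le> \<rho>"
  proof -
    have "1 / \<rho> \<le> T" by (simp add: T_def)
    then show ?thesis using \<rho> T by (simp add: field_simps)
  qed
  have TC: "C / (T * \<rho>\<^sup>2) \<le> \<eta> / 4"
  proof -
    have "4 * C / (\<eta> * \<rho>\<^sup>2) \<le> T" by (simp add: T_def)
    then show ?thesis using \<rho> T \<eta> by (simp add: field_simps)
  qed
  define \<kappa> where "\<kappa> = integral {-\<rho>..\<rho>} (fejer T)"
  have k1: "\<kappa> \<ge> 1" unfolding \<kappa>_def by (rule fejer_integral_ge_1[OF T T1])
  let ?k = "\<lambda>n v. fejer T (ln (real n) - v)"
  have kk: "fejer T (v - ln (real n)) = ?k n v" for n v
    using fejer_even[of T "ln (real n) - v"] by simp
  have W: "(\<Sum>n\<in>window \<rho> v. h n) = (\<Sum>n | n \<in> window \<rho> v \<and> prime n. h n) + (\<Sum>n\<in>window \<rho> v. if prime n then 0 else h n)"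
    for h :: "nat \<Rightarrow> complex" and v
  proof -
    have "(\<Sum>n | n \<in> window \<rho> v \<and> prime n. h n) = (\<Sum>n\<in>window \<rho> v. if prime n then h n else 0)"
      using sum.inter_filter[OF finite_window] by simp
    then show ?thesis by (simp only: sum.distrib[symmetric]) (intro sum.cong, auto)
  qed
  have mp: "(mangoldt p :: complex) = of_real (ln (real p))" if "prime p" for p
    using that by simp
  have np: "\<forall>\<^sub>F v in at_top. (\<Sum>n\<in>window \<rho> v. if prime n then 0 else mangoldt n / real n) \<le> \<eta> / (4 * T)"
    by (rule window_tail_small[OF summable_mangoldt_nonprime]) (use \<eta> T in \<open>auto simp: mangoldt_nonneg\<close>)
  have npb: "norm (\<Sum>n\<in>window \<rho> v. if prime n then 0 else u n * mangoldt n / of_nat n * of_real (?k n v)) \<le> \<eta> / 4"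
    if u: "\<And>n. norm (u n) \<le> 1" and v: "(\<Sum>n\<in>window \<rho> v. if prime n then 0 else mangoldt n / real n) \<le> \<eta> / (4 * T)" for u :: "nat \<Rightarrow> complex" and v
  proof -
    have "norm (\<Sum>n\<in>window \<rho> v. if prime n then 0 else u n * mangoldt n / of_nat n * of_real (?k n v))
       \<le> (\<Sum>n\<in>window \<rho> v. (if prime n then 0 else mangoldt n / real n) * T)"
    proof (rule sum_norm_le)
      fix n
      have "norm (u n) * (mangoldt n / real n) * fejer T (ln (real n) - v) \<le> 1 * (mangoldt n / real n) * T"
        by (intro mult_mono u order_refl fejer_le T fejer_nonneg) (auto simp: mangoldt_nonneg)
      then show "norm (if prime n then 0 else u n * mangoldt n / of_nat n * of_real (?k n v)) \<le> (if prime n then 0 else mangoldt n / real n) * T"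
        using fejer_nonneg[OF T, of "ln (real n) - v"] by (simp add: norm_mult norm_divide)
    qed
    also have "\<dots> = (\<Sum>n\<in>window \<rho> v. if prime n then 0 else mangoldt n / real n) * T" by (rule sum_distrib_right[symmetric])
    also have "\<dots> \<le> \<eta> / (4 * T) * T" using v T by (intro mult_right_mono) auto
    finally show ?thesis using T by simp
  qed
  obtain G where G: "continuous_on {s. Re s \<ge> 1} G" "\<forall>s. Re s > 1 \<longrightarrow> (\<lambda>n. (mangoldt n - 1) * of_nat n powr (-s)) sums G s"
    using zeta_log_deriv_continuous by blast
  have ev1: "\<forall>\<^sub>F v in at_top. norm (\<Sum>n\<in>window \<rho> v. (mangoldt n - 1) / of_nat n * of_real (fejer T (v - ln (real n))) :: complex) \<le> C / (T * \<rho>\<^sup>2) + \<eta> / 4"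
    by (rule small[OF _ G T \<rho>]) (use \<eta> norm_triangle_ineq4[of "mangoldt _ :: complex" 1] in auto)
  have ev2: "\<forall>\<^sub>F v in at_top. dist (\<Sum>n\<in>window \<rho> v. ?k n v / real n) \<kappa> < \<eta> / 4"
    unfolding \<kappa>_def by (rule tendstoD[OF window_riemann_sum[OF continuous_on_fejer[OF T] \<rho>]]) (use \<eta> in simp)
  have part1: "\<forall>\<^sub>F v in at_top. \<bar>(\<Sum>p | p \<in> window \<rho> v \<and> prime p. ?k p v * (ln (real p) / real p)) - \<kappa>\<bar> \<le> \<eta> * \<kappa>"
    using ev1 ev2 np
  proof eventually_elim
    case (elim v)
    let ?P = "\<Sum>p | p \<in> window \<rho> v \<and> prime p. ?k p v * (ln (real p) / real p)"
    let ?N = "\<Sum>n\<in>window \<rho> v. if prime n then 0 else 1 * mangoldt n / of_nat n * of_real (?k n v) :: complex"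
    let ?S = "\<Sum>n\<in>window \<rho> v. ?k n v / real n"
    have eqA: "(\<Sum>n\<in>window \<rho> v. mangoldt n / of_nat n * of_real (?k n v)) = complex_of_real ?P + ?N"
      by (subst W, unfold of_real_sum, intro arg_cong2[where f = "(+)"] sum.cong refl) (auto simp: mp mult.commute)
    have eqB: "(\<Sum>n\<in>window \<rho> v. (mangoldt n - 1) / of_nat n * complex_of_real (fejer T (v - ln (real n)))) =
      (\<Sum>n\<in>window \<rho> v. mangoldt n / of_nat n * of_real (?k n v)) - of_real ?S"
      unfolding kk of_real_sum sum_subtractf[symmetric] by (intro sum.cong) (auto simp: diff_divide_distrib left_diff_distrib)
    have n1: "norm (of_real ?P + ?N - of_real ?S) \<le> \<eta> / 4 + \<eta> / 4" using elim(1) TC unfolding eqB eqA by linarith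
    have n2: "norm ?N \<le> \<eta> / 4" by (rule npb) (use elim in auto)
    have eqC: "complex_of_real (?P - ?S) = (of_real ?P + ?N - of_real ?S) - ?N"
    proof -
      have "a - b = (a + c - b) - c" for a b c :: complex by simp
      then show ?thesis unfolding of_real_diff .
    qed
    have "norm (complex_of_real (?P - ?S)) \<le> norm (of_real ?P + ?N - of_real ?S) + norm ?N"
      unfolding eqC by (rule norm_triangle_ineq4)
    then have "\<bar>?P - ?S\<bar> \<le> norm (of_real ?P + ?N - of_real ?S) + norm ?N" unfolding norm_of_real .
    then have "\<bar>?P - ?S\<bar> \<le> 3 * (\<eta> / 4)" using n1 n2 by linarith
    moreover have "\<bar>?S - \<kappa>\<bar> \<le> \<eta> / 4" using elim(2) by (simp add: dist_real_def)
    ultimately have "\<bar>?P - \<kappa>\<bar> \<le> \<eta>" by linarith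
    also have "\<eta> \<le> \<eta> * \<kappa>" using k1 \<eta> by simp
    finally show ?case .
  qed
  have part2: "\<forall>\<^sub>F v in at_top. mean = 0 \<longrightarrow> norm (\<Sum>p | p \<in> window \<rho> v \<and> prime p. of_real (?k p v * (ln (real p) / real p)) * \<psi> p) \<le> \<eta> * \<kappa>"
  proof (cases "mean = 0")
    case True
    obtain H where H: "continuous_on {s. Re s \<ge> 1} H" "\<forall>s. Re s > 1 \<longrightarrow> (\<lambda>n. (mangoldt n * \<psi> n) * of_nat n powr (-s)) sums H s"
      using nontrivial_log_deriv_continuous[OF True] by auto
    have "norm (mangoldt n * \<psi> n) \<le> mangoldt n + 1" for n
      using mult_left_mono[OF norm_le1[of n], of "mangoldt n"] by (simp add: norm_mult mangoldt_nonneg)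
    then have ev3: "\<forall>\<^sub>F v in at_top. norm (\<Sum>n\<in>window \<rho> v. (mangoldt n * \<psi> n) / of_nat n * of_real (fejer T (v - ln (real n)))) \<le> C / (T * \<rho>\<^sup>2) + \<eta> / 4"
      by (intro small[OF _ H T \<rho>]) (use \<eta> in auto)
    show ?thesis using ev3 np
    proof eventually_elim
      case (elim v)
      let ?P = "\<Sum>p | p \<in> window \<rho> v \<and> prime p. of_real (?k p v * (ln (real p) / real p)) * \<psi> p"
      let ?N = "\<Sum>n\<in>window \<rho> v. if prime n then 0 else \<psi> n * mangoldt n / of_nat n * of_real (?k n v) :: complex"
      have eqA: "(\<Sum>n\<in>window \<rho> v. (mangoldt n * \<psi> n) / of_nat n * of_real (fejer T (v - ln (real n)))) = ?P + ?N"
        unfolding kk by (subst W, intro arg_cong2[where f = "(+)"] sum.cong refl) (auto simp: mp mult_ac)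
      have "norm (?P + ?N) \<le> \<eta> / 4 + \<eta> / 4" using elim(1) TC unfolding eqA by linarith
      moreover have "norm ?N \<le> \<eta> / 4" by (rule npb) (use elim norm_le1 in auto)
      moreover have "norm ?P \<le> norm (?P + ?N) + norm ?N"
        using norm_triangle_ineq4[of "?P + ?N" ?N] by (simp only: add_diff_cancel_right')
      ultimately have "norm ?P \<le> \<eta>" using \<eta> by linarith
      also have "\<eta> \<le> \<eta> * \<kappa>" using k1 \<eta> by simp
      finally show ?case by simp
    qed
  qed simp
  show ?thesis
    by (rule exI[of _ "fejer T"], rule exI[of _ \<kappa>], rule exI[of _ T],
        intro conjI allI T fejer_nonneg[OF T] fejer_le[OF T] eventually_conj[OF part1 part2]) (use k1 in simp)
qed

section \<open>Means along the number of prime factors\<close>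

lemma card_multiples:
  assumes "d > 0" shows "card {n \<in> {1..N}. d dvd n} = N div d"
proof -
  have "{n \<in> {1..N}. d dvd n} = (\<lambda>m. d * m) ` {1..N div d}"
  proof (intro equalityI subsetI)
    fix n assume "n \<in> {n \<in> {1..N}. d dvd n}"
    then obtain m where m: "n = d * m" "1 \<le> n" "n \<le> N" by auto
    then have "m \<le> N div d" using assms by (metis div_le_mono nonzero_mult_div_cancel_left less_not_refl2)
    moreover have "m \<ge> 1" using m by (cases m) auto
    ultimately show "n \<in> (\<lambda>m. d * m) ` {1..N div d}" using m by auto
  next
    fix n assume "n \<in> (\<lambda>m. d * m) ` {1..N div d}"
    then obtain m where "m \<in> {1..N div d}" and "n = d * m" by blast
    then have m: "n = d * m" "1 \<le> m" "m \<le> N div d" by simp_all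
    have "d * m \<le> d * (N div d)" using m by simp
    also have "\<dots> \<le> N" by simp
    finally show "n \<in> {n \<in> {1..N}. d dvd n}" using m assms by auto
  qed
  moreover have "inj_on (\<lambda>m. d * m) {1..N div d}" using assms by (auto intro: inj_onI)
  ultimately show ?thesis by (simp add: card_image)
qed

lemma sum_multiples:
  fixes c :: "nat \<Rightarrow> 'a :: comm_monoid_add"
  assumes "d > 0" shows "(\<Sum>n\<in>{n \<in> {1..N}. d dvd n}. c n) = (\<Sum>m=1..N div d. c (d * m))"
proof (rule sum.reindex_bij_witness[where i = "\<lambda>m. d * m" and j = "\<lambda>n. n div d"])
  fix n assume n: "n \<in> {n \<in> {1..N}. d dvd n}"
  then show "n div d \<in> {1..N div d}" using assms by (auto simp: div_le_mono Suc_le_eq div_greater_zero_iff dvd_imp_le)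
next
  fix m assume m: "m \<in> {1..N div d}"
  have "d * m \<le> d * (N div d)" using m by simp
  also have "\<dots> \<le> N" by simp
  finally show "d * m \<in> {n \<in> {1..N}. d dvd n}" using m assms by auto
qed (use assms in auto)

text \<open>Expand the square. Rounding down only decreases the second moment, whose mixed terms
  factor because distinct primes are coprime; in the first moment it loses at most the sum of the
  w(p), and that moment enters with factor -2A.\<close>

lemma turan_kubilius_variance:
  fixes w :: "nat \<Rightarrow> real"
  assumes P: "finite P" "\<And>p. p \<in> P \<Longrightarrow> prime p" and w: "\<And>p. p \<in> P \<Longrightarrow> w p \<ge> 0"
  defines "A \<equiv> \<Sum>p\<in>P. w p / real p"
  shows "(\<Sum>n=1..N. ((\<Sum>p\<in>P. if p dvd n then w p else 0) - A)\<^sup>2) \<le> real N * (\<Sum>p\<in>P. (w p)\<^sup>2 / real p) + 2 * A * (\<Sum>p\<in>P. w p)"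
proof -
  have p0: "p > 0" if "p \<in> P" for p using P(2)[OF that] prime_gt_0_nat by blast
  have A0: "A \<ge> 0" unfolding A_def by (intro sum_nonneg divide_nonneg_nonneg w) auto
  define g where "g p n = (if p dvd n then w p else 0)" for p n :: nat
  have cnt: "(\<Sum>n=1..N. if d dvd n then c else 0) = c * real (N div d)" if "d > 0" for d and c :: real
  proof -
    have "(\<Sum>n=1..N. if d dvd n then c else 0) = (\<Sum>n\<in>{n \<in> {1..N}. d dvd n}. c)"
      by (simp only: sum.inter_filter[OF finite_atLeastAtMost])
    then show ?thesis using card_multiples[OF that, of N] by simp
  qed
  have rdiv: "real (N div d) \<le> real N / real d" for d by (rule of_nat_div_le_of_nat)
  have square: "(\<Sum>n=1..N. (\<Sum>p\<in>P. g p n)\<^sup>2) \<le> real N * (\<Sum>p\<in>P. (w p)\<^sup>2 / real p) + real N * A\<^sup>2"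
  proof -
    have "(\<Sum>n=1..N. (\<Sum>p\<in>P. g p n)\<^sup>2) = (\<Sum>n=1..N. \<Sum>p\<in>P. \<Sum>r\<in>P. g p n * g r n)"
      by (simp add: power2_eq_square sum_product)
    also have "\<dots> = (\<Sum>p\<in>P. \<Sum>r\<in>P. \<Sum>n=1..N. g p n * g r n)"
      by (subst sum.swap) (intro sum.cong refl sum.swap)
    also have "\<dots> \<le> (\<Sum>p\<in>P. \<Sum>r\<in>P. (if r = p then real N * ((w p)\<^sup>2 / real p) else 0) + real N * (w p / real p * (w r / real r)))"
    proof (intro sum_mono)
      fix p r assume pr: "p \<in> P" "r \<in> P"
      have nn: "0 \<le> w p / real p * (w r / real r)" using pr w by (intro mult_nonneg_nonneg divide_nonneg_nonneg) auto
      show "(\<Sum>n=1..N. g p n * g r n) \<le> (if r = p then real N * ((w p)\<^sup>2 / real p) else 0) + real N * (w p / real p * (w r / real r))"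
      proof (cases "r = p")
        case True
        have "(\<Sum>n=1..N. g p n * g r n) = (\<Sum>n=1..N. if p dvd n then (w p)\<^sup>2 else 0)"
          using True by (intro sum.cong) (auto simp: g_def power2_eq_square)
        also have "\<dots> = (w p)\<^sup>2 * real (N div p)" by (rule cnt[OF p0[OF pr(1)]])
        also have "\<dots> \<le> (w p)\<^sup>2 * (real N / real p)" by (intro mult_left_mono rdiv) auto
        finally show ?thesis using True nn by (simp add: mult.commute add_increasing2)
      next
        case False
        have "p * r dvd n \<longleftrightarrow> p dvd n \<and> r dvd n" for n
          using primes_coprime[OF P(2)[OF pr(1)] P(2)[OF pr(2)]] False
          by (metis divides_mult dvd_mult_left dvd_mult_right)
        then have "(\<Sum>n=1..N. g p n * g r n) = (\<Sum>n=1..N. if p * r dvd n then w p * w r else 0)"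
          by (intro sum.cong) (auto simp: g_def)
        also have "\<dots> = w p * w r * real (N div (p * r))" by (rule cnt) (use p0 pr in auto)
        also have "\<dots> \<le> w p * w r * (real N / real (p * r))" using w pr by (intro mult_left_mono rdiv) auto
        finally show ?thesis using False by (simp add: mult_ac)
      qed
    qed
    also have "\<dots> = real N * (\<Sum>p\<in>P. (w p)\<^sup>2 / real p) + real N * A\<^sup>2"
    proof -
      have d: "(\<Sum>r\<in>P. if r = p then c else 0) = c" if "p \<in> P" for p and c :: real
        using that P(1) by simp
      have A2: "A\<^sup>2 = (\<Sum>p\<in>P. \<Sum>r\<in>P. w p / real p * (w r / real r))"
        unfolding A_def power2_eq_square by (rule sum_product)
      show ?thesis unfolding sum.distrib A2 by (simp add: sum_distrib_left d)
    qed
    finally show ?thesis .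
  qed
  have lin: "(\<Sum>n=1..N. \<Sum>p\<in>P. g p n) \<ge> real N * A - (\<Sum>p\<in>P. w p)"
  proof -
    have "(\<Sum>n=1..N. \<Sum>p\<in>P. g p n) = (\<Sum>p\<in>P. \<Sum>n=1..N. g p n)" by (rule sum.swap)
    also have "\<dots> = (\<Sum>p\<in>P. w p * real (N div p))"
      unfolding g_def by (intro sum.cong refl cnt p0)
    also have "\<dots> \<ge> (\<Sum>p\<in>P. w p * (real N / real p - 1))"
    proof (intro sum_mono mult_left_mono w)
      fix p assume "p \<in> P"
      then have "p > 0" by (rule p0)
      have "N \<le> p + N div p * p" using dividend_less_div_times[OF \<open>p > 0\<close>, of N] by simp
      then have "real N \<le> real (p + N div p * p)" by (simp only: of_nat_le_iff)
      then have "real N / real p \<le> real (N div p) + 1"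
        using \<open>p > 0\<close> by (simp add: pos_divide_le_eq algebra_simps)
      then show "real N / real p - 1 \<le> real (N div p)" by simp
    qed
    also have "(\<Sum>p\<in>P. w p * (real N / real p - 1)) = real N * A - (\<Sum>p\<in>P. w p)"
      by (simp add: A_def right_diff_distrib sum_subtractf sum_distrib_left mult.commute)
    finally show ?thesis .
  qed
  have "(\<Sum>n=1..N. ((\<Sum>p\<in>P. g p n) - A)\<^sup>2) = (\<Sum>n=1..N. (\<Sum>p\<in>P. g p n)\<^sup>2) - 2 * A * (\<Sum>n=1..N. \<Sum>p\<in>P. g p n) + real N * A\<^sup>2"
    by (simp add: power2_diff sum.distrib sum_subtractf sum_distrib_left[symmetric] sum_distrib_right[symmetric] mult_ac)
  also have "\<dots> \<le> (real N * (\<Sum>p\<in>P. (w p)\<^sup>2 / real p) + real N * A\<^sup>2) - 2 * A * (real N * A - (\<Sum>p\<in>P. w p)) + real N * A\<^sup>2"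
    by (intro add_mono diff_mono square mult_left_mono lin) (use A0 in auto)
  also have "\<dots> = real N * (\<Sum>p\<in>P. (w p)\<^sup>2 / real p) + 2 * A * (\<Sum>p\<in>P. w p)"
    by (simp add: algebra_simps power2_eq_square)
  finally show ?thesis unfolding g_def .
qed

text \<open>Cauchy-Schwarz against the variance replaces the constant \<open>A\<close> by the
  weighted divisor sum, and exchanging summations collects the n as multiples p m.\<close>

lemma turan_kubilius:
  fixes w :: "nat \<Rightarrow> real" and c :: "nat \<Rightarrow> complex"
  assumes P: "finite P" "\<And>p. p \<in> P \<Longrightarrow> prime p" and w: "\<And>p. p \<in> P \<Longrightarrow> w p \<ge> 0" and c: "\<And>n. norm (c n) \<le> 1"
  defines "A \<equiv> \<Sum>p\<in>P. w p / real p"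
  shows "norm (of_real A * (\<Sum>n=1..N. c n) - (\<Sum>p\<in>P. of_real (w p) * (\<Sum>m=1..N div p. c (p * m))))
    \<le> sqrt (real N * (real N * (\<Sum>p\<in>P. (w p)\<^sup>2 / real p) + 2 * A * (\<Sum>p\<in>P. w p)))"
proof -
  define D where "D n = (\<Sum>p\<in>P. if p dvd n then w p else 0) - A" for n :: nat
  have p0: "p > 0" if "p \<in> P" for p using P(2)[OF that] prime_gt_0_nat by blast
  have "(\<Sum>n=1..N. c n * of_real (\<Sum>p\<in>P. if p dvd n then w p else 0)) = (\<Sum>n=1..N. \<Sum>p\<in>P. if p dvd n then of_real (w p) * c n else 0)"
    by (auto simp: sum_distrib_left intro!: sum.cong)
  also have "\<dots> = (\<Sum>p\<in>P. \<Sum>n=1..N. if p dvd n then of_real (w p) * c n else 0)" by (rule sum.swap)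
  also have "\<dots> = (\<Sum>p\<in>P. of_real (w p) * (\<Sum>m=1..N div p. c (p * m)))"
  proof (rule sum.cong[OF refl])
    fix p assume "p \<in> P"
    have "(\<Sum>n=1..N. if p dvd n then of_real (w p) * c n else 0) = (\<Sum>n\<in>{n \<in> {1..N}. p dvd n}. of_real (w p) * c n)"
      by (simp only: sum.inter_filter[OF finite_atLeastAtMost])
    also have "\<dots> = (\<Sum>m=1..N div p. of_real (w p) * c (p * m))" by (rule sum_multiples[OF p0[OF \<open>p \<in> P\<close>]])
    finally show "(\<Sum>n=1..N. if p dvd n then of_real (w p) * c n else 0) = of_real (w p) * (\<Sum>m=1..N div p. c (p * m))"
      by (simp add: sum_distrib_left)
  qed
  finally have 1: "(\<Sum>n=1..N. c n * of_real (\<Sum>p\<in>P. if p dvd n then w p else 0)) = (\<Sum>p\<in>P. of_real (w p) * (\<Sum>m=1..N div p. c (p * m)))" .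
  have "(\<Sum>n=1..N. c n * of_real (D n)) = (\<Sum>p\<in>P. of_real (w p) * (\<Sum>m=1..N div p. c (p * m))) - of_real A * (\<Sum>n=1..N. c n)"
    unfolding D_def of_real_diff right_diff_distrib sum_subtractf 1 sum_distrib_right[symmetric]
    by (simp only: mult.commute[of "of_real A"])
  then have "norm (of_real A * (\<Sum>n=1..N. c n) - (\<Sum>p\<in>P. of_real (w p) * (\<Sum>m=1..N div p. c (p * m)))) = norm (\<Sum>n=1..N. c n * of_real (D n))"
    by (simp only:) (rule norm_minus_commute)
  also have "\<dots> \<le> (\<Sum>n=1..N. norm (c n) * \<bar>D n\<bar>)"
    by (rule order_trans[OF norm_sum]) (simp add: norm_mult)
  also have "\<dots> \<le> (\<Sum>n=1..N. 1 * \<bar>D n\<bar>)" by (intro sum_mono mult_right_mono c) auto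
  also have "\<dots> \<le> sqrt (real N * (\<Sum>n=1..N. (D n)\<^sup>2))"
  proof (rule real_le_rsqrt)
    have "(\<Sum>n=1..N. 1 * \<bar>D n\<bar>)\<^sup>2 \<le> (\<Sum>n=1..N. 1\<^sup>2) * (\<Sum>n=1..N. \<bar>D n\<bar>\<^sup>2)"
      by (rule Cauchy_Schwarz_ineq_sum)
    then show "(\<Sum>n=1..N. 1 * \<bar>D n\<bar>)\<^sup>2 \<le> real N * (\<Sum>n=1..N. (D n)\<^sup>2)"
      by (simp only: power2_abs power_one sum_constant card_atLeastAtMost diff_Suc_1 mult_1_right)
  qed
  also have "\<dots> \<le> sqrt (real N * (real N * (\<Sum>p\<in>P. (w p)\<^sup>2 / real p) + 2 * A * (\<Sum>p\<in>P. w p)))"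
    using turan_kubilius_variance[OF P w, where N = N] unfolding D_def A_def
    by (intro real_sqrt_le_mono mult_left_mono) auto
  finally show ?thesis .
qed

lemma prime_Omega_mult_prime: "prime p \<Longrightarrow> m > 0 \<Longrightarrow> prime_Omega (p * m) = Suc (prime_Omega m)"
  unfolding prime_Omega_def
  by (subst prime_factorization_mult) (auto simp: prime_factorization_prime prime_gt_0_nat)

section \<open>Logarithmic averages and their shifts\<close>

lemma log_weights_unbounded: "\<exists>N. \<forall>n\<ge>N. (\<Sum>j\<in>{J..<n}. 1 / real j) \<ge> B"
proof -
  have "\<forall>\<^sub>F n in sequentially. (harm n :: real) \<ge> B + harm J"
    using harm_at_top by (simp add: filterlim_at_top)
  then obtain N where N: "\<And>n. n \<ge> N \<Longrightarrow> (harm n :: real) \<ge> B + harm J" by (auto simp: eventually_sequentially)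
  have "(\<Sum>j\<in>{J..<n}. 1 / real j) \<ge> B" if "n \<ge> Suc N" for n
  proof -
    obtain m where m: "n = Suc m" "m \<ge> N" using \<open>n \<ge> Suc N\<close> by (cases n) auto
    have "(harm m :: real) \<le> (\<Sum>j\<in>{1..J} \<union> {J..<n}. 1 / real j)"
      unfolding harm_def by (subst divide_inverse) (auto intro!: sum_mono2 simp: m)
    also have "\<dots> \<le> (\<Sum>j\<in>{1..J}. 1 / real j) + (\<Sum>j\<in>{J..<n}. 1 / real j)"
      using sum.union_inter[of "{1..J}" "{J..<n}" "\<lambda>j. 1 / real j"] sum_nonneg[of "{1..J} \<inter> {J..<n}" "\<lambda>j. 1 / real j"] by simp
    also have "(\<Sum>j\<in>{1..J}. 1 / real j) = harm J" by (simp add: harm_def divide_inverse)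
    finally show ?thesis using N[OF m(2)] by linarith
  qed
  then show ?thesis by blast
qed

text \<open>Summation by parts: the two boundary terms and the total variation of 1/j contribute at
  most 1 each, whatever the length of the range, whereas the total weight is unbounded. This is the
  reason for the weights 1/j.\<close>

lemma log_average_shift_one:
  fixes h :: "nat \<Rightarrow> complex"
  assumes h: "\<And>n. norm (h n) \<le> 1" and J: "1 \<le> J1" "J1 \<le> J2"
  shows "norm (\<Sum>j\<in>{J1..<J2}. of_real (1 / real j) * (h (Suc j) - h j)) \<le> 3"
proof -
  have "(\<Sum>j\<in>{J1..<J2}. of_real (1 / real j) * (h (Suc j) - h j))
    = (\<Sum>j\<in>{J1..<J2}. (of_real (1 / real (Suc j)) * h (Suc j) - of_real (1 / real j) * h j) + of_real (1 / real j - 1 / real (Suc j)) * h (Suc j))"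
    by (intro sum.cong) (auto simp: algebra_simps)
  also have "\<dots> = (of_real (1 / real J2) * h J2 - of_real (1 / real J1) * h J1) + (\<Sum>j\<in>{J1..<J2}. of_real (1 / real j - 1 / real (Suc j)) * h (Suc j))"
    unfolding sum.distrib using sum_Suc_diff'[OF J(2), of "\<lambda>j. of_real (1 / real j) * h j"] by simp
  finally have eq: "(\<Sum>j\<in>{J1..<J2}. of_real (1 / real j) * (h (Suc j) - h j)) = \<dots>" .
  have n1: "norm (of_real (1 / real j) * h j) \<le> 1" if "j \<ge> 1" for j
    using h[of j] that by (simp add: norm_mult norm_divide divide_le_eq)
  have "norm (\<Sum>j\<in>{J1..<J2}. of_real (1 / real j - 1 / real (Suc j)) * h (Suc j)) \<le> (\<Sum>j\<in>{J1..<J2}. 1 / real j - 1 / real (Suc j))"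
  proof (rule sum_norm_le)
    fix j assume j: "j \<in> {J1..<J2}"
    have "1 / real (Suc j) \<le> 1 / real j" using j J by (intro divide_left_mono) auto
    then have "\<bar>1 / real j - 1 / real (Suc j)\<bar> * norm (h (Suc j)) \<le> (1 / real j - 1 / real (Suc j)) * 1"
      by (intro mult_mono h) auto
    then show "norm (of_real (1 / real j - 1 / real (Suc j)) * h (Suc j)) \<le> 1 / real j - 1 / real (Suc j)"
      unfolding norm_mult norm_of_real by simp
  qed
  also have "\<dots> = 1 / real J1 - 1 / real J2"
    using sum_Suc_diff'[OF J(2), of "\<lambda>j. - (1 / real j)"] by simp
  also have "\<dots> \<le> 1"
  proof -
    have "1 / real J1 \<le> 1" "1 / real J2 \<ge> 0" using J by auto
    then show ?thesis by linarith
  qed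
  finally have n2: "norm (\<Sum>j\<in>{J1..<J2}. of_real (1 / real j - 1 / real (Suc j)) * h (Suc j)) \<le> 1" .
  show ?thesis unfolding eq
    using n1[of J1] n1[of J2] n2 J norm_triangle_ineq4[of "of_real (1 / real J2) * h J2" "of_real (1 / real J1) * h J1"]
    by (intro order_trans[OF norm_triangle_ineq]) linarith
qed

lemma log_average_shift:
  fixes h :: "nat \<Rightarrow> complex"
  assumes h: "\<And>n. norm (h n) \<le> 1" and J: "1 \<le> J1" "J1 \<le> J2"
  shows "norm ((\<Sum>j\<in>{J1..<J2}. of_real (1 / real j) * h (j + r)) - (\<Sum>j\<in>{J1..<J2}. of_real (1 / real j) * h j)) \<le> 3 * real r"
proof (induction r)
  case (Suc r)
  let ?T = "\<lambda>r. \<Sum>j\<in>{J1..<J2}. of_real (1 / real j) * h (j + r)"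
  have "?T (Suc r) - ?T r = (\<Sum>j\<in>{J1..<J2}. of_real (1 / real j) * (h (Suc j + r) - h (j + r)))"
    unfolding right_diff_distrib sum_subtractf by simp
  then have "norm (?T (Suc r) - ?T r) \<le> 3" using log_average_shift_one[of "\<lambda>j. h (j + r)", OF h J] by simp
  moreover have "norm (?T (Suc r) - ?T 0) \<le> norm (?T (Suc r) - ?T r) + norm (?T r - ?T 0)"
    using norm_triangle_ineq[of "?T (Suc r) - ?T r" "?T r - ?T 0"] by simp
  ultimately show ?case using Suc by simp
qed simp

section \<open>Means of \<psi>(n) a(Omega(n)) at different scales\<close>

context dchar
begin

definition osum :: "(nat \<Rightarrow> complex) \<Rightarrow> nat \<Rightarrow> complex" where
  "osum a N = (\<Sum>n=1..N. \<psi> n * a (prime_Omega n))"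

text \<open>Normalised by x rather than by its integer part, so that the passage from x to x/p is
  exact.\<close>

definition omean :: "(nat \<Rightarrow> complex) \<Rightarrow> real \<Rightarrow> complex" where
  "omean a x = osum a (nat \<lfloor>x\<rfloor>) / of_real x"

lemma norm_summand: "(\<And>k. norm (a k) \<le> 1) \<Longrightarrow> norm (\<psi> n * a (prime_Omega n)) \<le> 1"
  unfolding norm_mult using norm_le1[of n] by (intro mult_le_one) auto

lemma norm_osum: assumes "\<And>k. norm (a k) \<le> 1" shows "norm (osum a N) \<le> real N"
proof -
  have "norm (osum a N) \<le> (\<Sum>n=1..N. 1)" unfolding osum_def by (intro sum_norm_le norm_summand assms)
  then show ?thesis by simp
qed

lemma norm_omean: assumes "\<And>k. norm (a k) \<le> 1" "x > 0" shows "norm (omean a x) \<le> 1"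
proof -
  have "norm (osum a (nat \<lfloor>x\<rfloor>)) \<le> x" using norm_osum[of a "nat \<lfloor>x\<rfloor>", OF assms(1)] assms(2) of_nat_floor[of x] by linarith
  then show ?thesis using assms(2) by (simp add: omean_def norm_divide)
qed

text \<open>Enlarging the scale by a factor at most e^\<rho> adds few terms; this permits replacing
  p by e^j for all primes of one window. The summand 1/y accounts for rounding.\<close>

lemma omean_lipschitz:
  assumes a: "\<And>k. norm (a k) \<le> 1" and y: "0 < y" "y \<le> z" "z \<le> y * exp \<rho>"
  shows "norm (omean a z - omean a y) \<le> 2 * \<rho> + 1 / y"
proof -
  let ?S = "\<lambda>x. osum a (nat \<lfloor>x\<rfloor>)"
  have z: "z > 0" using y by linarith
  have fl: "nat \<lfloor>y\<rfloor> \<le> nat \<lfloor>z\<rfloor>" using y by (intro nat_mono floor_mono) auto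
  have "?S z - ?S y = (\<Sum>n\<in>{nat \<lfloor>y\<rfloor><..nat \<lfloor>z\<rfloor>}. \<psi> n * a (prime_Omega n))"
  proof -
    have "{1..nat \<lfloor>z\<rfloor>} = {1..nat \<lfloor>y\<rfloor>} \<union> {nat \<lfloor>y\<rfloor><..nat \<lfloor>z\<rfloor>}" using fl by auto
    then have "?S z = ?S y + (\<Sum>n\<in>{nat \<lfloor>y\<rfloor><..nat \<lfloor>z\<rfloor>}. \<psi> n * a (prime_Omega n))"
      unfolding osum_def by (simp only:) (rule sum.union_disjoint, auto)
    then show ?thesis by simp
  qed
  then have "norm (?S z - ?S y) \<le> (\<Sum>n\<in>{nat \<lfloor>y\<rfloor><..nat \<lfloor>z\<rfloor>}. 1)"
    by (simp only:) (intro sum_norm_le norm_summand a)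
  also have "\<dots> = real (nat \<lfloor>z\<rfloor>) - real (nat \<lfloor>y\<rfloor>)" using fl by simp
  also have "\<dots> \<le> z - y + 1" using y z by linarith
  finally have d: "norm (?S z - ?S y) \<le> z - y + 1" .
  have "omean a z - omean a y = (?S z - ?S y) / of_real z - omean a y * of_real ((z - y) / z)"
    using y z by (simp add: omean_def field_simps)
  then have "norm (omean a z - omean a y) \<le> norm ((?S z - ?S y) / of_real z) + norm (omean a y * of_real ((z - y) / z))"
    by (metis norm_triangle_ineq4)
  also have "\<dots> \<le> (z - y + 1) / z + 1 * ((z - y) / z)"
  proof (intro add_mono)
    show "norm ((?S z - ?S y) / of_real z) \<le> (z - y + 1) / z" using d z by (simp add: norm_divide divide_right_mono)
    show "norm (omean a y * of_real ((z - y) / z)) \<le> 1 * ((z - y) / z)"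
      unfolding norm_mult norm_of_real by (intro mult_mono norm_omean a) (use y z in auto)
  qed
  also have "\<dots> = 2 * (1 - y / z) + 1 / z" using z by (simp add: field_simps)
  also have "\<dots> \<le> 2 * \<rho> + 1 / y"
  proof (intro add_mono mult_left_mono)
    have "exp (- \<rho>) \<le> y / z" using y z by (simp add: exp_minus field_simps)
    moreover have "1 - \<rho> \<le> exp (- \<rho>)" using exp_ge_add_one_self[of "-\<rho>"] by simp
    ultimately show "1 - y / z \<le> \<rho>" by linarith
    show "1 / z \<le> 1 / y" using y z by (intro divide_left_mono) auto
  qed auto
  finally show ?thesis .
qed

definition log_average :: "nat \<Rightarrow> nat \<Rightarrow> (real \<Rightarrow> complex) \<Rightarrow> real \<Rightarrow> complex" where
  "log_average J1 J2 g x = (\<Sum>j\<in>{J1..<J2}. of_real (1 / real j) * g (x * exp (- real j))) / of_real (\<Sum>j\<in>{J1..<J2}. 1 / real j)"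

text \<open>Turan-Kubilius and Omega(pm) = Omega(m) + 1 produce means of the shifted sequence at
  x/p, which are moved to x e^-j; the window sums of \<psi>(p) are then close to \<delta> \<kappa>.
  The ranges are quantified before \<open>a\<close>, so that they serve a sequence and its shifts
  alike.\<close>

lemma omean_log_average:
  fixes \<delta> :: real
  assumes \<epsilon>: "\<epsilon> > 0" and \<delta>: "(mean = 0 \<and> \<delta> = 0) \<or> ((\<forall>n. coprime n q \<longrightarrow> \<psi> n = 1) \<and> \<delta> = 1)"
  shows "\<exists>J0\<ge>1. \<forall>J1\<ge>J0. \<exists>N. \<forall>J2\<ge>N. \<forall>a. (\<forall>k. norm (a k) \<le> 1) \<longrightarrow>
    (\<forall>\<^sub>F x in at_top. norm (omean a x - of_real \<delta> * log_average J1 J2 (omean (a \<circ> Suc)) x) \<le> \<epsilon>)"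
proof -
  \<comment> \<open>At most 1/4, so that windows around different integers are disjoint and rounding
    log p recovers j. The second entries here and in \<eta> make 6 \<rho> and 2 \<eta> at most
    \<epsilon>/4.\<close>
  define \<rho> where "\<rho> = min (1/4) (\<epsilon> / 24)"
  define \<eta> where "\<eta> = min (1/2) (\<epsilon> / 8)"
  have \<rho>: "0 < \<rho>" "\<rho> \<le> 1" "\<rho> \<le> 1/4" "6 * \<rho> \<le> \<epsilon> / 4" using \<epsilon> by (auto simp: \<rho>_def)
  have \<eta>: "0 < \<eta>" "\<eta> \<le> 1/2" "2 * \<eta> \<le> \<epsilon> / 4" using \<epsilon> by (auto simp: \<eta>_def)
  define W where "W v = {p \<in> window \<rho> v. prime p}" for v
  have finW: "finite (W v)" for v unfolding W_def by (rule finite_subset[OF _ finite_window[of \<rho> v]]) auto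
  obtain k :: "real \<Rightarrow> real" and \<kappa> M where k: "\<kappa> > 0" "M > 0" "\<And>x. 0 \<le> k x" "\<And>x. k x \<le> M"
    and ev: "\<forall>\<^sub>F v in at_top. \<bar>(\<Sum>p\<in>W v. k (ln (real p) - v) * (ln (real p) / real p)) - \<kappa>\<bar> \<le> \<eta> * \<kappa> \<and>
      (mean = 0 \<longrightarrow> norm (\<Sum>p\<in>W v. of_real (k (ln (real p) - v) * (ln (real p) / real p)) * \<psi> p) \<le> \<eta> * \<kappa>)"
    using prime_window[OF \<rho>(1,2) \<eta>(1)] unfolding W_def by blast
  obtain V where V: "\<And>v. v \<ge> V \<Longrightarrow> \<bar>(\<Sum>p\<in>W v. k (ln (real p) - v) * (ln (real p) / real p)) - \<kappa>\<bar> \<le> \<eta> * \<kappa> \<and>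
      (mean = 0 \<longrightarrow> norm (\<Sum>p\<in>W v. of_real (k (ln (real p) - v) * (ln (real p) / real p)) * \<psi> p) \<le> \<eta> * \<kappa>)"
    using ev unfolding eventually_at_top_linorder by blast
  \<comment> \<open>The last entry puts the primes of every window above q, hence coprime to
    q.\<close>
  define J0 where "J0 = nat \<lceil>max 1 (max V (ln (real q) + 2))\<rceil>"
  have J0: "1 \<le> J0" "V \<le> real J0" "ln (real q) + 2 \<le> real J0" unfolding J0_def by linarith+
  show ?thesis
  proof (rule exI[of _ J0], intro conjI J0(1) allI impI)
    fix J1 assume J1: "J0 \<le> J1"
    \<comment> \<open>The constant 128 is what sqrt (4 M A) \<le> (\<epsilon>/4) \<kappa> Lw
      requires when A \<le> 2 \<kappa> Lw.\<close>
    obtain N where N: "\<And>n. n \<ge> N \<Longrightarrow> (\<Sum>j\<in>{J1..<n}. 1 / real j) \<ge> 1 + 128 * M / (\<kappa> * \<epsilon>\<^sup>2)"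
      using log_weights_unbounded by blast
    show "\<exists>N. \<forall>J2\<ge>N. \<forall>a. (\<forall>k. norm (a k) \<le> 1) \<longrightarrow>
       (\<forall>\<^sub>F x in at_top. norm (omean a x - of_real \<delta> * log_average J1 J2 (omean (a \<circ> Suc)) x) \<le> \<epsilon>)"
    proof (intro exI[of _ N] allI impI)
      fix J2 and a :: "nat \<Rightarrow> complex" assume J2: "N \<le> J2" and a: "\<forall>k. norm (a k) \<le> 1"
      define b where "b = a \<circ> Suc"
      have b: "norm (b k) \<le> 1" for k using a by (simp add: b_def)
      let ?J = "{J1..<J2}"
      define Lw where "Lw = (\<Sum>j\<in>?J. 1 / real j)"
      have "128 * M / (\<kappa> * \<epsilon>\<^sup>2) > 0" using k \<epsilon> by simp
      then have Lw: "Lw > 0" "Lw \<ge> 128 * M / (\<kappa> * \<epsilon>\<^sup>2)" using N[OF J2] unfolding Lw_def by linarith+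
      define Pj where "Pj j = W (real j)" for j :: nat
      define P where "P = (\<Union>j\<in>?J. Pj j)"
      define idx where "idx p = nat (round (ln (real p)))" for p :: nat
      \<comment> \<open>Chosen so that w(p)/p is 1/j times the smoothed prime weight of the window
        of j. As log p \<le> 2j there, w is bounded by 2M, which is what controls the
        variance.\<close>
      define w where "w p = k (ln (real p) - real (idx p)) * ln (real p) / real (idx p)" for p :: nat
      have Pj: "prime p" "p > 0" "\<bar>ln (real p) - real j\<bar> \<le> \<rho>" "idx p = j" "p \<in> P" if "p \<in> Pj j" "j \<in> ?J" for p j
      proof -
        show pr: "prime p" "\<bar>ln (real p) - real j\<bar> \<le> \<rho>" using that by (auto simp: Pj_def W_def window_def abs_minus_commute)
        show "p > 0" using pr prime_gt_0_nat by blast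
        have "round (ln (real p)) = int j" by (rule round_unique') (use pr \<rho> in simp)
        then show "idx p = j" by (simp add: idx_def)
        show "p \<in> P" using that by (auto simp: P_def)
      qed
      have finP: "finite P" unfolding P_def Pj_def using finW by blast
      have Pprime: "prime p" if "p \<in> P" for p using that Pj by (auto simp: P_def)
      have disj: "Pj i \<inter> Pj j = {}" if ij: "i \<in> ?J" "j \<in> ?J" "i \<noteq> j" for i j
      proof -
        have False if "p \<in> Pj i" "p \<in> Pj j" for p using Pj(4)[OF that(1) ij(1)] Pj(4)[OF that(2) ij(2)] ij(3) by simp
        then show ?thesis by blast
      qed
      have jpos: "real j \<ge> 1" if "j \<in> ?J" for j using that J1 J0 by auto
      have sumP: "(\<Sum>p\<in>P. f p) = (\<Sum>j\<in>?J. \<Sum>p\<in>Pj j. f p)" for f :: "nat \<Rightarrow> 'b::comm_monoid_add"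
        unfolding P_def by (rule sum.UNION_disjoint) (use finW disj in \<open>auto simp: Pj_def\<close>)
      have w_eq: "w p / real p = (1 / real j) * (k (ln (real p) - real j) * (ln (real p) / real p))" if "p \<in> Pj j" "j \<in> ?J" for p j
        using Pj(4)[OF that] by (simp add: w_def)
      have lnp: "0 \<le> ln (real p)" "ln (real p) \<le> 2 * real j" if "p \<in> Pj j" "j \<in> ?J" for p j
        using Pj(2,3)[OF that] jpos[OF that(2)] \<rho> by (auto simp: abs_le_iff)
      have w0: "0 \<le> w p" "w p \<le> 2 * M" if pP: "p \<in> P" for p
      proof -
        obtain j where j: "p \<in> Pj j" "j \<in> ?J" using pP unfolding P_def by blast
        have eq: "w p = k (ln (real p) - real j) * (ln (real p) / real j)" using Pj(4)[OF j] by (simp add: w_def)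
        show "0 \<le> w p" unfolding eq using lnp[OF j] k by (intro mult_nonneg_nonneg) auto
        have "ln (real p) / real j \<le> 2" using lnp[OF j] jpos[OF j(2)] by (simp add: divide_le_eq)
        then have "w p \<le> M * 2" unfolding eq using lnp[OF j] k(2-4) by (intro mult_mono) auto
        then show "w p \<le> 2 * M" by simp
      qed
      define K where "K j = (\<Sum>p\<in>Pj j. k (ln (real p) - real j) * (ln (real p) / real p))" for j
      define K\<psi> where "K\<psi> j = (\<Sum>p\<in>Pj j. of_real (k (ln (real p) - real j) * (ln (real p) / real p)) * \<psi> p)" for j
      have jV: "real j \<ge> V" if "j \<in> ?J" for j using that J1 J0 by auto
      have K: "\<bar>K j - \<kappa>\<bar> \<le> \<eta> * \<kappa>" if "j \<in> ?J" for j using V[OF jV[OF that]] by (simp add: K_def Pj_def)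
      have K\<psi>: "norm (K\<psi> j - of_real (\<delta> * \<kappa>)) \<le> \<eta> * \<kappa>" if j: "j \<in> ?J" for j
        using \<delta>
      proof
        assume "mean = 0 \<and> \<delta> = 0"
        then show ?thesis using V[OF jV[OF j]] by (simp add: K\<psi>_def Pj_def)
      next
        assume *: "(\<forall>n. coprime n q \<longrightarrow> \<psi> n = 1) \<and> \<delta> = 1"
        have "\<psi> p = 1" if p: "p \<in> Pj j" for p
        proof -
          have "ln (real q) < ln (real p)" using Pj(3)[OF p j] \<rho> j J1 J0 by (auto simp: abs_le_iff)
          then have "q < p" using q_pos Pj(2)[OF p j] by simp
          then have "coprime p q" using Pj(1)[OF p j] q_pos by (meson dvd_imp_le not_less prime_imp_coprime)
          then show ?thesis using * by blast
        qed
        then have "K\<psi> j = of_real (K j)" by (simp add: K\<psi>_def K_def)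
        then have "K\<psi> j - of_real (\<delta> * \<kappa>) = of_real (K j - \<kappa>)" using * by simp
        then show ?thesis using K[OF j] by (simp only: norm_of_real)
      qed
      define A where "A = (\<Sum>p\<in>P. w p / real p)"
      have A_eq: "A = (\<Sum>j\<in>?J. (1 / real j) * K j)"
        unfolding A_def sumP K_def sum_distrib_left by (intro sum.cong refl w_eq)
      have A\<kappa>: "\<bar>A - \<kappa> * Lw\<bar> \<le> \<eta> * \<kappa> * Lw"
      proof -
        have "A - \<kappa> * Lw = (\<Sum>j\<in>?J. (1 / real j) * (K j - \<kappa>))"
          unfolding A_eq Lw_def sum_distrib_left sum_subtractf[symmetric] by (intro sum.cong) (simp_all add: diff_divide_distrib)
        then have "\<bar>A - \<kappa> * Lw\<bar> \<le> (\<Sum>j\<in>?J. \<bar>(1 / real j) * (K j - \<kappa>)\<bar>)" by (simp only: sum_abs)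
        also have "\<dots> \<le> (\<Sum>j\<in>?J. (1 / real j) * (\<eta> * \<kappa>))"
          unfolding abs_mult by (intro sum_mono mult_mono K) auto
        also have "\<dots> = \<eta> * \<kappa> * Lw" by (simp add: Lw_def sum_distrib_left mult.commute)
        finally show ?thesis .
      qed
      have "\<eta> * \<kappa> * Lw \<le> 1 * (\<kappa> * Lw)" unfolding mult.assoc using \<eta> k Lw by (intro mult_right_mono) auto
      then have A2: "A \<le> 2 * (\<kappa> * Lw)" using A\<kappa> by (simp add: abs_le_iff)
      have A0: "A \<ge> 0" unfolding A_def using w0 by (intro sum_nonneg) auto
      define Wt where "Wt = (\<Sum>p\<in>P. w p)"
      have Wt0: "Wt \<ge> 0" unfolding Wt_def using w0 by (intro sum_nonneg) auto
      have sq: "(\<Sum>p\<in>P. (w p)\<^sup>2 / real p) \<le> 2 * M * A"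
      proof -
        have "(\<Sum>p\<in>P. (w p)\<^sup>2 / real p) \<le> (\<Sum>p\<in>P. 2 * M * (w p / real p))"
        proof (rule sum_mono)
          fix p assume "p \<in> P"
          then have "w p * (w p / real p) \<le> 2 * M * (w p / real p)" using w0 by (intro mult_right_mono) auto
          then show "(w p)\<^sup>2 / real p \<le> 2 * M * (w p / real p)" by (simp add: power2_eq_square)
        qed
        then show ?thesis by (simp add: A_def sum_distrib_left)
      qed
      define Lav where "Lav x = (\<Sum>j\<in>?J. of_real (1 / real j) * omean b (x * exp (- real j)))" for x
      have "\<forall>\<^sub>F x in at_top. x \<ge> max 1 (max (Wt / M) (exp (real J2 + 1) / \<rho>))" by (rule eventually_ge_at_top)
      then show "\<forall>\<^sub>F x in at_top. norm (omean a x - of_real \<delta> * log_average J1 J2 (omean (a \<circ> Suc)) x) \<le> \<epsilon>"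
      proof eventually_elim
        case (elim x)
        \<comment> \<open>The bound Wt / M absorbs the linear term of Turan-Kubilius into the
          quadratic one; the last bound makes the rounding error at most \<rho> at every scale that
          occurs.\<close>
        then have x: "x \<ge> 1" "x \<ge> Wt / M" "x \<ge> exp (real J2 + 1) / \<rho>" by auto
        define n where "n = nat \<lfloor>x\<rfloor>"
        have nx: "real n \<le> x" using x by (simp add: n_def)
        define c where "c m = \<psi> m * a (prime_Omega m)" for m
        have divn: "n div p = nat \<lfloor>x / real p\<rfloor>" if "p > 0" for p
          using x floor_divide_real_eq_div[of "int p" x] by (simp add: n_def nat_div_distrib)
        have inner: "(\<Sum>m=1..n div p. c (p * m)) = \<psi> p * osum b (nat \<lfloor>x / real p\<rfloor>)" if "p \<in> P" for p
          using Pprime[OF that] prime_gt_0_nat[OF Pprime[OF that]]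
          by (auto simp: divn osum_def sum_distrib_left c_def mult prime_Omega_mult_prime b_def mult.assoc intro!: sum.cong)
        have "norm (of_real A * (\<Sum>m=1..n. c m) - (\<Sum>p\<in>P. of_real (w p) * (\<Sum>m=1..n div p. c (p * m))))
          \<le> sqrt (real n * (real n * (\<Sum>p\<in>P. (w p)\<^sup>2 / real p) + 2 * A * Wt))"
          unfolding A_def Wt_def
          by (rule turan_kubilius[OF finP Pprime w0(1)]) (use norm_summand a in \<open>auto simp: c_def\<close>)
        also have "\<dots> \<le> sqrt (x * (x * (2 * M * A) + 2 * A * Wt))"
          by (intro real_sqrt_le_mono mult_mono add_mono nx sq) (use x A0 Wt0 k in \<open>auto intro!: add_nonneg_nonneg mult_nonneg_nonneg sum_nonneg\<close>)
        also have "\<dots> \<le> sqrt (x * (x * (2 * M * A) + 2 * A * (M * x)))"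
          using x k A0 by (intro real_sqrt_le_mono mult_left_mono add_left_mono) (auto simp: field_simps)
        also have "x * (x * (2 * M * A) + 2 * A * (M * x)) = x\<^sup>2 * (4 * M * A)" by (simp add: power2_eq_square algebra_simps)
        also have "sqrt (x\<^sup>2 * (4 * M * A)) = x * sqrt (4 * M * A)" using x by (simp add: real_sqrt_mult)
        finally have tk: "norm (of_real A * (\<Sum>m=1..n. c m) - (\<Sum>p\<in>P. of_real (w p) * (\<Sum>m=1..n div p. c (p * m)))) \<le> x * sqrt (4 * M * A)" .
        define Q where "Q = (\<Sum>p\<in>P. of_real (w p / real p) * \<psi> p * omean b (x / real p))"
        have "of_real A * omean a x - Q = (of_real A * (\<Sum>m=1..n. c m) - (\<Sum>p\<in>P. of_real (w p) * (\<Sum>m=1..n div p. c (p * m)))) / of_real x"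
        proof -
          have "of_real (w p / real p) * \<psi> p * omean b (x / real p) = of_real (w p) * (\<Sum>m=1..n div p. c (p * m)) / of_real x" if "p \<in> P" for p
            unfolding inner[OF that] using x prime_gt_0_nat[OF Pprime[OF that]] by (simp add: omean_def)
          then have "Q = (\<Sum>p\<in>P. of_real (w p) * (\<Sum>m=1..n div p. c (p * m))) / of_real x"
            unfolding Q_def sum_divide_distrib by (intro sum.cong) auto
          then show ?thesis by (simp add: omean_def osum_def c_def n_def diff_divide_distrib)
        qed
        then have "norm (of_real A * omean a x - Q) = norm (of_real A * (\<Sum>m=1..n. c m) - (\<Sum>p\<in>P. of_real (w p) * (\<Sum>m=1..n div p. c (p * m)))) / x"
          using x by (simp add: norm_divide)
        also have "\<dots> \<le> sqrt (4 * M * A)" using tk x by (simp add: divide_le_eq mult.commute)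
        finally have e1: "norm (of_real A * omean a x - Q) \<le> sqrt (4 * M * A)" .
        \<comment> \<open>All primes of one window now share the scale x e^-j, so that the values
          \<psi>(p) can be summed first.\<close>
        define Q' where "Q' = (\<Sum>j\<in>?J. of_real (1 / real j) * K\<psi> j * omean b (x * exp (- real j)))"
        have e2: "norm (Q - Q') \<le> A * (3 * \<rho>)"
        proof -
          have "Q' = (\<Sum>j\<in>?J. \<Sum>p\<in>Pj j. of_real (w p / real p) * \<psi> p * omean b (x * exp (- real j)))"
            unfolding Q'_def K\<psi>_def sum_distrib_left sum_distrib_right
            by (intro sum.cong refl) (simp only: w_eq of_real_mult mult.assoc)
          then have "Q - Q' = (\<Sum>j\<in>?J. \<Sum>p\<in>Pj j. of_real (w p / real p) * \<psi> p * (omean b (x / real p) - omean b (x * exp (- real j))))"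
            unfolding Q_def sumP by (simp only: sum_subtractf[symmetric] right_diff_distrib)
          also have "norm \<dots> \<le> (\<Sum>j\<in>?J. \<Sum>p\<in>Pj j. (w p / real p) * (3 * \<rho>))"
          proof (intro sum_norm_le)
            fix j p assume j: "j \<in> ?J" and p: "p \<in> Pj j"
            define y z where "y = x / real p" and "z = x * exp (- real j)"
            have p0: "real p > 0" using Pj(2)[OF p j] by simp
            have yz0: "y > 0" "z > 0" using x p0 by (auto simp: y_def z_def)
            have rel: "exp (- \<rho>) \<le> y / z" "y / z \<le> exp \<rho>"
            proof -
              have "y / z = exp (real j - ln (real p))" using x p0 by (simp add: y_def z_def exp_diff exp_minus field_simps)
              then show "exp (- \<rho>) \<le> y / z" "y / z \<le> exp \<rho>" using Pj(3)[OF p j] by (auto simp: abs_le_iff)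
            qed
            have low: "1 / z \<le> \<rho>" "1 / y \<le> \<rho>"
            proof -
              have ex: "exp (real J2 + 1) \<le> \<rho> * x" using x(3) \<rho> by (simp add: field_simps)
              have "exp (real j) \<le> exp (real J2 + 1)" using j by auto
              then have "exp (real j) \<le> \<rho> * x" using ex by linarith
              then show "1 / z \<le> \<rho>" using x by (simp add: z_def exp_minus field_simps)
              have "real p = exp (ln (real p))" using p0 by simp
              also have "\<dots> \<le> exp (real J2 + 1)" using Pj(3)[OF p j] j \<rho> by (auto simp: abs_le_iff)
              finally have "real p \<le> \<rho> * x" using ex by linarith
              then show "1 / y \<le> \<rho>" using x by (simp add: y_def field_simps)
            qed
            have "norm (omean b y - omean b z) \<le> 2 * \<rho> + \<rho>"
            proof (cases "y \<le> z")
              case True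
              have "z \<le> y * exp \<rho>" using rel(1) yz0 by (simp add: exp_minus field_simps)
              then have "norm (omean b z - omean b y) \<le> 2 * \<rho> + 1 / y" using True yz0 by (intro omean_lipschitz b) auto
              then show ?thesis using low by (simp add: norm_minus_commute)
            next
              case False
              have "y \<le> z * exp \<rho>" using rel(2) yz0 by (simp add: field_simps)
              then have "norm (omean b y - omean b z) \<le> 2 * \<rho> + 1 / z" using False yz0 by (intro omean_lipschitz b) auto
              then show ?thesis using low by simp
            qed
            note close = this
            have "norm (of_real (w p / real p) * \<psi> p) * norm (omean b y - omean b z) \<le> (w p / real p) * (3 * \<rho>)"
            proof (rule mult_mono)
              have "\<bar>w p / real p\<bar> * norm (\<psi> p) \<le> \<bar>w p / real p\<bar> * 1" by (intro mult_left_mono norm_le1) auto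
              then show "norm (of_real (w p / real p) * \<psi> p) \<le> w p / real p"
                using w0(1)[OF Pj(5)[OF p j]] by (simp only: norm_mult norm_of_real) simp
            qed (use w0(1)[OF Pj(5)[OF p j]] close in auto)
            then show "norm (of_real (w p / real p) * \<psi> p * (omean b (x / real p) - omean b (x * exp (- real j)))) \<le> (w p / real p) * (3 * \<rho>)"
              unfolding y_def z_def by (simp only: norm_mult)
          qed
          also have "\<dots> = A * (3 * \<rho>)" unfolding A_def sumP by (simp only: sum_distrib_right)
          finally show ?thesis .
        qed
        have e3: "norm (Q' - of_real (\<delta> * \<kappa>) * Lav x) \<le> \<eta> * \<kappa> * Lw"
        proof -
          have "Q' - of_real (\<delta> * \<kappa>) * Lav x = (\<Sum>j\<in>?J. of_real (1 / real j) * (K\<psi> j - of_real (\<delta> * \<kappa>)) * omean b (x * exp (- real j)))"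
            unfolding Q'_def Lav_def sum_distrib_left sum_subtractf[symmetric] by (intro sum.cong) (auto simp: algebra_simps)
          also have "norm \<dots> \<le> (\<Sum>j\<in>?J. (1 / real j) * (\<eta> * \<kappa>))"
          proof (rule sum_norm_le)
            fix j assume j: "j \<in> ?J"
            have "(1 / real j * norm (K\<psi> j - of_real (\<delta> * \<kappa>))) * norm (omean b (x * exp (- real j))) \<le> (1 / real j * (\<eta> * \<kappa>)) * 1"
              using x \<eta> k by (intro mult_mono K\<psi>[OF j] norm_omean b) auto
            then show "norm (of_real (1 / real j) * (K\<psi> j - of_real (\<delta> * \<kappa>)) * omean b (x * exp (- real j))) \<le> (1 / real j) * (\<eta> * \<kappa>)"
              unfolding norm_mult norm_of_real by simp
          qed
          also have "\<dots> = \<eta> * \<kappa> * Lw" by (simp add: Lw_def sum_distrib_left mult.commute)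
          finally show ?thesis .
        qed
        have e4: "norm (of_real (A - \<kappa> * Lw) * omean a x) \<le> \<eta> * \<kappa> * Lw"
        proof -
          have "\<bar>A - \<kappa> * Lw\<bar> * norm (omean a x) \<le> (\<eta> * \<kappa> * Lw) * 1"
            using \<eta> k Lw x a by (intro mult_mono A\<kappa> norm_omean) auto
          then show ?thesis by (simp only: norm_mult norm_of_real mult_1_right)
        qed
        \<comment> \<open>The four differences are the Turan-Kubilius error, the change of scale,
          the error in the window sums of \<psi>, and the replacement of \<open>A\<close> by
          \<kappa> Lw.\<close>
        have "of_real (\<kappa> * Lw) * omean a x - of_real (\<delta> * \<kappa>) * Lav x =
          (of_real A * omean a x - Q) + (Q - Q') + (Q' - of_real (\<delta> * \<kappa>) * Lav x) - of_real (A - \<kappa> * Lw) * omean a x"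
          by (simp add: algebra_simps)
        also have "norm \<dots> \<le> sqrt (4 * M * A) + A * (3 * \<rho>) + \<eta> * \<kappa> * Lw + \<eta> * \<kappa> * Lw"
          by (intro norm_triangle_le_diff norm_triangle_le add_mono e1 e2 e3 e4)
        also have "\<dots> \<le> (\<epsilon> / 4) * (\<kappa> * Lw) + (2 * (\<kappa> * Lw)) * (3 * \<rho>) + \<eta> * \<kappa> * Lw + \<eta> * \<kappa> * Lw"
        proof (intro add_mono order_refl mult_right_mono A2)
          show "sqrt (4 * M * A) \<le> \<epsilon> / 4 * (\<kappa> * Lw)"
          proof (rule real_le_lsqrt)
            have "4 * M * A \<le> 4 * M * (2 * (\<kappa> * Lw))" using k A2 by (intro mult_left_mono) auto
            also have "\<dots> = (8 * M) * (\<kappa> * Lw)" by simp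
            also have "\<dots> \<le> ((\<epsilon> / 4)\<^sup>2 * (\<kappa> * Lw)) * (\<kappa> * Lw)"
            proof (rule mult_right_mono)
              have "128 * M \<le> Lw * (\<kappa> * \<epsilon>\<^sup>2)" using Lw(2) k \<epsilon> by (simp add: pos_divide_le_eq)
              then show "8 * M \<le> (\<epsilon> / 4)\<^sup>2 * (\<kappa> * Lw)" by (simp add: power2_eq_square algebra_simps)
            qed (use k Lw in auto)
            also have "\<dots> = (\<epsilon> / 4 * (\<kappa> * Lw))\<^sup>2" by (simp add: power2_eq_square)
            finally show "4 * M * A \<le> (\<epsilon> / 4 * (\<kappa> * Lw))\<^sup>2" .
          qed (use k Lw \<epsilon> A0 in auto)
        qed (use \<rho> in auto)
        also have "\<dots> = (\<kappa> * Lw) * (\<epsilon> / 4 + 6 * \<rho> + 2 * \<eta>)" by (simp add: algebra_simps)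
        also have "\<dots> \<le> (\<kappa> * Lw) * \<epsilon>" using \<rho> \<eta> \<epsilon> k Lw by (intro mult_left_mono) auto
        finally have fin: "norm (of_real (\<kappa> * Lw) * omean a x - of_real (\<delta> * \<kappa>) * Lav x) \<le> (\<kappa> * Lw) * \<epsilon>" .
        have "of_real (\<kappa> * Lw) * omean a x - of_real (\<delta> * \<kappa>) * Lav x = of_real (\<kappa> * Lw) * (omean a x - of_real \<delta> * (Lav x / of_real Lw))"
          using Lw k by (simp add: field_simps)
        then have "(\<kappa> * Lw) * norm (omean a x - of_real \<delta> * (Lav x / of_real Lw)) \<le> (\<kappa> * Lw) * \<epsilon>"
          using fin k Lw by (simp add: norm_mult)
        then have "norm (omean a x - of_real \<delta> * (Lav x / of_real Lw)) \<le> \<epsilon>"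
          by (rule mult_left_le_imp_le) (use k Lw in auto)
        then show ?case by (simp only: log_average_def Lav_def Lw_def b_def)
      qed
    qed
  qed
qed

text \<open>Here \<delta> = 0: the primes in the windows cancel, and the logarithmic average drops
  out whatever the shifted means do.\<close>

theorem omean_nontrivial:
  assumes "mean = 0" and a: "\<And>k. norm (a k) \<le> 1"
  shows "(omean a \<longlongrightarrow> 0) at_top"
proof (rule tendstoI)
  fix \<epsilon> :: real assume \<epsilon>: "\<epsilon> > 0"
  obtain J0 where J0: "J0 \<ge> 1" "\<forall>J1\<ge>J0. \<exists>N. \<forall>J2\<ge>N. \<forall>a. (\<forall>k. norm (a k) \<le> 1) \<longrightarrow>
    (\<forall>\<^sub>F x in at_top. norm (omean a x - of_real 0 * log_average J1 J2 (omean (a \<circ> Suc)) x) \<le> \<epsilon> / 2)"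
    using omean_log_average[of "\<epsilon> / 2" 0] assms \<epsilon> by auto
  then obtain N where "\<forall>\<^sub>F x in at_top. norm (omean a x - of_real 0 * log_average J0 N (omean (a \<circ> Suc)) x) \<le> \<epsilon> / 2"
    using a by blast
  then show "\<forall>\<^sub>F x in at_top. dist (omean a x) 0 < \<epsilon>"
    by eventually_elim (use \<epsilon> in simp)
qed

lemma norm_weighted_average_le:
  fixes h :: "nat \<Rightarrow> complex"
  assumes "\<And>j. j \<in> {J1..<J2} \<Longrightarrow> norm (h j) \<le> e" and "(\<Sum>j\<in>{J1..<J2}. 1 / real j) > 0"
  shows "norm ((\<Sum>j\<in>{J1..<J2}. of_real (1 / real j) * h j) / of_real (\<Sum>j\<in>{J1..<J2}. 1 / real j)) \<le> e"
proof -
  have "norm (\<Sum>j\<in>{J1..<J2}. of_real (1 / real j) * h j) \<le> (\<Sum>j\<in>{J1..<J2}. 1 / real j * e)"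
    by (rule sum_norm_le) (use assms(1) in \<open>auto simp: norm_mult norm_divide divide_right_mono\<close>)
  also have "\<dots> = (\<Sum>j\<in>{J1..<J2}. 1 / real j) * e" by (rule sum_distrib_right[symmetric])
  finally show ?thesis using assms(2) unfolding norm_divide norm_of_real by (simp add: divide_le_eq mult.commute)
qed

theorem omean_shift_invariant:
  assumes triv: "\<forall>n. coprime n q \<longrightarrow> \<psi> n = 1" and a: "\<And>k. norm (a k) \<le> 1"
  shows "((\<lambda>x. omean a x - omean (a \<circ> Suc) x) \<longlongrightarrow> 0) at_top"
proof (rule tendstoI)
  fix \<epsilon> :: real assume \<epsilon>: "\<epsilon> > 0"
  define e where "e = \<epsilon> / 5"
  have e: "e > 0" using \<epsilon> by (simp add: e_def)
  obtain J1 where J1: "J1 \<ge> 1" "\<exists>N. \<forall>J2\<ge>N. \<forall>a. (\<forall>k. norm (a k) \<le> 1) \<longrightarrow>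
    (\<forall>\<^sub>F x in at_top. norm (omean a x - of_real 1 * log_average J1 J2 (omean (a \<circ> Suc)) x) \<le> e)"
    using omean_log_average[of e 1] triv e by blast
  then obtain N where N: "\<And>J2 a. J2 \<ge> N \<Longrightarrow> (\<forall>k. norm (a k) \<le> 1) \<Longrightarrow>
    (\<forall>\<^sub>F x in at_top. norm (omean a x - log_average J1 J2 (omean (a \<circ> Suc)) x) \<le> e)" by auto
  \<comment> \<open>The two ranges have very different lengths: the inner variable r stays below
    \<open>R\<close>, and the outer range up to \<open>J2\<close> is so long that a displacement by
    r costs at most 3 R / LV \<le> e.\<close>
  define R where "R = max N (Suc J1)"
  obtain N' where N': "\<And>n. n \<ge> N' \<Longrightarrow> (\<Sum>j\<in>{J1..<n}. 1 / real j) \<ge> 3 * real R / e" using log_weights_unbounded by blast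
  define J2 where "J2 = max N' R"
  define LW where "LW = (\<Sum>j\<in>{J1..<R}. 1 / real j)"
  define LV where "LV = (\<Sum>j\<in>{J1..<J2}. 1 / real j)"
  have "J1 \<in> {J1..<R}" "J1 \<in> {J1..<J2}" by (auto simp: R_def J2_def)
  then have LW: "LW > 0" and LV: "LV > 0"
    unfolding LW_def LV_def using J1(1) by (auto intro!: sum_pos2[of _ J1])
  have LVR: "3 * real R / LV \<le> e"
  proof -
    have "3 * real R / e \<le> LV" unfolding LV_def by (rule N') (simp add: J2_def)
    then show ?thesis using e LV by (simp add: field_simps)
  qed
  define b where "b = a \<circ> Suc"
  define c where "c = b \<circ> Suc"
  have b: "norm (b k) \<le> 1" and c: "norm (c k) \<le> 1" for k using a by (auto simp: b_def c_def)
  have ev1: "\<forall>\<^sub>F x in at_top. norm (omean a x - log_average J1 J2 (omean b) x) \<le> e"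
    unfolding b_def by (rule N) (use a in \<open>auto simp: J2_def R_def\<close>)
  have ev2: "\<forall>\<^sub>F x in at_top. norm (omean b x - log_average J1 J2 (omean c) x) \<le> e"
    unfolding c_def by (rule N) (use b in \<open>auto simp: J2_def R_def\<close>)
  have "\<forall>\<^sub>F x in at_top. norm (omean b x - log_average J1 R (omean c) x) \<le> e"
    unfolding c_def by (rule N) (use b in \<open>auto simp: R_def\<close>)
  \<comment> \<open>The inner approximation is used at all scales x e^-j with j < J2, hence the
    lower bound |Y| e^J2 on x below.\<close>
  then obtain Y where Y: "\<And>y. y \<ge> Y \<Longrightarrow> norm (omean b y - log_average J1 R (omean c) y) \<le> e"
    unfolding eventually_at_top_linorder by blast
  have ev3: "\<forall>\<^sub>F x in at_top. x \<ge> max 1 (\<bar>Y\<bar> * exp (real J2))" by (rule eventually_ge_at_top)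
  show "\<forall>\<^sub>F x in at_top. dist (omean a x - omean (a \<circ> Suc) x) 0 < \<epsilon>"
    using ev1 ev2 ev3
  proof eventually_elim
    case (elim x)
    then have x: "x \<ge> 1" "x \<ge> \<bar>Y\<bar> * exp (real J2)" by auto
    let ?V = "{J1..<J2}" and ?W = "{J1..<R}"
    define g where "g n = omean c (x * exp (- real n))" for n
    have g: "norm (g n) \<le> 1" for n unfolding g_def using x by (intro norm_omean c) auto
    have exps: "x * exp (- real j) * exp (- real r) = x * exp (- real (j + r))" for j r
      by (simp add: exp_add[symmetric] mult.assoc)
    \<comment> \<open>The outer average displaced by r; \<open>VV 0\<close> is the one that
      represents the mean of \<open>b\<close>.\<close>
    define VV where "VV r = (\<Sum>j\<in>?V. of_real (1 / real j) * g (j + r)) / of_real LV" for r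
    have V0: "log_average J1 J2 (omean c) x = VV 0" by (simp add: log_average_def VV_def g_def LV_def)
    have s1: "norm (log_average J1 J2 (omean b) x - log_average J1 J2 (log_average J1 R (omean c)) x) \<le> e"
    proof -
      have "log_average J1 J2 (omean b) x - log_average J1 J2 (log_average J1 R (omean c)) x =
        (\<Sum>j\<in>?V. of_real (1 / real j) * (omean b (x * exp (- real j)) - log_average J1 R (omean c) (x * exp (- real j)))) / of_real (\<Sum>j\<in>?V. 1 / real j)"
        unfolding log_average_def[of J1 J2] by (simp only: diff_divide_distrib[symmetric] sum_subtractf[symmetric] right_diff_distrib)
      also have "norm \<dots> \<le> e"
      proof (rule norm_weighted_average_le)
        fix j assume j: "j \<in> ?V"
        have "\<bar>Y\<bar> * exp (real j) \<le> \<bar>Y\<bar> * exp (real J2)" using j by (intro mult_left_mono) auto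
        then have "\<bar>Y\<bar> * exp (real j) \<le> x" using x by linarith
        then have "\<bar>Y\<bar> \<le> x * exp (- real j)" by (simp add: exp_minus field_simps)
        then show "norm (omean b (x * exp (- real j)) - log_average J1 R (omean c) (x * exp (- real j))) \<le> e" by (intro Y) linarith
      qed (use LV in \<open>simp add: LV_def\<close>)
      finally show ?thesis .
    qed
    have dbl: "log_average J1 J2 (log_average J1 R (omean c)) x = (\<Sum>r\<in>?W. of_real (1 / real r) * VV r) / of_real LW"
    proof -
      have "log_average J1 J2 (log_average J1 R (omean c)) x =
        (\<Sum>j\<in>?V. of_real (1 / real j) * ((\<Sum>r\<in>?W. of_real (1 / real r) * g (j + r)) / of_real LW)) / of_real LV"
        unfolding log_average_def exps g_def LV_def LW_def ..
      also have "\<dots> = (\<Sum>j\<in>?V. \<Sum>r\<in>?W. of_real (1 / real j) * (of_real (1 / real r) * g (j + r)) / of_real LW / of_real LV)"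
        unfolding sum_distrib_left sum_divide_distrib by (intro sum.cong refl) simp
      also have "\<dots> = (\<Sum>r\<in>?W. \<Sum>j\<in>?V. of_real (1 / real j) * (of_real (1 / real r) * g (j + r)) / of_real LW / of_real LV)"
        by (rule sum.swap)
      also have "\<dots> = (\<Sum>r\<in>?W. of_real (1 / real r) * VV r) / of_real LW"
        unfolding VV_def sum_distrib_left sum_divide_distrib by (intro sum.cong refl) (simp add: mult_ac)
      finally show ?thesis .
    qed
    have s2: "norm (log_average J1 J2 (log_average J1 R (omean c)) x - VV 0) \<le> e"
    proof -
      have "VV 0 = (\<Sum>r\<in>?W. of_real (1 / real r) * VV 0) / of_real LW"
        using LW unfolding sum_distrib_right[symmetric] of_real_sum[symmetric] LW_def[symmetric] by simp
      then have "log_average J1 J2 (log_average J1 R (omean c)) x - VV 0 =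
         (\<Sum>r\<in>?W. of_real (1 / real r) * VV r) / of_real LW - (\<Sum>r\<in>?W. of_real (1 / real r) * VV 0) / of_real LW"
        unfolding dbl by simp
      also have "\<dots> = (\<Sum>r\<in>?W. of_real (1 / real r) * (VV r - VV 0)) / of_real (\<Sum>r\<in>?W. 1 / real r)"
        unfolding LW_def by (simp only: diff_divide_distrib[symmetric] sum_subtractf[symmetric] right_diff_distrib)
      also have "norm \<dots> \<le> e"
      proof (rule norm_weighted_average_le)
        fix r assume r: "r \<in> ?W"
        have "VV r - VV 0 = ((\<Sum>j\<in>?V. of_real (1 / real j) * g (j + r)) - (\<Sum>j\<in>?V. of_real (1 / real j) * g j)) / of_real LV"
          by (simp add: VV_def diff_divide_distrib)
        also have "norm \<dots> \<le> 3 * real r / LV"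
          using log_average_shift[of g J1 J2 r, OF g J1(1)] LV by (simp add: norm_divide divide_right_mono J2_def R_def)
        also have "\<dots> \<le> 3 * real R / LV" using r LV by (intro divide_right_mono) auto
        finally show "norm (VV r - VV 0) \<le> e" using LVR by linarith
      qed (use LW in \<open>simp add: LW_def\<close>)
      finally show ?thesis .
    qed
    have "omean a x - omean b x = (omean a x - log_average J1 J2 (omean b) x)
      + (log_average J1 J2 (omean b) x - log_average J1 J2 (log_average J1 R (omean c)) x)
      + (log_average J1 J2 (log_average J1 R (omean c)) x - VV 0) - (omean b x - log_average J1 J2 (omean c) x)"
      unfolding V0 by simp
    also have "norm \<dots> \<le> e + e + e + e"
      by (intro norm_triangle_le_diff norm_triangle_le add_mono elim(1) elim(2) s1 s2)
    also have "\<dots> < \<epsilon>" using e by (simp add: e_def)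
    finally show ?case by (simp add: b_def)
  qed
qed

end

section \<open>Periodic weights\<close>

definition uniformly_mean_zero :: "(nat \<Rightarrow> complex) \<Rightarrow> bool" where
  "uniformly_mean_zero a \<longleftrightarrow> (\<forall>k. norm (a k) \<le> 1) \<and>
     (\<forall>\<epsilon>>0. \<exists>H>0. \<forall>m. norm ((\<Sum>k<H. a (m + k)) / of_nat H) \<le> \<epsilon>)"

text \<open>Quantifying over all admissible \<open>a\<close> makes the class stable under dilating
  the weight by d, since this shifts \<open>a\<close> by Omega(d).\<close>

definition Omega_null :: "(nat \<Rightarrow> complex) \<Rightarrow> bool" where
  "Omega_null w \<longleftrightarrow> (\<forall>a. uniformly_mean_zero a \<longrightarrow>
     (\<lambda>N. (\<Sum>n=1..N. w n * a (prime_Omega n)) / of_nat N) \<longlonglongrightarrow> 0)"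

lemma uniformly_mean_zero_shift: "uniformly_mean_zero a \<Longrightarrow> uniformly_mean_zero (\<lambda>k. a (k + d))"
  unfolding uniformly_mean_zero_def
proof (intro conjI allI impI)
  assume *: "(\<forall>k. norm (a k) \<le> 1) \<and> (\<forall>\<epsilon>>0. \<exists>H>0. \<forall>m. norm ((\<Sum>k<H. a (m + k)) / of_nat H) \<le> \<epsilon>)"
  show "norm (a (k + d)) \<le> 1" for k using * by blast
  fix \<epsilon> :: real assume "\<epsilon> > 0"
  then obtain H where H: "H > 0" "\<And>m. norm ((\<Sum>k<H. a (m + k)) / of_nat H) \<le> \<epsilon>" using * by blast
  then show "\<exists>H>0. \<forall>m. norm ((\<Sum>k<H. a (m + k + d)) / of_nat H) \<le> \<epsilon>"
    using H(2)[of "_ + d"] by (intro exI[of _ H]) (simp add: ac_simps)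
qed

lemma Omega_null_sum:
  assumes "finite A" "\<And>l. l \<in> A \<Longrightarrow> Omega_null (F l)" shows "Omega_null (\<lambda>n. \<Sum>l\<in>A. F l n)"
  unfolding Omega_null_def
proof (intro allI impI)
  fix a assume a: "uniformly_mean_zero a"
  have "(\<lambda>N. \<Sum>l\<in>A. (\<Sum>n=1..N. F l n * a (prime_Omega n)) / of_nat N) \<longlonglongrightarrow> (\<Sum>l\<in>A. 0)"
    by (intro tendsto_sum) (use assms a in \<open>auto simp: Omega_null_def\<close>)
  moreover have "(\<Sum>l\<in>A. (\<Sum>n=1..N. F l n * a (prime_Omega n)) / of_nat N) = (\<Sum>n=1..N. (\<Sum>l\<in>A. F l n) * a (prime_Omega n)) / of_nat N" for N
    unfolding sum_divide_distrib[symmetric] sum_distrib_right by (subst sum.swap) (rule refl)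
  ultimately show "(\<lambda>N. (\<Sum>n=1..N. (\<Sum>l\<in>A. F l n) * a (prime_Omega n)) / of_nat N) \<longlonglongrightarrow> 0" by simp
qed

lemma Omega_null_cmult:
  assumes "Omega_null w" shows "Omega_null (\<lambda>n. c * w n)"
  unfolding Omega_null_def
proof (intro allI impI)
  fix a assume a: "uniformly_mean_zero a"
  have "(\<lambda>N. c * ((\<Sum>n=1..N. w n * a (prime_Omega n)) / of_nat N)) \<longlonglongrightarrow> c * 0"
    by (intro tendsto_mult tendsto_const) (use assms a in \<open>auto simp: Omega_null_def\<close>)
  then show "(\<lambda>N. (\<Sum>n=1..N. c * w n * a (prime_Omega n)) / of_nat N) \<longlonglongrightarrow> 0"
    by (simp add: sum_distrib_left mult.assoc)
qed

text \<open>For the principal character the mean does not change in the limit when \<open>a\<close>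
  is shifted, hence it is close to the mean of the averages over H successive shifts, and these are
  uniformly small. For the others it vanishes by \<open>omean_nontrivial\<close>.\<close>

lemma (in dchar) Omega_null_char: "Omega_null \<psi>"
  unfolding Omega_null_def
proof (intro allI impI)
  fix a assume um: "uniformly_mean_zero a"
  then have a: "\<And>k. norm (a k) \<le> 1" by (simp add: uniformly_mean_zero_def)
  have "(omean a \<longlongrightarrow> 0) at_top"
  proof (cases "mean = 0")
    case True
    then show ?thesis by (rule omean_nontrivial[OF _ a])
  next
    case False
    have triv: "\<forall>n. coprime n q \<longrightarrow> \<psi> n = 1" using mean_nonzero_imp_trivial[OF False] by blast
    have shift: "((\<lambda>x. omean a x - omean (\<lambda>k. a (k + h)) x) \<longlongrightarrow> 0) at_top" for h
    proof (induction h)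
      case (Suc h)
      have "((\<lambda>x. omean (\<lambda>k. a (k + h)) x - omean ((\<lambda>k. a (k + h)) \<circ> Suc) x) \<longlongrightarrow> 0) at_top"
        by (rule omean_shift_invariant[OF triv]) (rule a)
      from tendsto_add[OF Suc this] show ?case by (simp add: o_def)
    qed simp
    show ?thesis
    proof (rule tendstoI)
      fix \<epsilon> :: real assume \<epsilon>: "\<epsilon> > 0"
      obtain H where H: "H > 0" "\<And>m. norm ((\<Sum>k<H. a (m + k)) / of_nat H) \<le> \<epsilon> / 2"
        using um \<epsilon> unfolding uniformly_mean_zero_def by (meson half_gt_zero)
      have "((\<lambda>x. \<Sum>h<H. (omean a x - omean (\<lambda>k. a (k + h)) x)) \<longlongrightarrow> (\<Sum>h<H. 0)) at_top"
        by (intro tendsto_sum shift)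
      then have "((\<lambda>x. (\<Sum>h<H. (omean a x - omean (\<lambda>k. a (k + h)) x)) / of_nat H) \<longlongrightarrow> 0 / of_nat H) at_top"
        by (intro tendsto_divide tendsto_const) (use H in auto)
      then have "\<forall>\<^sub>F x in at_top. dist ((\<Sum>h<H. (omean a x - omean (\<lambda>k. a (k + h)) x)) / of_nat H) 0 < \<epsilon> / 2"
        by (intro tendstoD) (use \<epsilon> in auto)
      then show "\<forall>\<^sub>F x in at_top. dist (omean a x) 0 < \<epsilon>"
        using eventually_gt_at_top[of 0]
      proof eventually_elim
        case (elim x)
        define b where "b k = (\<Sum>h<H. a (k + h)) / of_nat H" for k
        have "omean b x = (\<Sum>h<H. omean (\<lambda>k. a (k + h)) x) / of_nat H"
        proof -
          have "osum b N = (\<Sum>h<H. osum (\<lambda>k. a (k + h)) N) / of_nat H" for N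
            unfolding osum_def b_def by (subst sum.swap) (simp add: sum_distrib_left sum_divide_distrib)
          then show ?thesis by (simp add: omean_def sum_divide_distrib divide_divide_eq_left mult.commute)
        qed
        then have eq: "(\<Sum>h<H. (omean a x - omean (\<lambda>k. a (k + h)) x)) / of_nat H = omean a x - omean b x"
          using H(1) by (simp add: sum_subtractf diff_divide_distrib)
        have "norm (osum b (nat \<lfloor>x\<rfloor>)) \<le> (\<Sum>n=1..nat \<lfloor>x\<rfloor>. \<epsilon> / 2)"
          unfolding osum_def
        proof (rule sum_norm_le)
          fix n
          have "norm (\<psi> n) * norm (b (prime_Omega n)) \<le> 1 * (\<epsilon> / 2)"
            using H(2) by (intro mult_mono norm_le1) (auto simp: b_def)
          then show "norm (\<psi> n * b (prime_Omega n)) \<le> \<epsilon> / 2" by (simp add: norm_mult)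
        qed
        also have "\<dots> = real (nat \<lfloor>x\<rfloor>) * (\<epsilon> / 2)" by simp
        also have "\<dots> \<le> x * (\<epsilon> / 2)" using elim(2) \<epsilon> by (intro mult_right_mono) auto
        finally have "norm (omean b x) \<le> \<epsilon> / 2" using elim(2) by (simp add: omean_def norm_divide divide_le_eq mult.commute)
        moreover have "norm (omean a x - omean b x) < \<epsilon> / 2" using elim(1) unfolding eq by simp
        moreover have "norm (omean a x) \<le> norm (omean a x - omean b x) + norm (omean b x)"
          using norm_triangle_ineq[of "omean a x - omean b x" "omean b x"] by simp
        ultimately show ?case by simp
      qed
    qed
  qed
  then have "(\<lambda>N. omean a (real N)) \<longlonglongrightarrow> 0"
    by (rule filterlim_compose[OF _ filterlim_real_sequentially])
  then show "(\<lambda>N. (\<Sum>n=1..N. \<psi> n * a (prime_Omega n)) / of_nat N) \<longlonglongrightarrow> 0"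
    by (simp add: omean_def osum_def)
qed

section \<open>Periodic functions as combinations of dilated characters\<close>

definition coprime_periodic :: "nat \<Rightarrow> (nat \<Rightarrow> complex) \<Rightarrow> bool" where
  "coprime_periodic q f \<longleftrightarrow> (\<forall>n. f (n + q) = f n) \<and> (\<forall>n. \<not> coprime n q \<longrightarrow> f n = 0)"

definition eigen :: "nat \<Rightarrow> (nat \<Rightarrow> complex) \<Rightarrow> bool" where
  "eigen g f \<longleftrightarrow> (\<exists>\<omega>. \<forall>n. f (g * n) = \<omega> * f n)"

lemma periodic_mod:
  fixes f :: "nat \<Rightarrow> 'b"
  assumes "\<And>n. f (n + q) = f n" shows "f (n mod q) = f n"
proof -
  have "f (m + k * q) = f m" for m k
  proof (induction k)
    case (Suc k)
    then show ?case using assms[of "m + k * q"] by (simp add: algebra_simps)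
  qed simp
  then show ?thesis by (metis mod_div_mult_eq)
qed

lemma cis_root_of_unity: "m > 0 \<Longrightarrow> cis (2 * pi * real j / real m) ^ m = 1"
proof -
  assume m: "m > 0"
  have "cis (2 * pi * real j / real m) ^ m = cis (real m * (2 * pi * real j / real m))" by (rule Complex.DeMoivre)
  also have "real m * (2 * pi * real j / real m) = 2 * pi * real j" using m by simp
  also have "cis (2 * pi * real j) = 1" by (rule cis_multiple_2pi) (rule Ints_of_nat)
  finally show ?thesis .
qed

lemma sum_powers_root_of_unity:
  fixes m :: nat assumes "0 < j" "j < m"
  shows "(\<Sum>l<m. cis (2 * pi * real l / real m) ^ j) = 0"
proof -
  define z where "z = cis (2 * pi * real j / real m)"
  have "cis (2 * pi * real l / real m) ^ j = z ^ l" for l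
  proof -
    have "cis (2 * pi * real l / real m) ^ j = cis (real j * (2 * pi * real l / real m))" by (rule Complex.DeMoivre)
    also have "real j * (2 * pi * real l / real m) = real l * (2 * pi * real j / real m)" by (simp add: mult_ac)
    also have "cis \<dots> = z ^ l" unfolding z_def by (rule Complex.DeMoivre[symmetric])
    finally show ?thesis .
  qed
  then have "(\<Sum>l<m. cis (2 * pi * real l / real m) ^ j) = (\<Sum>l<m. z ^ l)" by simp
  moreover have "z \<noteq> 1"
  proof
    assume "z = 1"
    then have "exp (\<i> * of_real (2 * pi * real j / real m)) = 1" by (simp add: z_def cis_conv_exp)
    then obtain n :: int where "2 * pi * real j / real m = of_int (2 * n) * pi"
      by (subst (asm) exp_eq_1) auto
    then have "real j = of_int n * real m" using assms by (simp add: field_simps)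
    then have "real_of_int (int j) = real_of_int (n * int m)" by simp
    then have "int j = n * int m" by (simp only: of_int_eq_iff)
    then have "int m dvd int j" by simp
    then show False using assms by (auto dest: zdvd_imp_le)
  qed
  moreover have "z ^ m = 1" unfolding z_def by (rule cis_root_of_unity) (use assms in simp)
  ultimately show ?thesis by (simp add: geometric_sum)
qed

text \<open>Projecting onto the eigenspaces of multiplication by \<open>g\<close> splits a function into eigenfunctions,
  one residue class after the other; functions that are eigenfunctions for all units are multiples of characters.\<close>

lemma eigen_decomposition:
  assumes q: "q > 0" and f: "coprime_periodic q f" and g: "coprime g q"
  shows "\<exists>F. (\<forall>l<totient q. coprime_periodic q (F l) \<and> eigen g (F l) \<and> (\<forall>h. eigen h f \<longrightarrow> eigen h (F l))) \<and>
    f = (\<lambda>n. \<Sum>l<totient q. F l n)"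
proof -
  \<comment> \<open>By Euler's theorem this exponent serves every unit g. \<open>F l\<close> will be
    the component of f on which multiplication by g acts as the inverse of the root of unity
    \<open>z l\<close>.\<close>
  define m where "m = totient q"
  have m: "m > 0" using q by (simp add: m_def)
  define z where "z l = cis (2 * pi * real l / real m)" for l
  have zm: "z l ^ m = 1" for l
    unfolding z_def using m by (rule cis_root_of_unity)
  have znz: "z l \<noteq> 0" for l by (simp add: z_def)
  have fper: "f (n + q) = f n" and fzero: "\<not> coprime n q \<Longrightarrow> f n = 0" for n using f by (auto simp: coprime_periodic_def)
  note fmod = periodic_mod[of f q, OF fper]
  have gm: "f (g ^ m * n) = f n" for n
  proof -
    have "[g ^ m * n = 1 * n] (mod q)" using euler_theorem[OF g] unfolding m_def by (rule cong_scalar_right)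
    then show ?thesis using fmod by (metis cong_def mult_1)
  qed
  define F where "F l n = (\<Sum>j<m. z l ^ j * f (g ^ j * n)) / of_nat m" for l n
  have "coprime_periodic q (F l)" for l
    unfolding coprime_periodic_def
  proof (intro conjI allI impI)
    fix n
    have "f (g ^ j * (n + q)) = f (g ^ j * n)" for j
    proof -
      have "(g ^ j * (n + q)) mod q = (g ^ j * n) mod q" by (simp add: distrib_left)
      then show ?thesis using fmod by metis
    qed
    then show "F l (n + q) = F l n" by (simp add: F_def)
    assume "\<not> coprime n q"
    then have "f (g ^ j * n) = 0" for j by (intro fzero) simp
    then show "F l n = 0" by (simp add: F_def)
  qed
  moreover have "eigen g (F l)" for l
    unfolding eigen_def
  proof (intro exI[of _ "inverse (z l)"] allI)
    fix n
    have "z l * (\<Sum>j<m. z l ^ j * f (g ^ j * (g * n))) = (\<Sum>j<m. z l ^ Suc j * f (g ^ Suc j * n))"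
      by (simp add: sum_distrib_left mult_ac)
    also have "\<dots> = (\<Sum>j<m. z l ^ j * f (g ^ j * n)) + (z l ^ m * f (g ^ m * n) - z l ^ 0 * f (g ^ 0 * n))"
      using sum.lessThan_Suc_shift[of "\<lambda>j. z l ^ j * f (g ^ j * n)" m] sum.lessThan_Suc[of "\<lambda>j. z l ^ j * f (g ^ j * n)" m]
      by (simp add: algebra_simps)
    also have "\<dots> = (\<Sum>j<m. z l ^ j * f (g ^ j * n))" by (simp add: zm gm)
    finally have "z l * F l (g * n) = F l n" by (simp add: F_def)
    then show "F l (g * n) = inverse (z l) * F l n" using znz[of l] by (simp add: field_simps)
  qed
  moreover have "eigen h (F l)" if "eigen h f" for h l
  proof -
    obtain \<omega> where \<omega>: "\<And>n. f (h * n) = \<omega> * f n" using \<open>eigen h f\<close> by (auto simp: eigen_def)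
    have "f (g ^ j * (h * n)) = \<omega> * f (g ^ j * n)" for j n using \<omega>[of "g ^ j * n"] by (simp add: mult_ac)
    then have "F l (h * n) = \<omega> * F l n" for n
      unfolding F_def times_divide_eq_right sum_distrib_left by (simp only: mult.left_commute[of \<omega>])
    then show ?thesis by (auto simp: eigen_def)
  qed
  moreover have "f n = (\<Sum>l<m. F l n)" for n
  proof -
    have "(\<Sum>l<m. F l n) = (\<Sum>j<m. (\<Sum>l<m. z l ^ j) * f (g ^ j * n)) / of_nat m"
      unfolding F_def sum_divide_distrib[symmetric] sum_distrib_right by (subst sum.swap) (rule refl)
    also have "(\<Sum>j<m. (\<Sum>l<m. z l ^ j) * f (g ^ j * n)) = (\<Sum>j<m. if j = 0 then of_nat m * f n else 0)"
    proof (rule sum.cong[OF refl])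
      fix j assume "j \<in> {..<m}"
      then show "(\<Sum>l<m. z l ^ j) * f (g ^ j * n) = (if j = 0 then of_nat m * f n else 0)"
        using sum_powers_root_of_unity[of j m] by (cases "j = 0") (auto simp: z_def)
    qed
    also have "\<dots> = of_nat m * f n" using m by simp
    finally show ?thesis using m by simp
  qed
  ultimately show ?thesis unfolding m_def[symmetric] by (intro exI[of _ F]) auto
qed

text \<open>Decomposing along one unit after another keeps the eigenfunction property for the units
  already treated. In the end f(g n) f(1) = f(g) f(n) for all g and n, so f is either 0 or f(1)
  times a character.\<close>

lemma Omega_null_coprime_periodic:
  assumes q: "q > 0" and f: "coprime_periodic q f"
  shows "Omega_null f"
proof -
  have reduce: "\<forall>f. coprime_periodic q f \<longrightarrow> Omega_null f"
    if "\<forall>g\<in>set gs. coprime g q" "\<forall>f. coprime_periodic q f \<longrightarrow> (\<forall>g\<in>set gs. eigen g f) \<longrightarrow> Omega_null f" for gs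
    using that
  proof (induction gs)
    case (Cons g gs)
    have "\<forall>f. coprime_periodic q f \<longrightarrow> (\<forall>h\<in>set gs. eigen h f) \<longrightarrow> Omega_null f"
    proof (intro allI impI)
      fix f assume f: "coprime_periodic q f" "\<forall>h\<in>set gs. eigen h f"
      obtain F where F: "\<And>l. l < totient q \<Longrightarrow> coprime_periodic q (F l) \<and> eigen g (F l) \<and> (\<forall>h. eigen h f \<longrightarrow> eigen h (F l))"
        "f = (\<lambda>n. \<Sum>l<totient q. F l n)"
        using eigen_decomposition[OF q f(1), of g] Cons.prems(1) by auto
      have "Omega_null (F l)" if "l \<in> {..<totient q}" for l
        using Cons.prems(2) F(1)[of l] f(2) that by auto
      then have "Omega_null (\<lambda>n. \<Sum>l<totient q. F l n)" by (intro Omega_null_sum) auto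
      then show "Omega_null f" using F(2) by simp
    qed
    then show ?case using Cons by simp
  qed simp
  have full: "Omega_null f" if f: "coprime_periodic q f" and eig: "\<And>g. g < q \<Longrightarrow> coprime g q \<Longrightarrow> eigen g f" for f
  proof -
    have fper: "f (n + q) = f n" and fzero: "\<not> coprime n q \<Longrightarrow> f n = 0" for n using f by (auto simp: coprime_periodic_def)
    note fmod = periodic_mod[of f q, OF fper]
    have eig': "f (g * n) * f 1 = f g * f n" for g n
    proof (cases "coprime g q")
      case True
      then obtain \<omega> where \<omega>: "\<And>n. f ((g mod q) * n) = \<omega> * f n" using eig[of "g mod q"] q by (auto simp: eigen_def)
      have "f (g * n) = \<omega> * f n" for n using \<omega>[of n] fmod by (metis mod_mult_left_eq)
      from this[of n] this[of 1] show ?thesis by simp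
    next
      case False
      then show ?thesis by (simp add: fzero)
    qed
    show ?thesis
    proof (cases "f 1 = 0")
      case True
      have "f n = 0" for n
      proof (cases "coprime n q")
        case True
        then obtain \<omega> where \<omega>: "\<And>k. f ((n mod q) * k) = \<omega> * f k" using eig[of "n mod q"] q by (auto simp: eigen_def)
        from \<omega>[of 1] show ?thesis using \<open>f 1 = 0\<close> fmod by simp
      qed (rule fzero)
      then show ?thesis by (simp add: Omega_null_def)
    next
      case False
      interpret dchar "\<lambda>n. f n / f 1" q
        by unfold_locales (use q fper fzero eig' False in \<open>auto simp: field_simps\<close>)
      have "Omega_null (\<lambda>n. f 1 * (f n / f 1))" by (intro Omega_null_cmult Omega_null_char)
      then show ?thesis using False by simp
    qed
  qed
  show ?thesis
    using reduce[of "filter (\<lambda>g. coprime g q) [0..<q]"] full f by auto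
qed

lemma prime_Omega_mult: "m > 0 \<Longrightarrow> n > 0 \<Longrightarrow> prime_Omega (m * n) = prime_Omega m + prime_Omega n"
  unfolding prime_Omega_def by (subst prime_factorization_mult) auto

text \<open>Split by d = gcd(n, q): with n = d m and q = d e the condition says that m is coprime to
  e, and Omega(n) = Omega(m) + Omega(d) merely shifts the sequence.\<close>

theorem Omega_null_periodic:
  assumes q: "q > 0" and w: "\<And>n. w (n + q) = w n"
  shows "Omega_null w"
proof -
  have part: "Omega_null (\<lambda>n. if gcd n q = d then w n else 0)" if d: "d dvd q" for d
    unfolding Omega_null_def
  proof (intro allI impI)
    fix a assume um: "uniformly_mean_zero a"
    obtain e where e: "q = d * e" using d by blast
    have d0: "d > 0" and e0: "e > 0" using q unfolding e by (simp_all only: nat_0_less_mult_iff)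
    define f where "f m = (if coprime m e then w (d * m) else 0)" for m
    have "coprime_periodic e f"
      unfolding coprime_periodic_def f_def
    proof (intro conjI allI impI)
      fix m
      have "coprime (m + e) e = coprime m e" by (simp only: coprime_iff_gcd_eq_1 gcd_add1)
      then show "(if coprime (m + e) e then w (d * (m + e)) else 0) = (if coprime m e then w (d * m) else 0)"
        using w[of "d * m"] by (simp add: e distrib_left)
    qed simp
    then have "Omega_null f" by (rule Omega_null_coprime_periodic[OF e0])
    then have lim: "(\<lambda>N. (\<Sum>m=1..N. f m * a (prime_Omega m + prime_Omega d)) / of_nat N) \<longlonglongrightarrow> 0"
      using uniformly_mean_zero_shift[OF um, of "prime_Omega d"] unfolding Omega_null_def by (elim allE impE) assumption
    have eq: "(\<Sum>n=1..N. (if gcd n q = d then w n else 0) * a (prime_Omega n)) = (\<Sum>m=1..N div d. f m * a (prime_Omega m + prime_Omega d))" for N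
    proof -
      have "(\<Sum>n=1..N. (if gcd n q = d then w n else 0) * a (prime_Omega n)) = (\<Sum>n\<in>{n \<in> {1..N}. d dvd n}. (if gcd n q = d then w n else 0) * a (prime_Omega n))"
        by (rule sum.mono_neutral_right) auto
      also have "\<dots> = (\<Sum>m=1..N div d. (if gcd (d * m) q = d then w (d * m) else 0) * a (prime_Omega (d * m)))"
        by (rule sum_multiples[OF d0])
      also have "\<dots> = (\<Sum>m=1..N div d. f m * a (prime_Omega m + prime_Omega d))"
      proof (rule sum.cong[OF refl])
        fix m assume "m \<in> {1..N div d}"
        then have m: "m > 0" by simp
        have "gcd (d * m) q = d \<longleftrightarrow> coprime m e"
        proof -
          have "gcd (d * m) q = d * gcd m e" unfolding e by (rule gcd_mult_distrib_nat[symmetric])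
          then have "gcd (d * m) q = d \<longleftrightarrow> gcd m e = 1" using d0 by simp
          then show ?thesis by (simp only: coprime_iff_gcd_eq_1)
        qed
        then show "(if gcd (d * m) q = d then w (d * m) else 0) * a (prime_Omega (d * m)) = f m * a (prime_Omega m + prime_Omega d)"
          using prime_Omega_mult[OF d0 m] by (simp add: f_def add.commute)
      qed
      finally show ?thesis .
    qed
    have divlim: "filterlim (\<lambda>N. N div d) sequentially sequentially"
      unfolding filterlim_at_top
    proof
      fix Z :: nat
      show "\<forall>\<^sub>F N in sequentially. Z \<le> N div d"
        using eventually_ge_at_top[of "Z * d"] by eventually_elim (use d0 in \<open>simp add: less_eq_div_iff_mult_less_eq\<close>)
    qed
    show "(\<lambda>N. (\<Sum>n=1..N. (if gcd n q = d then w n else 0) * a (prime_Omega n)) / of_nat N) \<longlonglongrightarrow> 0"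
    proof (rule Lim_null_comparison)
      let ?A = "\<lambda>N. (\<Sum>m=1..N. f m * a (prime_Omega m + prime_Omega d)) / of_nat N"
      show "(\<lambda>N. norm (?A (N div d))) \<longlonglongrightarrow> 0"
        using tendsto_norm_zero[OF filterlim_compose[OF lim divlim]] .
      show "\<forall>\<^sub>F N in sequentially. norm ((\<Sum>n=1..N. (if gcd n q = d then w n else 0) * a (prime_Omega n)) / of_nat N) \<le> norm (?A (N div d))"
      proof (intro always_eventually allI)
        fix N
        let ?S = "\<Sum>m=1..N div d. f m * a (prime_Omega m + prime_Omega d)"
        \<comment> \<open>If N div d = 0, the sum \<open>?S\<close> is empty and both sides are
          0.\<close>
        have "norm ?S / real N \<le> norm ?S / real (N div d)"
        proof (cases "N div d = 0")
          case False
          then show ?thesis by (intro divide_left_mono mult_pos_pos) (auto intro: gr0I)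
        qed simp
        then show "norm ((\<Sum>n=1..N. (if gcd n q = d then w n else 0) * a (prime_Omega n)) / of_nat N) \<le> norm (?A (N div d))"
          unfolding eq by (simp add: norm_divide)
      qed
    qed
  qed
  have "Omega_null (\<lambda>n. \<Sum>d | d dvd q. if gcd n q = d then w n else 0)"
    by (intro Omega_null_sum part) (use q in auto)
  moreover have "(\<Sum>d | d dvd q. if gcd n q = d then w n else 0) = w n" for n
    using q by (simp add: sum.delta)
  ultimately show ?thesis by simp
qed

section \<open>Uniform ergodic averages\<close>

text \<open>The indicator of a closed set A is the limit of the functions max(0, 1 - n dist(x, A)),
  and closed sets form an intersection-stable generator.\<close>

lemma finite_measure_eqI_continuous:
  fixes M N :: "'a::metric_space measure"
  assumes M: "prob_space M" "sets M = sets borel" and N: "prob_space N" "sets N = sets borel"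
    and eq: "\<And>f :: 'a \<Rightarrow> real. continuous_on UNIV f \<Longrightarrow> (\<And>x. 0 \<le> f x \<and> f x \<le> 1) \<Longrightarrow> (\<integral>x. f x \<partial>M) = (\<integral>x. f x \<partial>N)"
  shows "M = N"
proof -
  interpret M: prob_space M by fact
  interpret N: prob_space N by fact
  have closed: "emeasure M A = emeasure N A" if A: "closed A" for A
  proof (cases "A = {}")
    case False
    define f where "f n x = max 0 (1 - real n * infdist x A)" for n :: nat and x :: 'a
    have fc: "continuous_on UNIV (f n)" for n
      unfolding f_def by (intro continuous_intros continuous_on_infdist)
    have fb: "0 \<le> f n x \<and> f n x \<le> 1" for n x
      using infdist_nonneg[of x A] by (auto simp: f_def)
    have fl: "(\<lambda>n. f n x) \<longlonglongrightarrow> indicator A x" for x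
    proof (cases "x \<in> A")
      case True
      then show ?thesis by (simp add: f_def)
    next
      case False
      then have d: "infdist x A > 0" using A \<open>A \<noteq> {}\<close> infdist_pos_not_in_closed by blast
      obtain n0 :: nat where n0: "1 / infdist x A < real n0" using reals_Archimedean2 by blast
      have "f n x = 0" if "n \<ge> n0" for n
      proof -
        have "1 / infdist x A \<le> real n" using n0 that by linarith
        then show ?thesis using d by (simp add: f_def field_simps)
      qed
      then have "\<forall>\<^sub>F n in sequentially. f n x = indicator A x" using False by (auto simp: eventually_sequentially)
      then show ?thesis by (rule tendsto_eventually)
    qed
    have lim: "(\<lambda>n. \<integral>x. f n x \<partial>K) \<longlonglongrightarrow> measure K A" if K: "prob_space K" "sets K = sets borel" for K :: "'a measure"
    proof -
      interpret K: prob_space K by fact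
      have "(\<lambda>n. \<integral>x. f n x \<partial>K) \<longlonglongrightarrow> (\<integral>x. indicator A x \<partial>K)"
      proof (rule integral_dominated_convergence[where w = "\<lambda>_. 1"])
        show "f n \<in> borel_measurable K" for n
          using borel_measurable_continuous_onI[OF fc] K(2) by (simp cong: measurable_cong_sets)
        show "(\<lambda>x. indicator A x :: real) \<in> borel_measurable K"
          using A K(2) by (intro borel_measurable_indicator) auto
      qed (use fl fb in auto)
      then show ?thesis using K(2) A by simp
    qed
    have "measure M A = measure N A"
      using lim[OF M] lim[OF N] eq[OF fc fb] by (simp add: LIMSEQ_unique)
    then show ?thesis by (simp add: M.emeasure_eq_measure N.emeasure_eq_measure)
  qed simp
  show ?thesis
  proof (rule measure_eqI_generator_eq[where E = "Collect closed" and \<Omega> = UNIV and A = "\<lambda>_. UNIV"])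
    show "Int_stable (Collect closed)" by (auto simp: Int_stable_def)
    show "sets M = sigma_sets UNIV (Collect closed)" "sets N = sigma_sets UNIV (Collect closed)"
      using M(2) N(2) by (simp_all add: borel_eq_closed)
    show "emeasure M UNIV \<noteq> \<infinity>" for i :: nat by (simp add: M.emeasure_eq_measure)
  qed (auto intro: closed)
qed

section \<open>Weak compactness of empirical measures\<close>

text \<open>The first differing digit contributes 2/3^(i+1), and all later ones together at most
  half of that. Leaving out the digit 1, as for the Cantor set, excludes ambiguous
  expansions.\<close>

lemma ternary_separation:
  fixes a b :: "nat \<Rightarrow> bool"
  defines "v \<equiv> \<lambda>a. (\<Sum>i. (if a i then 2 else 0) / 3 ^ Suc i :: real)"
  assumes ne: "a i \<noteq> b i" and eq: "\<And>j. j < i \<Longrightarrow> a j = b j"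
  shows "\<bar>v a - v b\<bar> \<ge> 1 / 3 ^ Suc i"
proof -
  define u where "u a i = (if a i then 2 else 0) / (3::real) ^ Suc i" for a :: "nat \<Rightarrow> bool" and i
  have geo: "(\<lambda>l. 2 / (3::real) ^ Suc (l + n)) sums (1 / 3 ^ n)" for n
  proof -
    have "(\<lambda>l. 2 / 3 ^ Suc n * (1 / 3 :: real) ^ l) sums (2 / 3 ^ Suc n * (1 / (1 - 1 / 3)))"
      by (intro sums_mult geometric_sums) simp
    moreover have "2 / 3 ^ Suc n * (1 / 3 :: real) ^ l = 2 / 3 ^ Suc (l + n)" for l
      by (simp add: power_add power_divide)
    ultimately show ?thesis by simp
  qed
  have sm: "summable (u a)" for a
    by (rule summable_comparison_test'[OF sums_summable[OF geo[of 0]], where N = 0]) (auto simp: u_def)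
  have main: "v a - v b \<ge> 1 / 3 ^ Suc i" if "a i" "\<not> b i" and eq: "\<And>j. j < i \<Longrightarrow> a j = b j" for a b
  proof -
    define d where "d j = u a j - u b j" for j
    have sd: "summable d" unfolding d_def by (intro summable_diff sm)
    have "suminf d = (\<Sum>j. d (j + Suc i)) + sum d {..<Suc i}"
      by (rule suminf_split_initial_segment[OF sd])
    moreover have "sum d {..<Suc i} = 2 / 3 ^ Suc i"
      using that by (auto simp: d_def u_def intro!: sum.neutral)
    moreover have "(\<Sum>j. d (j + Suc i)) \<ge> (\<Sum>j. - (2 / 3 ^ Suc (j + Suc i)))"
    proof (rule suminf_le)
      show "- (2 / 3 ^ Suc (j + Suc i)) \<le> d (j + Suc i)" for j by (auto simp: d_def u_def)
      show "summable (\<lambda>j. - (2 / (3::real) ^ Suc (j + Suc i)))" using geo[of "Suc i"] by (intro summable_minus) (auto simp: sums_iff)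
      show "summable (\<lambda>j. d (j + Suc i))" using sd by (simp only: summable_iff_shift)
    qed
    moreover have "(\<Sum>j. - (2 / (3::real) ^ Suc (j + Suc i))) = - (1 / 3 ^ Suc i)"
      using sums_minus[OF geo[of "Suc i"]] by (rule sums_unique[symmetric])
    moreover have "v a - v b = suminf d" unfolding v_def d_def u_def[symmetric] by (rule suminf_diff[OF sm sm])
    ultimately have "v a - v b \<ge> - (1 / 3 ^ Suc i) + 2 / 3 ^ Suc i" by linarith
    then show ?thesis by simp
  qed
  show ?thesis
  proof (cases "a i")
    case True
    then have "v a - v b \<ge> 1 / 3 ^ Suc i" using ne eq by (intro main) auto
    then show ?thesis by linarith
  next
    case False
    then have "v b - v a \<ge> 1 / 3 ^ Suc i" using ne eq by (intro main) auto
    then show ?thesis by linarith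
  qed
qed

text \<open>Points are coded by the ternary expansion recording membership in countably many balls; codes that
  agree up to a high digit belong to points that are close together.\<close>

lemma compact_metric_code:
  assumes "compact (UNIV :: 'a::metric_space set)"
  shows "\<exists>c :: 'a \<Rightarrow> real. (\<forall>x. 0 \<le> c x \<and> c x \<le> 1) \<and>
    (\<forall>e>0. \<exists>d>0. \<forall>x y. \<bar>c x - c y\<bar> < d \<longrightarrow> dist x y < e)"
proof -
  have "\<exists>C. finite C \<and> (UNIV :: 'a set) \<subseteq> (\<Union>x\<in>C. ball x (1 / real (Suc n)))" for n
  proof -
    have "seq_compact (UNIV :: 'a set)" using assms by (rule compact_imp_seq_compact)
    then show ?thesis using seq_compact_imp_totally_bounded[of "UNIV :: 'a set"] by auto
  qed
  then obtain C where C: "\<And>n. finite (C n)" "\<And>n. (UNIV :: 'a set) \<subseteq> (\<Union>x\<in>C n. ball x (1 / real (Suc n)))" by metis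
  define I where "I = (SIGMA n:(UNIV::nat set). C n)"
  have cI: "countable I" unfolding I_def using C(1) by (intro countable_SIGMA) (auto intro: countable_finite)
  define U where "U i = (let (n, z) = from_nat_into I i in ball z (1 / real (Suc n)))" for i
  \<comment> \<open>The code is in general discontinuous; what is used is that its inverse is
    uniformly continuous.\<close>
  define c where "c x = (\<Sum>i. (if x \<in> U i then 2 else 0) / 3 ^ Suc i :: real)" for x
  have geo: "(\<lambda>l. 2 / (3::real) ^ Suc l) sums 1"
    using sums_mult[OF geometric_sums[of "1/3::real"], of "2/3"] by (simp add: power_divide)
  have sm: "summable (\<lambda>i. (if x \<in> U i then 2 else 0) / (3::real) ^ Suc i)" for x
    by (rule summable_comparison_test'[OF sums_summable[OF geo], where N = 0]) auto
  have "0 \<le> c x" "c x \<le> 1" for x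
  proof -
    show "0 \<le> c x" unfolding c_def by (rule suminf_nonneg[OF sm]) auto
    have "c x \<le> (\<Sum>l. 2 / (3::real) ^ Suc l)" unfolding c_def by (rule suminf_le[OF _ sm sums_summable[OF geo]]) auto
    then show "c x \<le> 1" using geo by (simp add: sums_iff)
  qed
  moreover have "\<exists>d>0. \<forall>x y. \<bar>c x - c y\<bar> < d \<longrightarrow> dist x y < e" if e: "e > 0" for e
  proof -
    obtain n :: nat where "2 / e < real n" using reals_Archimedean2 by blast
    then have n: "2 / real (Suc n) < e" using e by (simp add: field_simps)
    \<comment> \<open>The digits below \<open>K\<close> include those of all balls in the finite
      cover \<open>C n\<close>, so codes agreeing that far put both points into a common
      ball.\<close>
    define K where "K = Suc (Max (to_nat_on I ` (\<lambda>z. (n, z)) ` C n))"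
    show ?thesis
    proof (intro exI[of _ "1 / 3 ^ K"] conjI allI impI)
      fix x y assume close: "\<bar>c x - c y\<bar> < 1 / 3 ^ K"
      have agree: "x \<in> U i \<longleftrightarrow> y \<in> U i" if "i < K" for i
      proof (rule ccontr)
        assume ne: "\<not> ?thesis"
        define i0 where "i0 = (LEAST i. (x \<in> U i) \<noteq> (y \<in> U i))"
        have i0: "(x \<in> U i0) \<noteq> (y \<in> U i0)" unfolding i0_def by (rule LeastI[of _ i]) (use ne in blast)
        have lt: "(x \<in> U j) = (y \<in> U j)" if "j < i0" for j using not_less_Least[of j "\<lambda>i. (x \<in> U i) \<noteq> (y \<in> U i)"] that by (auto simp: i0_def)
        have "i0 \<le> i" unfolding i0_def by (rule Least_le) (use ne in blast)
        have "1 / 3 ^ Suc i0 \<le> \<bar>c x - c y\<bar>" unfolding c_def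
          by (rule ternary_separation[of "\<lambda>i. x \<in> U i" i0 "\<lambda>i. y \<in> U i"]) (use i0 lt in auto)
        moreover have "1 / 3 ^ K \<le> (1::real) / 3 ^ Suc i0" using \<open>i0 \<le> i\<close> \<open>i < K\<close> by (intro divide_left_mono power_increasing) auto
        ultimately show False using close by linarith
      qed
      obtain z where z: "z \<in> C n" "x \<in> ball z (1 / real (Suc n))" using C(2)[of n] by blast
      define i where "i = to_nat_on I (n, z)"
      have "i < K" unfolding K_def i_def less_Suc_eq_le using z(1) C(1) by (intro Max_ge) auto
      have "(n, z) \<in> I" using z(1) by (simp add: I_def)
      then have "from_nat_into I i = (n, z)" using cI by (simp add: i_def)
      then have Ui: "U i = ball z (1 / real (Suc n))" by (simp add: U_def)
      have "y \<in> ball z (1 / real (Suc n))" using agree[OF \<open>i < K\<close>] z(2) unfolding Ui by blast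
      then have "dist x y < 1 / real (Suc n) + 1 / real (Suc n)"
        using z(2) dist_triangle2[of x y z] by (simp add: dist_commute)
      then show "dist x y < e" using n by simp
    qed simp
  qed
  ultimately show ?thesis by blast
qed

text \<open>The code moves the averages to the real line, where Helly's selection theorem applies to
  measures carried by [0, 1]. The limit is brought back by the inverse \<open>h\<close> of the code,
  extended continuously to the closure \<open>K\<close> of its range.\<close>

lemma empirical_measures_limit:
  fixes y :: "nat \<Rightarrow> nat \<Rightarrow> 'a::metric_space" and H :: "nat \<Rightarrow> nat"
  assumes comp: "compact (UNIV :: 'a set)" and H: "\<And>n. H n > 0"
  shows "\<exists>r \<nu>. strict_mono (r :: nat \<Rightarrow> nat) \<and> prob_space \<nu> \<and> sets \<nu> = sets borel \<and>
    (\<forall>f :: 'a \<Rightarrow> complex. continuous_on UNIV f \<longrightarrow>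
      (\<lambda>n. (\<Sum>k<H (r n). f (y (r n) k)) / of_nat (H (r n))) \<longlonglongrightarrow> (\<integral>x. f x \<partial>\<nu>))"
proof -
  obtain c :: "'a \<Rightarrow> real" where c: "\<And>x. 0 \<le> c x" "\<And>x. c x \<le> 1"
    and sep: "\<And>e. e > 0 \<Longrightarrow> \<exists>d>0. \<forall>x y. \<bar>c x - c y\<bar> < d \<longrightarrow> dist x y < e"
    using compact_metric_code[OF comp] by blast
  define K where "K = closure (range c)"
  have closedK: "closed K" by (simp add: K_def)
  have cK: "c x \<in> K" for x using closure_subset[of "range c"] by (auto simp: K_def)
  \<comment> \<open>A point t of the closure is a limit of codes, and by compactness the coded
    points accumulate at some z, which becomes h(t).\<close>
  have "\<exists>z. \<forall>e>0. \<exists>x. \<bar>c x - t\<bar> < e \<and> dist x z < e" if tK: "t \<in> K" for t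
  proof -
    obtain s where s: "\<forall>n. s n \<in> range c" "s \<longlonglongrightarrow> t" using tK unfolding K_def closure_sequential by blast
    from s(1) have "\<forall>n. \<exists>x. s n = c x" by (simp add: image_iff)
    then obtain x where x: "\<And>n. s n = c (x n)" unfolding choice_iff by (elim exE) simp
    obtain z r where zr: "strict_mono (r :: nat \<Rightarrow> nat)" "(x \<circ> r) \<longlonglongrightarrow> z"
      using compact_imp_seq_compact[OF comp] unfolding seq_compact_def by blast
    have l: "(\<lambda>n. c (x (r n))) \<longlonglongrightarrow> t" using LIMSEQ_subseq_LIMSEQ[OF s(2) zr(1)] by (simp add: o_def x)
    show ?thesis
    proof (rule exI[of _ z], intro allI impI)
      fix e :: real assume e: "e > 0"
      have "\<forall>\<^sub>F n in sequentially. dist (c (x (r n))) t < e \<and> dist ((x \<circ> r) n) z < e"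
        by (intro eventually_conj tendstoD l zr e)
      then obtain n where "dist (c (x (r n))) t < e" "dist (x (r n)) z < e" by (auto simp: eventually_sequentially)
      then show "\<exists>x. \<bar>c x - t\<bar> < e \<and> dist x z < e" by (auto simp: dist_real_def)
    qed
  qed
  then obtain h where h: "\<And>t e. t \<in> K \<Longrightarrow> e > 0 \<Longrightarrow> \<exists>x. \<bar>c x - t\<bar> < e \<and> dist x (h t) < e" by metis
  have hclose: "\<exists>d>0. \<forall>t\<in>K. \<forall>s\<in>K. \<bar>s - t\<bar> < d \<longrightarrow> dist (h s) (h t) < e" if e: "e > 0" for e
  proof -
    obtain d where d: "d > 0" "\<And>x y. \<bar>c x - c y\<bar> < d \<Longrightarrow> dist x y < e / 3" using sep[of "e/3"] e by auto
    have "dist (h s) (h t) < e" if ts: "t \<in> K" "s \<in> K" "\<bar>s - t\<bar> < d / 3" for t s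
    proof -
      obtain x where x: "\<bar>c x - t\<bar> < min (d/3) (e/3)" "dist x (h t) < min (d/3) (e/3)" using h[OF ts(1), of "min (d/3) (e/3)"] d(1) e by auto
      obtain w where w: "\<bar>c w - s\<bar> < min (d/3) (e/3)" "dist w (h s) < min (d/3) (e/3)" using h[OF ts(2), of "min (d/3) (e/3)"] d(1) e by auto
      have "\<bar>c w - c x\<bar> < d" using x w ts(3) by linarith
      then have "dist w x < e / 3" by (rule d(2))
      moreover have "dist (h s) (h t) \<le> dist (h s) w + dist w x + dist x (h t)"
        using dist_triangle[of "h s" "h t" w] dist_triangle[of w "h t" x] by linarith
      ultimately show ?thesis using x w by (simp add: dist_commute)
    qed
    then show ?thesis using d(1) by (intro exI[of _ "d/3"]) auto
  qed
  have hcont: "continuous_on K h"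
    unfolding continuous_on_iff dist_real_def using hclose by blast
  have hc: "h (c x) = x" for x
  proof (rule ccontr)
    assume "h (c x) \<noteq> x"
    then have e: "dist (h (c x)) x / 2 > 0" by simp
    obtain d where d: "d > 0" "\<And>u w. \<bar>c u - c w\<bar> < d \<Longrightarrow> dist u w < dist (h (c x)) x / 2" using sep[OF e] by auto
    obtain u where u: "\<bar>c u - c x\<bar> < min d (dist (h (c x)) x / 2)" "dist u (h (c x)) < min d (dist (h (c x)) x / 2)"
      using h[OF cK, of "min d (dist (h (c x)) x / 2)" x] d(1) e by auto
    have "dist u x < dist (h (c x)) x / 2" using u by (intro d(2)) auto
    then show False using u(2) dist_triangle[of "h (c x)" x u] by (simp add: dist_commute)
  qed
  define D where "D n = distr (measure_pmf (pmf_of_set {..<H n})) borel (\<lambda>k. c (y n k))" for n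
  have Hne: "{..<H n} \<noteq> {}" "finite {..<H n}" for n using H[of n] by auto
  have Dreal: "real_distribution (D n)" for n
    unfolding D_def by (rule prob_space.real_distribution_distr[OF measure_pmf.prob_space_axioms]) simp
  have Dint: "(\<integral>t. F t \<partial>D n) = (\<Sum>k<H n. F (c (y n k))) / of_nat (H n)" if F: "continuous_on UNIV F" for F :: "real \<Rightarrow> complex" and n
  proof -
    have "(\<integral>t. F t \<partial>D n) = (\<integral>k. F (c (y n k)) \<partial>measure_pmf (pmf_of_set {..<H n}))"
      unfolding D_def by (rule integral_distr) (auto intro: borel_measurable_continuous_onI F)
    also have "\<dots> = (\<Sum>k<H n. pmf (pmf_of_set {..<H n}) k *\<^sub>R F (c (y n k)))"
      by (rule integral_measure_pmf) (use Hne in \<open>auto simp: set_pmf_of_set\<close>)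
    also have "\<dots> = (\<Sum>k<H n. F (c (y n k)) / of_nat (H n))"
      using Hne by (intro sum.cong) (auto simp: scaleR_conv_of_real)
    finally show ?thesis by (simp add: sum_divide_distrib)
  qed
  have tight: "tight D"
    unfolding tight_def
  proof (intro conjI allI impI Dreal)
    fix \<epsilon> :: real assume \<epsilon>: "\<epsilon> > 0"
    \<comment> \<open>Tightness uses intervals open on the left, so the left end has to lie below
      the possible code value 0.\<close>
    have "measure (D n) {-1<..1} = 1" for n
    proof -
      have cpos: "-1 < c x" for x using c(1)[of x] by linarith
      have "measure (D n) {-1<..1} = measure (measure_pmf (pmf_of_set {..<H n})) ((\<lambda>k. c (y n k)) -` {-1<..1})"
        unfolding D_def by (subst measure_distr) auto
      also have "(\<lambda>k. c (y n k)) -` {-1<..1} = UNIV" using c(2) cpos by auto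
      finally show ?thesis by simp
    qed
    then show "\<exists>a b. a < b \<and> (\<forall>n. 1 - \<epsilon> < measure (D n) {a<..b})"
      using \<epsilon> by (intro exI[of _ "-1"] exI[of _ 1]) auto
  qed
  obtain r M where rM: "strict_mono (r :: nat \<Rightarrow> nat)" "real_distribution M" "weak_conv_m (D \<circ> id \<circ> r) M"
    using tight_imp_convergent_subsubsequence[OF tight strict_mono_id] by blast
  interpret M: real_distribution M by fact
  have conv: "(\<lambda>n. (\<Sum>k<H (r n). F (c (y (r n) k))) / of_nat (H (r n))) \<longlonglongrightarrow> (\<integral>t. F t \<partial>M)"
    if F: "continuous_on UNIV F" "\<And>t. norm (F t) \<le> B" for F :: "real \<Rightarrow> complex" and B
  proof -
    have "(\<lambda>n. \<integral>t. F t \<partial>(D \<circ> id \<circ> r) n) \<longlonglongrightarrow> (\<integral>t. F t \<partial>M)"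
      by (rule weak_conv_imp_integral_bdd_continuous_conv[OF _ rM(2,3) _ F(2)])
         (use Dreal F(1) in \<open>auto simp: continuous_on_eq_continuous_at\<close>)
    then show ?thesis by (simp add: Dint[OF F(1)])
  qed
  \<comment> \<open>The continuous function min 1 (dist to K) vanishes at all code values, so its
    averages along the sequence and hence its integral are 0.\<close>
  have AEK: "AE t in M. t \<in> K"
  proof -
    define u where "u t = min 1 (infdist t K)" for t
    have uc: "continuous_on UNIV u" unfolding u_def by (intro continuous_intros continuous_on_infdist)
    have u01: "0 \<le> u t" "u t \<le> 1" for t using infdist_nonneg[of t K] by (auto simp: u_def)
    have "(\<lambda>n. (\<Sum>k<H (r n). complex_of_real (u (c (y (r n) k)))) / of_nat (H (r n))) \<longlonglongrightarrow> (\<integral>t. complex_of_real (u t) \<partial>M)"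
      by (rule conv[of "\<lambda>t. complex_of_real (u t)" 1]) (use u01 uc in \<open>auto intro!: continuous_intros\<close>)
    moreover have "u (c x) = 0" for x using cK by (simp add: u_def)
    ultimately have "(\<integral>t. complex_of_real (u t) \<partial>M) = 0" by (simp add: LIMSEQ_const_iff)
    then have i0: "(\<integral>t. u t \<partial>M) = 0" by simp
    have "u \<in> borel_measurable M" using borel_measurable_continuous_onI[OF uc] by (simp cong: measurable_cong_sets)
    then have "integrable M u" by (intro M.integrable_const_bound[where B = 1]) (use u01 in auto)
    then have "AE t in M. u t = 0" using i0 u01 by (subst (asm) integral_nonneg_eq_0_iff_AE) auto
    then show ?thesis
    proof eventually_elim
      case (elim t)
      then have "infdist t K = 0" by (simp add: u_def min_def split: if_splits)
      moreover have "K \<noteq> {}" using cK by blast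
      ultimately show ?case using closedK in_closed_iff_infdist_zero by blast
    qed
  qed
  \<comment> \<open>\<open>h\<close> is only controlled on \<open>K\<close>; a constant value
    elsewhere keeps the map Borel measurable and does not affect integrals, as \<open>K\<close> has
    full measure.\<close>
  define \<phi> where "\<phi> t = (if t \<in> K then h t else undefined)" for t
  have \<phi>: "\<phi> \<in> measurable borel borel"
    unfolding \<phi>_def using closedK borel_measurable_continuous_on_restrict[OF hcont]
    by (subst measurable_If_restrict_space_iff) auto
  have \<phi>M: "\<phi> \<in> measurable M borel" using \<phi> by (simp cong: measurable_cong_sets)
  define \<nu> where "\<nu> = distr M borel \<phi>"
  show ?thesis
  proof (intro exI[of _ r] exI[of _ \<nu>] conjI allI impI rM(1))
    show "prob_space \<nu>" unfolding \<nu>_def by (rule M.prob_space_distr[OF \<phi>M])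
    show "sets \<nu> = sets borel" by (simp add: \<nu>_def)
    fix f :: "'a \<Rightarrow> complex" assume f: "continuous_on UNIV f"
    have "bounded (range f)" using compact_imp_bounded[OF compact_continuous_image[OF f comp]] .
    then obtain B where B: "\<And>x. norm (f x) \<le> B" by (auto simp: bounded_iff)
    then have B0: "B \<ge> 0" using norm_ge_zero order_trans by blast
    have fh: "continuous_on K (\<lambda>t. f (h t))"
      by (rule continuous_on_compose2[OF f hcont]) auto
    \<comment> \<open>Weak convergence tests bounded continuous functions on the whole line, so f
      composed with h is extended from \<open>K\<close> by Tietze's theorem.\<close>
    obtain F where F: "continuous_on UNIV F" "\<And>t. t \<in> K \<Longrightarrow> F t = f (h t)" "\<And>t. norm (F t) \<le> B"
      by (rule Tietze[OF fh, of UNIV B]) (use closedK B B0 in auto)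
    have "(\<lambda>n. (\<Sum>k<H (r n). F (c (y (r n) k))) / of_nat (H (r n))) \<longlonglongrightarrow> (\<integral>t. F t \<partial>M)"
      by (rule conv[OF F(1,3)])
    moreover have "F (c x) = f x" for x using F(2)[OF cK] hc by simp
    moreover have "(\<integral>t. F t \<partial>M) = (\<integral>t. f (\<phi> t) \<partial>M)"
    proof (rule integral_cong_AE)
      show "AE t in M. F t = f (\<phi> t)" using AEK by eventually_elim (simp add: F(2) \<phi>_def)
      show "F \<in> borel_measurable M" using borel_measurable_continuous_onI[OF F(1)] by (simp cong: measurable_cong_sets)
      show "(\<lambda>t. f (\<phi> t)) \<in> borel_measurable M"
        using measurable_compose[OF \<phi>M borel_measurable_continuous_onI[OF f]] .
    qed
    moreover have "(\<integral>t. f (\<phi> t) \<partial>M) = (\<integral>x. f x \<partial>\<nu>)"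
      unfolding \<nu>_def by (rule integral_distr[symmetric, OF \<phi>M borel_measurable_continuous_onI[OF f]])
    ultimately show "(\<lambda>n. (\<Sum>k<H (r n). f (y (r n) k)) / of_nat (H (r n))) \<longlonglongrightarrow> (\<integral>x. f x \<partial>\<nu>)" by simp
  qed
qed

text \<open>Otherwise there is a bad starting point for every length. A weak limit of the
  corresponding empirical measures is invariant, since the sums of g(T x) and g(x) along an orbit
  differ by two boundary terms; so it equals \<mu>, against the lower bound \<epsilon>.\<close>

theorem uniquely_ergodic_uniform:
  fixes T :: "'a::metric_space \<Rightarrow> 'a" and f :: "'a \<Rightarrow> complex"
  assumes comp: "compact (UNIV :: 'a set)" and T: "continuous_on UNIV T"
    and ue: "uniquely_ergodic T" and \<mu>: "invariant_borel_prob T \<mu>" and f: "continuous_on UNIV f" and \<epsilon>: "\<epsilon> > 0"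
  shows "\<exists>H>0. \<forall>x. norm ((\<Sum>k<H. f ((T ^^ k) x)) / of_nat H - (\<integral>y. f y \<partial>\<mu>)) \<le> \<epsilon>"
proof (rule ccontr)
  assume neg: "\<not> ?thesis"
  have "\<exists>x. norm ((\<Sum>k<Suc n. f ((T ^^ k) x)) / of_nat (Suc n) - (\<integral>y. f y \<partial>\<mu>)) > \<epsilon>" for n
    using neg by (metis not_le zero_less_Suc)
  then obtain x where x: "\<And>n. norm ((\<Sum>k<Suc n. f ((T ^^ k) (x n))) / of_nat (Suc n) - (\<integral>y. f y \<partial>\<mu>)) > \<epsilon>" by metis
  obtain r \<nu> where r: "strict_mono (r :: nat \<Rightarrow> nat)" and \<nu>: "prob_space \<nu>" "sets \<nu> = sets borel"
    and lim: "\<And>g :: 'a \<Rightarrow> complex. continuous_on UNIV g \<Longrightarrow>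
      (\<lambda>n. (\<Sum>k<Suc (r n). g ((T ^^ k) (x (r n)))) / of_nat (Suc (r n))) \<longlonglongrightarrow> (\<integral>x. g x \<partial>\<nu>)"
    using empirical_measures_limit[OF comp, of Suc "\<lambda>n k. (T ^^ k) (x n)"] by auto
  have Tm: "T \<in> measurable \<nu> borel"
    using borel_measurable_continuous_onI[OF T] \<nu>(2) by (simp cong: measurable_cong_sets)
  have "distr \<nu> borel T = \<nu>"
  proof (rule finite_measure_eqI_continuous)
    show "prob_space (distr \<nu> borel T)" by (rule prob_space.prob_space_distr[OF \<nu>(1) Tm])
    fix g :: "'a \<Rightarrow> real" assume g: "continuous_on UNIV g" "\<And>x. 0 \<le> g x \<and> g x \<le> 1"
    let ?g = "\<lambda>x. complex_of_real (g x)"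
    have gc: "continuous_on UNIV ?g" using g(1) by (intro continuous_intros)
    have gT: "continuous_on UNIV (\<lambda>x. ?g (T x))" by (rule continuous_on_compose2[OF gc T]) auto
    let ?A = "\<lambda>h n. (\<Sum>k<Suc (r n). h ((T ^^ k) (x (r n)))) / of_nat (Suc (r n)) :: complex"
    have "(\<lambda>n. ?A (\<lambda>x. ?g (T x)) n - ?A ?g n) \<longlonglongrightarrow> (\<integral>x. ?g (T x) \<partial>\<nu>) - (\<integral>x. ?g x \<partial>\<nu>)"
      by (intro tendsto_diff lim gc gT)
    moreover have "(\<lambda>n. ?A (\<lambda>x. ?g (T x)) n - ?A ?g n) \<longlonglongrightarrow> 0"
    proof (rule Lim_null_comparison)
      show "\<forall>\<^sub>F n in sequentially. norm (?A (\<lambda>x. ?g (T x)) n - ?A ?g n) \<le> 2 / real (Suc (r n))"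
      proof (intro always_eventually allI)
        fix n
        have "(\<Sum>k<m. ?g (T ((T ^^ k) z))) - (\<Sum>k<m. ?g ((T ^^ k) z)) = ?g ((T ^^ m) z) - ?g z" for m z
        proof (induction m)
          case (Suc m)
          have "(\<Sum>k<Suc m. ?g (T ((T ^^ k) z))) - (\<Sum>k<Suc m. ?g ((T ^^ k) z)) =
            ((\<Sum>k<m. ?g (T ((T ^^ k) z))) - (\<Sum>k<m. ?g ((T ^^ k) z))) + (?g ((T ^^ Suc m) z) - ?g ((T ^^ m) z))" by simp
          then show ?case unfolding Suc by simp
        qed simp
        then have "?A (\<lambda>x. ?g (T x)) n - ?A ?g n = (?g ((T ^^ Suc (r n)) (x (r n))) - ?g (x (r n))) / of_nat (Suc (r n))"
          by (simp only: diff_divide_distrib[symmetric])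
        then have "norm (?A (\<lambda>x. ?g (T x)) n - ?A ?g n) = norm (?g ((T ^^ Suc (r n)) (x (r n))) - ?g (x (r n))) / real (Suc (r n))"
          by (simp only: norm_divide norm_of_nat)
        also have "norm (?g ((T ^^ Suc (r n)) (x (r n))) - ?g (x (r n))) \<le> 1 + 1"
          by (rule order_trans[OF norm_triangle_ineq4 add_mono]) (use g(2) in auto)
        finally show "norm (?A (\<lambda>x. ?g (T x)) n - ?A ?g n) \<le> 2 / real (Suc (r n))" by (simp add: divide_right_mono)
      qed
      have "(\<lambda>n. 2 * inverse (real (Suc n))) \<longlonglongrightarrow> 2 * 0" by (intro tendsto_mult tendsto_const LIMSEQ_inverse_real_of_nat)
      then have "((\<lambda>n. 2 / real (Suc n)) \<circ> r) \<longlonglongrightarrow> 0" using r by (intro LIMSEQ_subseq_LIMSEQ) (auto simp: divide_inverse)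
      then show "(\<lambda>n. 2 / real (Suc (r n))) \<longlonglongrightarrow> 0" by (simp add: o_def)
    qed
    ultimately have "(\<integral>x. ?g (T x) \<partial>\<nu>) - (\<integral>x. ?g x \<partial>\<nu>) = 0" by (rule LIMSEQ_unique)
    then have "(\<integral>x. g (T x) \<partial>\<nu>) = (\<integral>x. g x \<partial>\<nu>)" by simp
    moreover have "(\<integral>x. g x \<partial>distr \<nu> borel T) = (\<integral>x. g (T x) \<partial>\<nu>)"
      by (rule integral_distr[OF Tm borel_measurable_continuous_onI[OF g(1)]])
    ultimately show "(\<integral>x. g x \<partial>distr \<nu> borel T) = (\<integral>x. g x \<partial>\<nu>)" by simp
  qed (use \<nu> in auto)
  then have "emeasure \<nu> (T -` A) = emeasure \<nu> A" if "A \<in> sets borel" for A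
    using emeasure_distr[OF Tm that] \<nu>(2) sets_eq_imp_space_eq[OF \<nu>(2)] by simp
  then have "invariant_borel_prob T \<nu>" using \<nu> by (simp add: invariant_borel_prob_def)
  then have "\<nu> = \<mu>" using ue \<mu> unfolding uniquely_ergodic_def by blast
  then have "\<forall>\<^sub>F n in sequentially. dist ((\<Sum>k<Suc (r n). f ((T ^^ k) (x (r n)))) / of_nat (Suc (r n))) (\<integral>y. f y \<partial>\<mu>) < \<epsilon>"
    using tendstoD[OF lim[OF f] \<epsilon>] by simp
  then obtain n where "dist ((\<Sum>k<Suc (r n). f ((T ^^ k) (x (r n)))) / of_nat (Suc (r n))) (\<integral>y. f y \<partial>\<mu>) < \<epsilon>"
    by (auto simp: eventually_sequentially)
  with x[of "r n"] show False by (simp only: dist_norm)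
qed

section \<open>Exponential weights\<close>

text \<open>By \<open>prime_window\<close> for the trivial character, the window at j has reciprocal
  mass at least c/j, the windows are disjoint, and the harmonic series diverges.\<close>

lemma prime_reciprocals_unbounded:
  "\<exists>P. finite P \<and> (\<forall>p\<in>P. prime p) \<and> (\<Sum>p\<in>P. 1 / real p) \<ge> B"
proof -
  interpret o: dchar "\<lambda>_. 1" 1 by (rule dchar_one)
  define W where "W v = {p \<in> window (1/4) v. prime p}" for v
  have finW: "finite (W v)" for v unfolding W_def by (rule finite_subset[OF _ finite_window[of "1/4" v]]) auto
  have "\<exists>k \<kappa> M. \<kappa> > 0 \<and> M > 0 \<and> (\<forall>x::real. 0 \<le> k x \<and> k x \<le> M) \<and>
    (\<forall>\<^sub>F v in at_top. \<bar>(\<Sum>p\<in>W v. k (ln (real p) - v) * (ln (real p) / real p)) - \<kappa>\<bar> \<le> 1/2 * \<kappa> \<and>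
      (o.mean = 0 \<longrightarrow> norm (\<Sum>p\<in>W v. of_real (k (ln (real p) - v) * (ln (real p) / real p)) * (1 :: complex)) \<le> 1/2 * \<kappa>))"
    unfolding W_def by (rule o.prime_window) simp_all
  then obtain k :: "real \<Rightarrow> real" and \<kappa> M where k0: "\<kappa> > 0" "M > 0" "\<forall>x. 0 \<le> k x \<and> k x \<le> M"
    and ev0: "\<forall>\<^sub>F v in at_top. \<bar>(\<Sum>p\<in>W v. k (ln (real p) - v) * (ln (real p) / real p)) - \<kappa>\<bar> \<le> 1/2 * \<kappa> \<and>
      (o.mean = 0 \<longrightarrow> norm (\<Sum>p\<in>W v. of_real (k (ln (real p) - v) * (ln (real p) / real p)) * (1 :: complex)) \<le> 1/2 * \<kappa>)"
    by (elim exE conjE) (rule that)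
  have k: "\<kappa> > 0" "M > 0" "\<And>x. 0 \<le> k x" "\<And>x. k x \<le> M" using k0 by auto
  have ev: "\<forall>\<^sub>F v in at_top. \<bar>(\<Sum>p\<in>W v. k (ln (real p) - v) * (ln (real p) / real p)) - \<kappa>\<bar> \<le> 1/2 * \<kappa>"
    by (rule eventually_mono[OF ev0]) blast
  from ev obtain V where V: "\<And>v. v \<ge> V \<Longrightarrow> \<bar>(\<Sum>p\<in>W v. k (ln (real p) - v) * (ln (real p) / real p)) - \<kappa>\<bar> \<le> 1/2 * \<kappa>"
    unfolding eventually_at_top_linorder by blast
  define J where "J = nat \<lceil>max 1 V\<rceil>"
  have J: "J \<ge> 1" "V \<le> real J" unfolding J_def by linarith+
  \<comment> \<open>On the window of j one has k \<le> M and log p \<le> 2j, so \<kappa>/2 is at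
    most 2 M j times the sum of 1/p.\<close>
  define c where "c = \<kappa> / (4 * M)"
  have c: "c > 0" using k by (simp add: c_def)
  have low: "(\<Sum>p\<in>W (real j). 1 / real p) \<ge> c * (1 / real j)" if "j \<ge> J" for j
  proof -
    have j: "real j \<ge> 1" "real j \<ge> V" using that J by auto
    have "\<kappa> / 2 \<le> (\<Sum>p\<in>W (real j). k (ln (real p) - real j) * (ln (real p) / real p))"
      using abs_le_D2[OF V[OF j(2)]] by linarith
    also have "\<dots> \<le> (\<Sum>p\<in>W (real j). M * (2 * real j / real p))"
    proof (rule sum_mono)
      fix p assume "p \<in> W (real j)"
      then have "p \<ge> 1" "\<bar>real j - ln (real p)\<bar> \<le> 1/4" unfolding W_def window_def by auto
      then have p: "p \<ge> 1" "ln (real p) \<le> real j + 1/4" by linarith+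
      then show "k (ln (real p) - real j) * (ln (real p) / real p) \<le> M * (2 * real j / real p)"
        using k j by (intro mult_mono divide_right_mono) auto
    qed
    also have "\<dots> = M * (2 * real j) * (\<Sum>p\<in>W (real j). 1 / real p)" by (simp add: sum_distrib_left)
    finally have "\<kappa> / 2 \<le> M * (2 * real j) * (\<Sum>p\<in>W (real j). 1 / real p)" .
    then show ?thesis using k j by (simp add: c_def field_simps)
  qed
  obtain N where N: "(\<Sum>j\<in>{J..<N}. 1 / real j) \<ge> B / c" using log_weights_unbounded[of "B / c" J] by blast
  define P where "P = (\<Union>j\<in>{J..<N}. W (real j))"
  have disj: "W (real i) \<inter> W (real j) = {}" if "i \<noteq> j" for i j :: nat
  proof (rule ccontr)
    assume "\<not> ?thesis"
    then obtain p where "\<bar>real i - ln (real p)\<bar> \<le> 1/4" "\<bar>real j - ln (real p)\<bar> \<le> 1/4" by (auto simp: W_def window_def)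
    then have "\<bar>real i - real j\<bar> < 1" by linarith
    then show False using that by linarith
  qed
  have "(\<Sum>p\<in>P. 1 / real p) = (\<Sum>j\<in>{J..<N}. \<Sum>p\<in>W (real j). 1 / real p)"
    unfolding P_def by (rule sum.UNION_disjoint) (use finW disj in auto)
  also have "\<dots> \<ge> (\<Sum>j\<in>{J..<N}. c * (1 / real j))" by (intro sum_mono low) auto
  also have "(\<Sum>j\<in>{J..<N}. c * (1 / real j)) = c * (\<Sum>j\<in>{J..<N}. 1 / real j)" by (rule sum_distrib_left[symmetric])
  also have "c * (\<Sum>j\<in>{J..<N}. 1 / real j) \<ge> B" using N c by (simp add: pos_divide_le_eq mult.commute)
  finally show ?thesis using finW by (intro exI[of _ P]) (auto simp: P_def W_def)
qed

section \<open>Katai's orthogonality argument\<close>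

lemma e2pi_add: "e2pi (x + y) = e2pi x * e2pi y"
  by (simp add: e2pi_def exp_add[symmetric] distrib_left)

lemma norm_e2pi [simp]: "norm (e2pi x) = 1"
proof -
  have "e2pi x = exp (\<i> * of_real (2 * pi * x))" by (simp add: e2pi_def ac_simps)
  then show ?thesis by simp
qed

lemma cnj_e2pi: "cnj (e2pi x) = e2pi (- x)"
  by (simp add: e2pi_def exp_cnj)

lemma e2pi_eq_1_iff: "e2pi x = 1 \<longleftrightarrow> x \<in> \<int>"
proof
  assume "e2pi x = 1"
  then have "exp (2 * of_real pi * \<i> * of_real x) = 1" by (simp add: e2pi_def)
  then obtain n :: int where "2 * pi * x = of_int (2 * n) * pi" by (subst (asm) exp_eq_1) auto
  then have "x = of_int n" by simp
  then show "x \<in> \<int>" by simp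
next
  assume "x \<in> \<int>"
  then obtain n where "x = of_int n" by (rule Ints_cases)
  then show "e2pi x = 1" unfolding e2pi_def by (subst exp_eq_1) (auto intro!: exI[of _ n])
qed

lemma e2pi_of_nat_mult: "e2pi (real n * x) = e2pi x ^ n"
proof (induction n)
  case 0
  show ?case by (simp add: e2pi_def)
next
  case (Suc n)
  have "e2pi (real (Suc n) * x) = e2pi (x + real n * x)" by (simp add: distrib_right)
  then show ?case by (simp add: e2pi_add Suc)
qed

lemma e2pi_geometric_bound:
  assumes "x \<notin> \<int>" shows "norm (\<Sum>n=1..N. e2pi (real n * x)) \<le> 2 / norm (1 - e2pi x)"
proof -
  have ne: "e2pi x \<noteq> 1" using assms e2pi_eq_1_iff by blast
  have "(\<Sum>n=1..N. e2pi (real n * x)) = (\<Sum>n=1..N. e2pi x ^ n)" by (simp only: e2pi_of_nat_mult)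
  also have "(1 - e2pi x) * \<dots> = e2pi x - e2pi x ^ Suc N"
  proof (induction N)
    case (Suc N)
    have "(1 - e2pi x) * (\<Sum>n=1..Suc N. e2pi x ^ n) = (1 - e2pi x) * (\<Sum>n=1..N. e2pi x ^ n) + (1 - e2pi x) * e2pi x ^ Suc N"
      by (simp add: distrib_left)
    also have "\<dots> = e2pi x - e2pi x ^ Suc N + (1 - e2pi x) * e2pi x ^ Suc N" by (simp only: Suc)
    also have "\<dots> = e2pi x - e2pi x ^ Suc (Suc N)" by (simp add: algebra_simps)
    finally show ?case .
  qed simp
  finally have "norm (1 - e2pi x) * norm (\<Sum>n=1..N. e2pi (real n * x)) = norm (e2pi x - e2pi x ^ Suc N)"
    by (simp only: norm_mult[symmetric])
  also have "\<dots> \<le> 1 + 1"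
    by (rule order_trans[OF norm_triangle_ineq4]) (simp add: norm_mult norm_power)
  finally show ?thesis using ne by (simp add: pos_le_divide_eq mult.commute)
qed

text \<open>After Turan-Kubilius every p in \<open>P\<close> meets the same factor a(Omega(m) + 1),
  so Cauchy-Schwarz in m removes \<open>a\<close>. What is left are correlations of e(pm\<alpha>)
  and e(rm\<alpha>), geometric sums that stay bounded for p \<noteq> r because (p - r)\<alpha> is
  not an integer.\<close>

theorem e2pi_Omega_irrational:
  fixes a :: "nat \<Rightarrow> complex"
  assumes \<alpha>: "\<alpha> \<notin> \<rat>" and a: "\<And>k. norm (a k) \<le> 1"
  shows "(\<lambda>N. (\<Sum>n=1..N. e2pi (real n * \<alpha>) * a (prime_Omega n)) / of_nat N) \<longlonglongrightarrow> 0"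
proof (rule tendstoI)
  fix \<epsilon> :: real assume \<epsilon>: "\<epsilon> > 0"
  \<comment> \<open>The final comparison 2 sqrt (2A) < A \<epsilon> asks for A > 8/\<epsilon>^2; the
    bound chosen leaves a margin.\<close>
  obtain P where P0: "finite P" "\<forall>p\<in>P. prime p" and Pbig: "(\<Sum>p\<in>P. 1 / real p) \<ge> 1 + 16 / \<epsilon>\<^sup>2"
    using prime_reciprocals_unbounded[of "1 + 16 / \<epsilon>\<^sup>2"] by (elim exE conjE) (rule that)
  have P: "finite P" "\<And>p. p \<in> P \<Longrightarrow> prime p" using P0 by auto
  define A where "A = (\<Sum>p\<in>P. 1 / real p)"
  have "16 / \<epsilon>\<^sup>2 > 0" using \<epsilon> by simp
  then have A: "A > 0" "A > 16 / \<epsilon>\<^sup>2" using Pbig unfolding A_def by linarith+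
  \<comment> \<open>The diagonal terms p = r are 2/0 = 0, so the sum may run over all pairs. The
    bound does not depend on N.\<close>
  define C where "C = (\<Sum>p\<in>P. \<Sum>r\<in>P. 2 / norm (1 - e2pi ((real p - real r) * \<alpha>)))"
  define c where "c n = e2pi (real n * \<alpha>) * a (prime_Omega n)" for n
  have cn: "norm (c n) \<le> 1" for n using a by (simp add: c_def norm_mult)
  have tk: "norm (of_real A * (\<Sum>n=1..N. c n) - (\<Sum>p\<in>P. \<Sum>m=1..N div p. c (p * m))) \<le> sqrt (real N * (real N * A + 2 * A * real (card P)))" for N
    using turan_kubilius[OF P, of "\<lambda>_. 1" c N] cn by (simp add: A_def)
  have bil: "norm (\<Sum>p\<in>P. \<Sum>m=1..N div p. c (p * m)) \<le> sqrt (real N * (real N * A + C))" for N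
  proof -
    \<comment> \<open>The exponentials of all p for one m; the cut-off at N div p gives them a
      common range of summation, so that the two sums can be exchanged.\<close>
    define D where "D m = (\<Sum>p\<in>P. if m \<le> N div p then e2pi (real (p * m) * \<alpha>) else 0)" for m
    have "(\<Sum>p\<in>P. \<Sum>m=1..N div p. c (p * m)) = (\<Sum>p\<in>P. \<Sum>m=1..N. if m \<le> N div p then e2pi (real (p * m) * \<alpha>) * a (Suc (prime_Omega m)) else 0)"
    proof (rule sum.cong[OF refl])
      fix p assume p: "p \<in> P"
      have "(\<Sum>m=1..N div p. c (p * m)) = (\<Sum>m=1..N div p. e2pi (real (p * m) * \<alpha>) * a (Suc (prime_Omega m)))"
        by (intro sum.cong) (auto simp: c_def prime_Omega_mult_prime[OF P(2)[OF p]])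
      also have "\<dots> = (\<Sum>m\<in>{m \<in> {1..N}. m \<le> N div p}. e2pi (real (p * m) * \<alpha>) * a (Suc (prime_Omega m)))"
        by (rule sum.cong) (auto intro: order_trans[OF _ div_le_dividend])
      finally show "(\<Sum>m=1..N div p. c (p * m)) = (\<Sum>m=1..N. if m \<le> N div p then e2pi (real (p * m) * \<alpha>) * a (Suc (prime_Omega m)) else 0)"
        by (simp only: sum.inter_filter[OF finite_atLeastAtMost])
    qed
    also have "\<dots> = (\<Sum>m=1..N. D m * a (Suc (prime_Omega m)))"
      unfolding D_def sum_distrib_right by (subst sum.swap) (auto intro!: sum.cong)
    finally have "norm (\<Sum>p\<in>P. \<Sum>m=1..N div p. c (p * m)) \<le> (\<Sum>m=1..N. norm (D m * a (Suc (prime_Omega m))))"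
      by (simp only: norm_sum)
    also have "\<dots> \<le> (\<Sum>m=1..N. 1 * norm (D m))"
    proof (rule sum_mono)
      fix m show "norm (D m * a (Suc (prime_Omega m))) \<le> 1 * norm (D m)"
        unfolding norm_mult using mult_left_mono[OF a, of "norm (D m)"] by simp
    qed
    also have "\<dots> \<le> sqrt (real N * (\<Sum>m=1..N. (norm (D m))\<^sup>2))"
    proof (rule real_le_rsqrt)
      have "(\<Sum>m=1..N. 1 * norm (D m))\<^sup>2 \<le> (\<Sum>m=1..N. 1\<^sup>2) * (\<Sum>m=1..N. (norm (D m))\<^sup>2)"
        by (rule Cauchy_Schwarz_ineq_sum)
      then show "(\<Sum>m=1..N. 1 * norm (D m))\<^sup>2 \<le> real N * (\<Sum>m=1..N. (norm (D m))\<^sup>2)" by simp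
    qed
    also have "(\<Sum>m=1..N. (norm (D m))\<^sup>2) \<le> real N * A + C"
    proof -
      define g where "g p m = (if m \<le> N div p then e2pi (real (p * m) * \<alpha>) else 0)" for p m :: nat
      have "complex_of_real (\<Sum>m=1..N. (norm (D m))\<^sup>2) = (\<Sum>m=1..N. \<Sum>p\<in>P. \<Sum>r\<in>P. g p m * cnj (g r m))"
        unfolding of_real_sum complex_norm_square D_def g_def[symmetric] cnj_sum sum_product ..
      also have "\<dots> = (\<Sum>p\<in>P. \<Sum>r\<in>P. \<Sum>m=1..N. g p m * cnj (g r m))"
        by (rule trans[OF sum.swap sum.cong[OF refl sum.swap]])
      finally have "norm (complex_of_real (\<Sum>m=1..N. (norm (D m))\<^sup>2)) = norm (\<Sum>p\<in>P. \<Sum>r\<in>P. \<Sum>m=1..N. g p m * cnj (g r m))"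
        by (simp only:)
      moreover have "\<bar>\<Sum>m=1..N. (norm (D m))\<^sup>2\<bar> = (\<Sum>m=1..N. (norm (D m))\<^sup>2)" by (intro abs_of_nonneg sum_nonneg) simp
      ultimately have "(\<Sum>m=1..N. (norm (D m))\<^sup>2) = norm (\<Sum>p\<in>P. \<Sum>r\<in>P. \<Sum>m=1..N. g p m * cnj (g r m))"
        by (simp only: norm_of_real)
      also have "\<dots> \<le> (\<Sum>p\<in>P. \<Sum>r\<in>P. (if r = p then real N / real p else 0) + 2 / norm (1 - e2pi ((real p - real r) * \<alpha>)))"
      proof (intro sum_norm_le)
        fix p r assume p: "p \<in> P" and r: "r \<in> P"
        have "(\<Sum>m=1..N. g p m * cnj (g r m)) = (\<Sum>m=1..N. if m \<le> N div p \<and> m \<le> N div r then e2pi (real m * ((real p - real r) * \<alpha>)) else 0)"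
        proof (intro sum.cong refl)
          fix m
          have "e2pi (real (p * m) * \<alpha>) * cnj (e2pi (real (r * m) * \<alpha>)) = e2pi (real m * ((real p - real r) * \<alpha>))"
            unfolding cnj_e2pi e2pi_add[symmetric] by (simp add: algebra_simps)
          then show "g p m * cnj (g r m) = (if m \<le> N div p \<and> m \<le> N div r then e2pi (real m * ((real p - real r) * \<alpha>)) else 0)"
            by (simp add: g_def)
        qed
        also have "\<dots> = (\<Sum>m\<in>{m \<in> {1..N}. m \<le> N div p \<and> m \<le> N div r}. e2pi (real m * ((real p - real r) * \<alpha>)))"
          by (simp only: sum.inter_filter[OF finite_atLeastAtMost])
        also have "\<dots> = (\<Sum>m=1..min (N div p) (N div r). e2pi (real m * ((real p - real r) * \<alpha>)))"
          by (rule sum.cong) (auto intro: order_trans[OF _ div_le_dividend])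
        finally have eq: "(\<Sum>m=1..N. g p m * cnj (g r m)) = (\<Sum>m=1..min (N div p) (N div r). e2pi (real m * ((real p - real r) * \<alpha>)))" .
        show "norm (\<Sum>m=1..N. g p m * cnj (g r m)) \<le> (if r = p then real N / real p else 0) + 2 / norm (1 - e2pi ((real p - real r) * \<alpha>))"
        proof (cases "r = p")
          case True
          have "norm (\<Sum>m=1..min (N div p) (N div r). e2pi (real m * ((real p - real r) * \<alpha>))) \<le> (\<Sum>m=1..min (N div p) (N div r). 1)"
            by (rule sum_norm_le) simp
          also have "\<dots> = real (N div p)" using True by simp
          also have "\<dots> \<le> real N / real p" by (rule of_nat_div_le_of_nat)
          finally have b: "norm (\<Sum>m=1..min (N div p) (N div r). e2pi (real m * ((real p - real r) * \<alpha>))) \<le> real N / real p" .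
          show ?thesis unfolding eq if_P[OF True] by (rule add_increasing2[OF _ b]) simp
        next
          case False
          have "(real p - real r) * \<alpha> \<notin> \<int>"
          proof
            assume "(real p - real r) * \<alpha> \<in> \<int>"
            then obtain n where "(real p - real r) * \<alpha> = of_int n" by (rule Ints_cases)
            then have "\<alpha> = of_int n / of_int (int p - int r)" using False by (simp add: field_simps)
            then have "\<alpha> \<in> \<rat>" by (simp only:) (intro Rats_divide Rats_of_int)
            with \<alpha> show False by blast
          qed
          then show ?thesis unfolding eq using False e2pi_geometric_bound by simp
        qed
      qed
      also have "\<dots> = real N * A + C"
      proof -
        have d: "(\<Sum>r\<in>P. if r = p then x else 0) = x" if "p \<in> P" for p and x :: real using that P(1) by simp
        show ?thesis unfolding sum.distrib C_def A_def sum_distrib_left by (simp add: d)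
      qed
      finally show ?thesis .
    qed
    finally show ?thesis by (simp add: mult_left_mono)
  qed
  have "\<forall>\<^sub>F N in sequentially. real N \<ge> max 1 (max (C / A) (2 * real (card P)))"
    using filterlim_real_sequentially unfolding filterlim_at_top by blast
  then show "\<forall>\<^sub>F N in sequentially. dist ((\<Sum>n=1..N. e2pi (real n * \<alpha>) * a (prime_Omega n)) / of_nat N) 0 < \<epsilon>"
  proof eventually_elim
    case (elim N)
    \<comment> \<open>From here on both lower-order terms, \<open>C\<close> and 2 A card P, are
      absorbed into N A.\<close>
    then have N: "real N \<ge> 1" "C \<le> real N * A" "2 * real (card P) \<le> real N" using A by (auto simp: field_simps)
    let ?S = "\<Sum>n=1..N. c n"
    have "A * (2 * real (card P)) \<le> A * real N" using A N by (intro mult_left_mono) auto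
    then have e1: "sqrt (real N * (real N * A + 2 * A * real (card P))) \<le> sqrt (real N * (real N * A + real N * A))"
      using N by (intro real_sqrt_le_mono mult_left_mono add_left_mono) (auto simp: mult_ac)
    have e2: "sqrt (real N * (real N * A + C)) \<le> sqrt (real N * (real N * A + real N * A))"
      using N by (intro real_sqrt_le_mono mult_left_mono add_left_mono) auto
    have e3: "sqrt (real N * (real N * A + real N * A)) = real N * sqrt (2 * A)"
    proof -
      have "real N * (real N * A + real N * A) = (real N)\<^sup>2 * (2 * A)" by (simp add: power2_eq_square algebra_simps)
      then show ?thesis by (simp add: real_sqrt_mult)
    qed
    have "norm (of_real A * ?S) \<le> norm (of_real A * ?S - (\<Sum>p\<in>P. \<Sum>m=1..N div p. c (p * m))) + norm (\<Sum>p\<in>P. \<Sum>m=1..N div p. c (p * m))"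
      using norm_triangle_ineq[of "of_real A * ?S - (\<Sum>p\<in>P. \<Sum>m=1..N div p. c (p * m))" "\<Sum>p\<in>P. \<Sum>m=1..N div p. c (p * m)"] by simp
    also have "\<dots> \<le> real N * sqrt (2 * A) + real N * sqrt (2 * A)"
      using tk[of N] bil[of N] e1 e2 unfolding e3 by linarith
    finally have "A * norm ?S \<le> real N * (2 * sqrt (2 * A))" using A by (simp add: norm_mult)
    also have "2 * sqrt (2 * A) < A * \<epsilon>"
    proof -
      have "sqrt (8 * A) < A * \<epsilon>"
      proof (rule real_less_lsqrt)
        have "8 * A < 16 * A" using A by simp
        also have "16 * A \<le> (A * \<epsilon>\<^sup>2) * A" using A \<epsilon> by (intro mult_right_mono) (auto simp: pos_divide_less_eq)
        also have "\<dots> = (A * \<epsilon>)\<^sup>2" by (simp add: power2_eq_square)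
        finally show "8 * A < (A * \<epsilon>)\<^sup>2" .
      qed (use A \<epsilon> in auto)
      moreover have "2 * sqrt (2 * A) = sqrt (8 * A)"
        using real_sqrt_mult[of 4 "2 * A"] by simp
      ultimately show ?thesis by simp
    qed
    finally have "A * norm ?S < A * (real N * \<epsilon>)" using N by (simp add: mult_ac)
    then have "norm ?S < real N * \<epsilon>" using A by simp
    then show ?case using N unfolding c_def by (simp add: norm_divide pos_divide_less_eq mult.commute)
  qed
qed

section \<open>Combining all frequencies with the ergodic averages\<close>

lemma e2pi_mean_zero:
  assumes "\<alpha> \<notin> \<int>" shows "(\<lambda>N. (\<Sum>n=1..N. e2pi (real n * \<alpha>)) / of_nat N) \<longlonglongrightarrow> 0"
proof (rule Lim_null_comparison)
  let ?B = "2 / norm (1 - e2pi \<alpha>)"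
  show "\<forall>\<^sub>F N in sequentially. norm ((\<Sum>n=1..N. e2pi (real n * \<alpha>)) / of_nat N) \<le> ?B * (1 / real N)"
  proof (intro always_eventually allI)
    fix N
    have "norm (\<Sum>n=1..N. e2pi (real n * \<alpha>)) / real N \<le> ?B / real N"
      by (intro divide_right_mono e2pi_geometric_bound assms) simp
    then show "norm ((\<Sum>n=1..N. e2pi (real n * \<alpha>)) / of_nat N) \<le> ?B * (1 / real N)"
      by (simp only: norm_divide norm_of_nat times_divide_eq_right mult_1_right)
  qed
  have "(\<lambda>N. ?B * (1 / real N)) \<longlonglongrightarrow> ?B * 0" by (intro tendsto_intros lim_1_over_n[unfolded inverse_eq_divide])
  then show "(\<lambda>N. ?B * (1 / real N)) \<longlonglongrightarrow> 0" by simp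
qed

text \<open>A denominator of a rational \<alpha> is a period of the weight, which leads back to
  characters; irrational \<alpha> falls under Katai's argument.\<close>

theorem e2pi_Omega_mean_zero:
  assumes um: "uniformly_mean_zero a"
  shows "(\<lambda>N. (\<Sum>n=1..N. e2pi (real n * \<alpha>) * a (prime_Omega n)) / of_nat N) \<longlonglongrightarrow> 0"
proof (cases "\<alpha> \<in> \<rat>")
  case True
  then obtain r q where rq0: "q > 0" "\<alpha> = of_int r / of_int q" by (rule Rats_cases') (rule that)
  define k where "k = nat q"
  have k: "k > 0" "real k = of_int q" using rq0(1) by (auto simp: k_def)
  have "real k * \<alpha> = of_int r" using rq0 by (simp add: k(2))
  then have "real k * \<alpha> \<in> \<int>" by simp
  then have "e2pi (real k * \<alpha>) = 1" using e2pi_eq_1_iff by blast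
  then have "e2pi (real (n + k) * \<alpha>) = e2pi (real n * \<alpha>)" for n by (simp add: distrib_right e2pi_add)
  then have "Omega_null (\<lambda>n. e2pi (real n * \<alpha>))" by (intro Omega_null_periodic[OF k(1)])
  then show ?thesis using um by (simp add: Omega_null_def)
next
  case False
  then show ?thesis using um by (intro e2pi_Omega_irrational) (auto simp: uniformly_mean_zero_def)
qed

theorem corollary1p25:
  fixes T :: "'a::metric_space \<Rightarrow> 'a"
    and \<mu> :: "'a measure"
    and \<alpha> :: real
    and f :: "'a \<Rightarrow> complex"
    and x :: 'a
  assumes "compact (UNIV :: 'a set)"
    and "continuous_on UNIV T"
    and "uniquely_ergodic T"
    and "invariant_borel_prob T \<mu>"
    and "continuous_on UNIV f"
  shows "(\<lambda>N::nat. 1 / of_nat N * (\<Sum>n=1..N. e2pi (real n * \<alpha>) * f ((T ^^ prime_Omega n) x)))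
    \<longlonglongrightarrow> (if \<alpha> \<in> \<int> then \<integral>y. f y \<partial>\<mu> else 0)"
proof -
  define I where "I = (\<integral>y. f y \<partial>\<mu>)"
  have "bounded (range f)" using compact_imp_bounded[OF compact_continuous_image[OF assms(5,1)]] .
  then obtain B where B: "\<And>y. norm (f y) \<le> B" by (auto simp: bounded_iff)
  \<comment> \<open>Scales f - I to norm at most 1; the summand 1 keeps \<open>K\<close>
    positive.\<close>
  define K where "K = \<bar>B\<bar> + norm I + 1"
  have K: "K > 0" by (simp add: K_def add_nonneg_pos)
  define a where "a k = (f ((T ^^ k) x) - I) / of_real K" for k
  have "norm (a k) \<le> 1" for k
  proof -
    have "norm (f ((T ^^ k) x) - I) \<le> K"
      unfolding K_def using norm_triangle_ineq4[of "f ((T ^^ k) x)" I] B[of "(T ^^ k) x"] by linarith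
    then show ?thesis using K by (simp add: a_def norm_divide)
  qed
  moreover have "\<exists>H>0. \<forall>m. norm ((\<Sum>k<H. a (m + k)) / of_nat H) \<le> \<epsilon>" if \<epsilon>: "\<epsilon> > 0" for \<epsilon>
  proof -
    obtain H where H: "H > 0" "\<And>y. norm ((\<Sum>k<H. f ((T ^^ k) y)) / of_nat H - I) \<le> \<epsilon> * K"
      using uniquely_ergodic_uniform[OF assms, of "\<epsilon> * K"] \<epsilon> K unfolding I_def by auto
    have "norm ((\<Sum>k<H. a (m + k)) / of_nat H) \<le> \<epsilon>" for m
    proof -
      \<comment> \<open>A block of \<open>a\<close> beginning at m is an ergodic sum started at T^m
        x; hence the need for uniformity in the starting point.\<close>
      have "(T ^^ (m + k)) x = (T ^^ k) ((T ^^ m) x)" for k by (simp add: add.commute[of m] funpow_add)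
      then have "(\<Sum>k<H. a (m + k)) / of_nat H = ((\<Sum>k<H. f ((T ^^ k) ((T ^^ m) x))) / of_nat H - I) / of_real K"
        using H(1) by (simp add: a_def sum_divide_distrib[symmetric] sum_subtractf diff_divide_distrib)
      then have "norm ((\<Sum>k<H. a (m + k)) / of_nat H) = norm ((\<Sum>k<H. f ((T ^^ k) ((T ^^ m) x))) / of_nat H - I) / K"
        using K by (simp add: norm_divide)
      also have "\<dots> \<le> (\<epsilon> * K) / K" using H(2) K by (intro divide_right_mono) auto
      finally show ?thesis using K by simp
    qed
    then show ?thesis using H(1) by blast
  qed
  ultimately have um: "uniformly_mean_zero a" by (simp add: uniformly_mean_zero_def)
  have fa: "f ((T ^^ k) x) = of_real K * a k + I" for k using K by (simp add: a_def)
  \<comment> \<open>The constant I splits off with the plain mean of e(n\<alpha>), which alone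
    decides between the two cases of the limit.\<close>
  have eq: "1 / of_nat N * (\<Sum>n=1..N. e2pi (real n * \<alpha>) * f ((T ^^ prime_Omega n) x)) =
    of_real K * ((\<Sum>n=1..N. e2pi (real n * \<alpha>) * a (prime_Omega n)) / of_nat N) + I * ((\<Sum>n=1..N. e2pi (real n * \<alpha>)) / of_nat N)" for N
    unfolding fa distrib_left sum.distrib by (simp add: sum_distrib_left sum_divide_distrib mult_ac)
  have "(\<lambda>N. (\<Sum>n=1..N. e2pi (real n * \<alpha>)) / of_nat N) \<longlonglongrightarrow> (if \<alpha> \<in> \<int> then 1 else 0)"
  proof (cases "\<alpha> \<in> \<int>")
    case True
    have "e2pi (real n * \<alpha>) = 1" for n unfolding e2pi_eq_1_iff using True by (intro Ints_mult) auto
    moreover have "\<forall>\<^sub>F N in sequentially. (of_nat N / of_nat N :: complex) = 1"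
      using eventually_gt_at_top[of 0] by eventually_elim simp
    ultimately show ?thesis using True by (simp add: tendsto_eventually)
  next
    case False
    then show ?thesis using e2pi_mean_zero by simp
  qed
  then have "(\<lambda>N. of_real K * ((\<Sum>n=1..N. e2pi (real n * \<alpha>) * a (prime_Omega n)) / of_nat N) + I * ((\<Sum>n=1..N. e2pi (real n * \<alpha>)) / of_nat N))
    \<longlonglongrightarrow> of_real K * 0 + I * (if \<alpha> \<in> \<int> then 1 else 0)"
    by (intro tendsto_intros e2pi_Omega_mean_zero um)
  moreover have "of_real K * 0 + I * (if \<alpha> \<in> \<int> then 1 else 0) = (if \<alpha> \<in> \<int> then I else 0)" by simp
  ultimately show ?thesis unfolding eq I_def[symmetric] by (simp only:)
qed

end
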